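(* Unit 2-Interval Recognition is NP-complete, even for graphs of degree at most 7.
   Context: A $d$-interval is the union of $d$ disjoint closed intervals on the real line; it is unit if every one of its intervals has length 1. A graph is a unit $d$-interval graph if it is the intersection graph of a family of unit $d$-intervals (vertices adjacent iff their $d$-intervals intersect). Unit 2-Interval Recognition: given a graph $G$, decide whether $G$ has a unit 2-interval representation. *)

theory Defs
  imports Complex_Main "HOL-Library.Disjoint_Sets" "HOL-Computational_Algebra.Polynomial"
begin

section \<open>Deterministic multi-tape Turing machines\<close>

text \<open>
  States and tape symbols are initial segments of the natural numbers. Tapes are infinite in both
  directions; a tape is given by its contents and the position of its head. Symbol 0 is the blank,
  1 and 2 stand for the bits, and 3 is the separator between the two arguments of a verifier.
  Machines may use further symbols.
\<close>

datatype dir = MoveLeft | Stay | MoveRight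

record turing_machine =
  tape_count :: nat
  symbol_count :: nat
  state_count :: nat
  start_state :: nat
  accept_state :: nat
  reject_state :: nat
  delta :: "nat \<Rightarrow> nat list \<Rightarrow> nat \<times> (nat \<times> dir) list"

definition wf_tm :: "turing_machine \<Rightarrow> bool" where
  "wf_tm M \<longleftrightarrow>
     1 \<le> tape_count M \<and> 4 \<le> symbol_count M \<and>
     start_state M < state_count M \<and> accept_state M < state_count M \<and>
     reject_state M < state_count M \<and> accept_state M \<noteq> reject_state M \<and>
     (\<forall>q < state_count M. \<forall>ss. length ss = tape_count M \<and> set ss \<subseteq> {..<symbol_count M} \<longrightarrow>
        (case delta M q ss of (q', as) \<Rightarrow>
           q' < state_count M \<and> length as = tape_count M \<and>
           (\<forall>(a, d) \<in> set as. a < symbol_count M)))"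

type_synonym tape = "(int \<Rightarrow> nat) \<times> int"
type_synonym config = "nat \<times> tape list"

fun offset :: "dir \<Rightarrow> int" where
  "offset MoveLeft = -1"
| "offset Stay = 0"
| "offset MoveRight = 1"

fun read_tape :: "tape \<Rightarrow> nat" where
  "read_tape (t, h) = t h"

fun act_tape :: "tape \<Rightarrow> nat \<times> dir \<Rightarrow> tape" where
  "act_tape (t, h) (a, d) = (t(h := a), h + offset d)"

definition halted :: "turing_machine \<Rightarrow> config \<Rightarrow> bool" where
  "halted M c \<longleftrightarrow> fst c = accept_state M \<or> fst c = reject_state M"

text \<open>Halted configurations are fixed points of \<open>step\<close>.\<close>

definition step :: "turing_machine \<Rightarrow> config \<Rightarrow> config" where
  "step M c =
     (if halted M c then c
      else case delta M (fst c) (map read_tape (snd c)) of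
        (q', as) \<Rightarrow> (q', map2 act_tape (snd c) as))"

definition word_contents :: "nat list \<Rightarrow> int \<Rightarrow> nat" where
  "word_contents w i = (if 0 \<le> i \<and> i < int (length w) then w ! nat i else 0)"

definition init_config :: "turing_machine \<Rightarrow> nat list \<Rightarrow> config" where
  "init_config M w =
     (start_state M, (word_contents w, 0) # replicate (tape_count M - 1) (word_contents [], 0))"

definition run :: "turing_machine \<Rightarrow> nat list \<Rightarrow> nat \<Rightarrow> config" where
  "run M w t = (step M ^^ t) (init_config M w)"

section \<open>Polynomial-time reductions and NP-completeness\<close>

type_synonym language = "bool list set"

definition encode_word :: "bool list \<Rightarrow> nat list" where
  "encode_word x = map (\<lambda>b. if b then 2 else 1) x"

definition encode_pair :: "bool list \<Rightarrow> bool list \<Rightarrow> nat list" where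
  "encode_pair x y = encode_word x @ [3] @ encode_word y"

text \<open>
  Since halted configurations persist, looking at the configuration after exactly
  \<open>poly p n\<close> steps amounts to halting within that many steps. The output is the
  complete non-blank contents of the last tape.
\<close>

definition polytime_computable :: "(bool list \<Rightarrow> bool list) \<Rightarrow> bool" where
  "polytime_computable f \<longleftrightarrow>
     (\<exists>M. \<exists>p :: nat poly. wf_tm M \<and>
        (\<forall>x. let c = run M (encode_word x) (poly p (length x)) in
               halted M c \<and> fst (last (snd c)) = word_contents (encode_word (f x))))"

definition polytime_decidable_rel :: "(bool list \<Rightarrow> bool list \<Rightarrow> bool) \<Rightarrow> bool" where
  "polytime_decidable_rel R \<longleftrightarrow>
     (\<exists>M. \<exists>p :: nat poly. wf_tm M \<and>
        (\<forall>x y. let c = run M (encode_pair x y) (poly p (length (encode_pair x y))) in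
                 halted M c \<and> (fst c = accept_state M \<longleftrightarrow> R x y)))"

definition in_NP :: "language \<Rightarrow> bool" where
  "in_NP L \<longleftrightarrow>
     (\<exists>R. \<exists>p :: nat poly. polytime_decidable_rel R \<and>
        (\<forall>x. x \<in> L \<longleftrightarrow> (\<exists>y. length y \<le> poly p (length x) \<and> R x y)))"

definition polytime_reducible :: "language \<Rightarrow> language \<Rightarrow> bool" where
  "polytime_reducible K L \<longleftrightarrow>
     (\<exists>f. polytime_computable f \<and> (\<forall>x. x \<in> K \<longleftrightarrow> f x \<in> L))"

definition NP_hard :: "language \<Rightarrow> bool" where
  "NP_hard L \<longleftrightarrow> (\<forall>K. in_NP K \<longrightarrow> polytime_reducible K L)"

definition NP_complete :: "language \<Rightarrow> bool" where
  "NP_complete L \<longleftrightarrow> in_NP L \<and> NP_hard L"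

section \<open>Graphs and unit multiple-interval representations\<close>

text \<open>A graph is a vertex set with an adjacency relation, relevant only on the vertex set.\<close>

definition simple_graph :: "'a set \<Rightarrow> ('a \<Rightarrow> 'a \<Rightarrow> bool) \<Rightarrow> bool" where
  "simple_graph V E \<longleftrightarrow>
     finite V \<and> (\<forall>v\<in>V. \<not> E v v) \<and> (\<forall>u\<in>V. \<forall>v\<in>V. E u v \<longrightarrow> E v u)"

definition degree_in :: "'a set \<Rightarrow> ('a \<Rightarrow> 'a \<Rightarrow> bool) \<Rightarrow> 'a \<Rightarrow> nat" where
  "degree_in V E v = card {u \<in> V. E v u}"

definition max_degree_le :: "nat \<Rightarrow> 'a set \<Rightarrow> ('a \<Rightarrow> 'a \<Rightarrow> bool) \<Rightarrow> bool" where
  "max_degree_le k V E \<longleftrightarrow> (\<forall>v\<in>V. degree_in V E v \<le> k)"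

definition unit_d_interval :: "nat \<Rightarrow> real set \<Rightarrow> bool" where
  "unit_d_interval d S \<longleftrightarrow>
     (\<exists>\<I>. finite \<I> \<and> card \<I> = d \<and> disjoint \<I> \<and> (\<forall>I\<in>\<I>. \<exists>a. I = {a..a + 1}) \<and> S = \<Union>\<I>)"

definition unit_d_interval_graph :: "nat \<Rightarrow> 'a set \<Rightarrow> ('a \<Rightarrow> 'a \<Rightarrow> bool) \<Rightarrow> bool" where
  "unit_d_interval_graph d V E \<longleftrightarrow>
     (\<exists>\<phi>. (\<forall>v\<in>V. unit_d_interval d (\<phi> v)) \<and>
          (\<forall>u\<in>V. \<forall>v\<in>V. u \<noteq> v \<longrightarrow> (E u v \<longleftrightarrow> \<phi> u \<inter> \<phi> v \<noteq> {})))"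

section \<open>Recognition problems as languages\<close>

text \<open>
  A graph with vertices \<open>0, \<dots>, n - 1\<close> is given by the rows of its adjacency matrix; the length
  \<open>n * n\<close> of the word determines \<open>n\<close>. Words that are not the encoding of a simple
  graph are no-instances.
\<close>

definition encode_graph :: "nat \<Rightarrow> (nat \<Rightarrow> nat \<Rightarrow> bool) \<Rightarrow> bool list" where
  "encode_graph n E = concat (map (\<lambda>i. map (\<lambda>j. E i j) [0..<n]) [0..<n])"

definition unit_2_interval_recognition :: language where
  "unit_2_interval_recognition =
     {encode_graph n E | n E. simple_graph {..<n} E \<and> unit_d_interval_graph 2 {..<n} E}"

definition unit_2_interval_recognition_max_degree :: "nat \<Rightarrow> language" where
  "unit_2_interval_recognition_max_degree k =
     {encode_graph n E | n E. simple_graph {..<n} E \<and> max_degree_le k {..<n} E \<and>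
        unit_d_interval_graph 2 {..<n} E}"

end

theory Submission
  imports Defs "HOL-Library.Countable"
begin

text \<open>
  Hardness is by a direct reduction from the acceptance problem of a verifier. Its computation is
  written as a propositional formula whose clauses and literals are first-order definable with
  bounded quantifiers in the input, and the formula becomes a graph with a grid of cells, one for
  every clause and every variable. In a cell two intervals are hidden: a copy of
  \<open>K\<^sub>4\<^sub>,\<^sub>4\<close> minus an edge swallows one interval of the vertices \<open>A\<close> and \<open>M\<close>, so all other neighbours
  of \<open>A\<close> meet a single unit interval. At most two of several mutually adjacent neighbours can stick
  out of that interval, one at either end, and a pendant vertex uses up one end. Along a column this
  propagates the value of a variable, along a row it forces a true literal.
  For membership the certificate lists the order of all interval endpoints together with the
  semiorder of closeness. Verifier and reduction are bounded formulas, and these are compiled to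
  register programs and then to Turing machines.
\<close>

section \<open>Unit 2-interval representations by left endpoints\<close>

text \<open>A vertex with two free intervals can serve its neighbours in two unrelated places, so
  little is forced locally. Once one interval is hidden, the other neighbours crowd around a single
  unit interval, and its two ends become a scarce resource. Rows then work by counting. The
  \<open>M\<close> vertices of a row with N columns have 2N ends. The \<open>h\<close> of column 0
  is adjacent to the first and the last \<open>M\<close> but to none of its competitors there, so it
  blocks one end at each. Each of the other N - 1 vertices \<open>h\<close> needs an end, and every
  \<open>s\<close> takes one more unless it is a literal served at its \<open>A\<close>. As 2N - 1
  exceeds 2N - 2, some \<open>s\<close> must be served at its \<open>A\<close>, which only a true
  literal can be. The degree 7 is that of \<open>v\<close>: two \<open>A\<close>, two
  \<open>s\<close>, two further \<open>v\<close> and a contact.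

  Hardness must start from an arbitrary verifier, and a Turing machine must compute the reduction.
  The regular grid makes adjacency of two numbered vertices expressible by one bounded formula, so a
  single compiler serves both the reduction and the verifier.\<close>

lemma unit_intervals_meet: "{x..x + 1} \<inter> {y..y + 1} \<noteq> {} \<longleftrightarrow> \<bar>x - y\<bar> \<le> (1::real)"
proof
  assume "\<bar>x - y\<bar> \<le> 1"
  then have "max x y \<in> {x..x + 1} \<inter> {y..y + 1}" by (auto simp: max_def)
  then show "{x..x + 1} \<inter> {y..y + 1} \<noteq> {}" by blast
qed auto

lemma unit_2_interval_iff:
  "unit_d_interval 2 S \<longleftrightarrow> (\<exists>x y. x + 1 < y \<and> S = {x..x + 1} \<union> {y..y + 1})"
proof
  assume "unit_d_interval 2 S"
  then obtain \<I> where I: "card \<I> = 2" "disjoint \<I>" "\<forall>I\<in>\<I>. \<exists>a. I = {a..a + 1}" "S = \<Union>\<I>"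
    unfolding unit_d_interval_def by blast
  obtain A B where AB: "\<I> = {A, B}" "A \<noteq> B" using I(1) by (auto simp: card_2_iff)
  obtain x y where xy: "A = {x..x + 1}" "B = {y..y + 1}" using I(3) AB by auto
  have "A \<inter> B = {}" using I(2) AB by (auto simp: disjoint_def)
  then have "x + 1 < y \<or> y + 1 < x" using unit_intervals_meet[of x y] xy by (auto simp: abs_if split: if_splits)
  moreover have "S = {x..x + 1} \<union> {y..y + 1}" using I(4) AB xy by auto
  ultimately show "\<exists>x y. x + 1 < y \<and> S = {x..x + 1} \<union> {y..y + 1}" by (metis Un_commute)
next
  assume "\<exists>x y. x + 1 < y \<and> S = {x..x + 1} \<union> {y..y + 1}"
  then obtain x y where xy: "x + 1 < y" "S = {x..x + 1} \<union> {y..y + 1}" by blast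
  have "x \<in> {x..x + 1}" "x \<notin> {y..y + 1}" using xy by auto
  then have ne: "{x..x + 1} \<noteq> {y..y + 1}" by blast
  show "unit_d_interval 2 S" unfolding unit_d_interval_def
    by (rule exI[of _ "{{x..x + 1}, {y..y + 1}}"]) (use xy ne in \<open>auto simp: disjoint_def card_2_iff\<close>)
qed

text \<open>The boolean names the two intervals of a vertex, in no particular order; each is given
  by its left endpoint.\<close>

type_synonym 'a layout = "'a \<Rightarrow> bool \<Rightarrow> real"

definition touch :: "'a layout \<Rightarrow> 'a \<Rightarrow> 'a \<Rightarrow> bool" where
  "touch L u v \<longleftrightarrow> (\<exists>i k. \<bar>L u i - L v k\<bar> \<le> 1)"

definition represents :: "'a layout \<Rightarrow> 'a set \<Rightarrow> ('a \<Rightarrow> 'a \<Rightarrow> bool) \<Rightarrow> bool" where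
  "represents L V E \<longleftrightarrow> (\<forall>v\<in>V. \<bar>L v False - L v True\<bar> > 1) \<and>
     (\<forall>u\<in>V. \<forall>v\<in>V. u \<noteq> v \<longrightarrow> (E u v \<longleftrightarrow> touch L u v))"

lemma touch_iff_meet:
  "touch L u v \<longleftrightarrow> (\<Union>i. {L u i..L u i + 1}) \<inter> (\<Union>i. {L v i..L v i + 1}) \<noteq> {}"
proof -
  have "(\<Union>i. {L u i..L u i + 1}) \<inter> (\<Union>i. {L v i..L v i + 1}) \<noteq> {} \<longleftrightarrow>
    (\<exists>i k. {L u i..L u i + 1} \<inter> {L v k..L v k + 1} \<noteq> {})" by blast
  then show ?thesis unfolding unit_intervals_meet touch_def by simp
qed

lemma Union_bool: "(\<Union>i::bool. f i) = f False \<union> f True"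
  by (auto simp: UNIV_bool)

lemma unit_2_interval_graph_iff: "unit_d_interval_graph 2 V E \<longleftrightarrow> (\<exists>L. represents L V E)"
proof
  assume "unit_d_interval_graph 2 V E"
  then obtain \<phi> where \<phi>: "\<And>v. v \<in> V \<Longrightarrow> unit_d_interval 2 (\<phi> v)"
    "\<And>u v. u \<in> V \<Longrightarrow> v \<in> V \<Longrightarrow> u \<noteq> v \<Longrightarrow> E u v \<longleftrightarrow> \<phi> u \<inter> \<phi> v \<noteq> {}"
    unfolding unit_d_interval_graph_def by blast
  have "\<forall>v\<in>V. \<exists>x y. x + 1 < y \<and> \<phi> v = {x..x + 1} \<union> {y..y + 1}"
    using \<phi>(1) unit_2_interval_iff by blast
  then obtain x y where xy: "\<And>v. v \<in> V \<Longrightarrow> x v + 1 < y v \<and> \<phi> v = {x v..x v + 1} \<union> {y v..y v + 1}"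
    by metis
  let ?L = "\<lambda>v i. if i then y v else x v"
  have \<phi>L: "\<phi> v = (\<Union>i. {?L v i..?L v i + 1})" if "v \<in> V" for v using xy[OF that] unfolding Union_bool by simp
  have "E u v \<longleftrightarrow> touch ?L u v" if "u \<in> V" "v \<in> V" "u \<noteq> v" for u v
    using \<phi>(2)[OF that] unfolding touch_iff_meet \<phi>L[OF that(1)] \<phi>L[OF that(2)] .
  moreover have "\<bar>?L v False - ?L v True\<bar> > 1" if "v \<in> V" for v using xy[OF that] by simp
  ultimately have "represents ?L V E" unfolding represents_def by blast
  then show "\<exists>L. represents L V E" by (rule exI[of _ ?L])
next
  assume "\<exists>L. represents L V E"
  then obtain L where L: "represents L V E" ..
  let ?\<phi> = "\<lambda>v. \<Union>i. {L v i..L v i + 1}"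
  have "unit_d_interval 2 (?\<phi> v)" if "v \<in> V" for v
  proof -
    have d: "\<bar>L v False - L v True\<bar> > 1" using L that by (simp add: represents_def)
    show ?thesis
  proof (cases "L v False \<le> L v True")
    case True
    then show ?thesis unfolding unit_2_interval_iff Union_bool
      by (intro exI[of _ "L v False"] exI[of _ "L v True"]) (use d True in \<open>auto simp: abs_if split: if_splits\<close>)
  next
    case False
    then show ?thesis unfolding unit_2_interval_iff Union_bool
      by (intro exI[of _ "L v True"] exI[of _ "L v False"]) (use d False in \<open>auto simp: abs_if split: if_splits\<close>)
  qed
  qed
  moreover have "E u v \<longleftrightarrow> ?\<phi> u \<inter> ?\<phi> v \<noteq> {}" if "u \<in> V" "v \<in> V" "u \<noteq> v" for u v
  proof -
    have "E u v \<longleftrightarrow> touch L u v" using L that unfolding represents_def by blast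
    then show ?thesis unfolding touch_iff_meet .
  qed
  ultimately show "unit_d_interval_graph 2 V E" unfolding unit_d_interval_graph_def
    by (intro exI[of _ ?\<phi>]) blast
qed

section \<open>A gadget that hides one interval\<close>

text \<open>The sides are 0 to 3 and 4 to 7, and edges are oriented from the first to the second.
  Without the edge 04 there are 15 edges, one less than there are intervals, and 0 and 4 are the
  only vertices of odd degree.\<close>

definition k44 :: "nat \<Rightarrow> nat \<Rightarrow> bool" where
  "k44 a b \<longleftrightarrow> a < 4 \<and> 4 \<le> b \<and> b < 8 \<and> \<not> (a = 0 \<and> b = 4)"

lemma card_k44: "card {(a, b). k44 a b} = 15"
proof -
  have "{(a, b). k44 a b} = {..<4} \<times> {4..<8} - {(0, 4)}" by (auto simp: k44_def)
  then show ?thesis by (simp add: card_Diff_singleton)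
qed

text \<open>
  In a triangle-free graph every interval meets at most one interval to its right. The 15 edges thus
  use up all 16 intervals but the last one, so the intervals form a chain; its two ends belong to
  the vertices 0 and 4 of degree 3.
\<close>

locale k44_layout =
  fixes G :: "nat \<Rightarrow> bool \<Rightarrow> real"
  assumes sep: "\<And>a. a < 8 \<Longrightarrow> \<bar>G a False - G a True\<bar> > 1"
    and edges: "\<And>a b. a < 8 \<Longrightarrow> b < 8 \<Longrightarrow> a \<noteq> b \<Longrightarrow> touch G a b \<longleftrightarrow> k44 a b \<or> k44 b a"
begin

text \<open>The two intervals of a vertex are disjoint, so three pairwise meeting intervals belong
  to three vertices and would form a triangle in a bipartite graph.\<close>

lemma no_triple:
  assumes "a < 8" "b < 8" "c < 8" "(a, i) \<noteq> (b, k)" "(a, i) \<noteq> (c, l)" "(b, k) \<noteq> (c, l)"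
    "\<bar>G a i - G b k\<bar> \<le> 1" "\<bar>G a i - G c l\<bar> \<le> 1" "\<bar>G b k - G c l\<bar> \<le> 1"
  shows False
proof -
  have same: "i = k" if "\<bar>G a i - G a k\<bar> \<le> 1" "a < 8" for a i k
    using sep[OF that(2)] that(1) by (cases i; cases k) (auto simp: abs_minus_commute)
  have "a \<noteq> b" "a \<noteq> c" "b \<noteq> c" using same assms by blast+
  moreover have "touch G a b" "touch G a c" "touch G b c" using assms unfolding touch_def by blast+
  ultimately have "k44 a b \<or> k44 b a" "k44 a c \<or> k44 c a" "k44 b c \<or> k44 c b"
    using edges assms(1-3) by auto
  then show False by (auto simp: k44_def)
qed

definition pos :: "nat \<times> bool \<Rightarrow> real" where "pos x = G (fst x) (snd x)"

text \<open>Ties between left endpoints are broken by the index, so that every meeting pair has an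
  earlier and a later member.\<close>

definition before :: "nat \<times> bool \<Rightarrow> nat \<times> bool \<Rightarrow> bool" where
  "before x y \<longleftrightarrow> pos x < pos y \<or> pos x = pos y \<and> 2 * fst x + of_bool (snd x) < 2 * fst y + of_bool (snd y)"

abbreviation P :: "(nat \<times> bool) set" where "P \<equiv> {..<8} \<times> UNIV"

lemma before_linear: "x \<noteq> y \<Longrightarrow> before x y \<or> before y x"
  unfolding before_def by (cases x; cases y) (auto; presburger)

lemma before_trans: "before x y \<Longrightarrow> before y z \<Longrightarrow> before x z"
  unfolding before_def by auto

lemma before_irrefl: "\<not> before x x"
  unfolding before_def by auto

lemma before_pos: "before x y \<Longrightarrow> pos x \<le> pos y"
  unfolding before_def by auto

lemma obtain_last:
  assumes "Q \<subseteq> P" "Q \<noteq> {}"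
  obtains m where "m \<in> Q" "\<And>x. x \<in> Q \<Longrightarrow> x \<noteq> m \<Longrightarrow> before x m"
proof -
  have "finite Q" using assms(1) by (rule finite_subset) simp
  then have "\<exists>m\<in>Q. \<forall>x\<in>Q. x \<noteq> m \<longrightarrow> before x m" using assms(2)
  proof (induction Q rule: finite_ne_induct)
    case (insert x F)
    then obtain m where m: "m \<in> F" "\<forall>x\<in>F. x \<noteq> m \<longrightarrow> before x m" by blast
    show ?case
    proof (cases "before x m")
      case True
      then show ?thesis using m by blast
    next
      case False
      then have "before m x" using before_linear[of x m] m(1) insert.hyps by blast
      then have "\<forall>y\<in>insert x F. y \<noteq> x \<longrightarrow> before y x" using m(2) before_trans by (metis insert_iff)
      then show ?thesis by blast
    qed
  qed auto
  then show thesis using that by blast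
qed

lemma obtain_last_all:
  obtains m where "m \<in> P" "\<And>x. x \<in> P \<Longrightarrow> x \<noteq> m \<Longrightarrow> before x m"
proof (rule obtain_last[of P])
  have "(0, False) \<in> P" by simp
  then show "P \<noteq> {}" by blast
qed (use that in blast)+

text \<open>Two unit intervals that start no earlier than \<open>x\<close> and meet it both contain
  its right endpoint, so they would form a triple with it.\<close>

lemma next_unique:
  assumes "x \<in> P" "y \<in> P" "z \<in> P" "before x y" "before x z" "pos y \<le> pos x + 1" "pos z \<le> pos x + 1"
  shows "y = z"
proof (rule ccontr)
  assume "y \<noteq> z"
  moreover have "x \<noteq> y" "x \<noteq> z" using assms before_irrefl by blast+
  moreover have "pos x \<le> pos y" "pos x \<le> pos z" using assms before_pos by blast+
  moreover have "\<bar>pos y - pos z\<bar> \<le> 1" using calculation assms(6,7) by linarith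
  ultimately show False
    using no_triple[of "fst x" "fst y" "fst z" "snd x" "snd y" "snd z"] assms
    by (auto simp: pos_def mem_Times_iff)
qed

lemma has_next:
  assumes "m \<in> P" "\<And>x. x \<in> P \<Longrightarrow> x \<noteq> m \<Longrightarrow> before x m" "x \<in> P" "x \<noteq> m"
  shows "\<exists>y\<in>P. before x y \<and> pos y \<le> pos x + 1"
proof -
  define N where "N = {x \<in> P. \<exists>y\<in>P. before x y \<and> pos y \<le> pos x + 1}"
  have "\<exists>x y. x \<in> P \<and> y \<in> P \<and> before x y \<and> pos y \<le> pos x + 1 \<and> {fst x, fst y} = {a, b}"
    if "k44 a b" for a b
  proof -
    have ab: "a < 8" "b < 8" "a \<noteq> b" using that by (auto simp: k44_def)
    then have "touch G a b" using edges[of a b] that by blast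
    then obtain i k where ik: "\<bar>G a i - G b k\<bar> \<le> 1" unfolding touch_def by blast
    have "before (a, i) (b, k) \<or> before (b, k) (a, i)" using before_linear ab by auto
    then show ?thesis
    proof
      assume "before (a, i) (b, k)"
      then show ?thesis using ab ik by (intro exI[of _ "(a, i)"] exI[of _ "(b, k)"]) (auto simp: pos_def)
    next
      assume "before (b, k) (a, i)"
      then show ?thesis using ab ik by (intro exI[of _ "(b, k)"] exI[of _ "(a, i)"]) (auto simp: pos_def)
    qed
  qed
  then have "\<forall>e\<in>{(a, b). k44 a b}. \<exists>x. x \<in> P \<and> (\<exists>y\<in>P. before x y \<and> pos y \<le> pos x + 1 \<and>
      {fst x, fst y} = {fst e, snd e})" by fastforce
  then obtain f where f: "\<And>e. e \<in> {(a, b). k44 a b} \<Longrightarrow> f e \<in> P \<and> (\<exists>y\<in>P. before (f e) y \<and>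
      pos y \<le> pos (f e) + 1 \<and> {fst (f e), fst y} = {fst e, snd e})"
    by (metis (no_types, lifting))
  \<comment> \<open>The earlier interval of a witness determines the edge, because its successor is
    unique. Hence 15 intervals have a successor, which is all of them except the last.\<close>
  have "inj_on f {(a, b). k44 a b}"
  proof (rule inj_onI)
    fix e e' assume e: "e \<in> {(a, b). k44 a b}" "e' \<in> {(a, b). k44 a b}" "f e = f e'"
    obtain y y' where y: "y \<in> P" "before (f e) y" "pos y \<le> pos (f e) + 1" "{fst (f e), fst y} = {fst e, snd e}"
      "y' \<in> P" "before (f e') y'" "pos y' \<le> pos (f e') + 1" "{fst (f e'), fst y'} = {fst e', snd e'}"
      using f[OF e(1)] f[OF e(2)] by blast
    have "y = y'" using next_unique[of "f e" y y'] f[OF e(1)] y e(3) by auto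
    then have "{fst e, snd e} = {fst e', snd e'}" using y e(3) by auto
    then show "e = e'" using e(1,2) by (auto simp: k44_def doubleton_eq_iff)
  qed
  then have "15 = card (f ` {(a, b). k44 a b})" using card_k44 by (simp add: card_image)
  also have "f ` {(a, b). k44 a b} \<subseteq> N"
  proof
    fix x assume "x \<in> f ` {(a, b). k44 a b}"
    then obtain e where "e \<in> {(a, b). k44 a b}" "x = f e" by blast
    then show "x \<in> N" using f[of e] unfolding N_def by blast
  qed
  then have "card (f ` {(a, b). k44 a b}) \<le> card N" by (intro card_mono) (auto simp: N_def)
  finally have N15: "15 \<le> card N" .
  have NP: "N \<subseteq> P - {m}"
  proof
    fix x assume "x \<in> N"
    then obtain y where "x \<in> P" "y \<in> P" "before x y" by (auto simp: N_def)
    then show "x \<in> P - {m}" using assms(2)[of y] before_trans before_irrefl by (cases "y = m") blast+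
  qed
  have "card (P - {m}) = 15" using assms(1) by (simp add: card_Diff_singleton card_cartesian_product)
  then have "N = P - {m}" using NP N15 by (intro card_seteq) auto
  then show ?thesis using assms(3,4) unfolding N_def by blast
qed

text \<open>Each side of each interval offers room for one neighbour only. A vertex thus has four
  slots, but the last interval has nothing on its right; the three remaining slots are too few for a
  vertex of degree 4.\<close>

lemma last_owner:
  assumes "m \<in> P" "\<And>x. x \<in> P \<Longrightarrow> pos x \<le> pos m"
  shows "fst m = 0 \<or> fst m = 4"
proof (rule ccontr)
  assume ends: "\<not> (fst m = 0 \<or> fst m = 4)"
  obtain a i0 where m: "m = (a, i0)" by (cases m)
  define B where "B = {b. k44 a b \<or> k44 b a}"
  have a: "a < 8" using assms(1) m by auto
  have "B = (if a < 4 then {4..<8} else {..<4})" using a ends m by (auto simp: B_def k44_def)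
  then have cB: "card B = 4" "finite B" by auto
  have B8: "b < 8" "b \<noteq> a" if "b \<in> B" for b using that by (auto simp: B_def k44_def)
  have "\<forall>b\<in>B. \<exists>c. \<bar>G a (fst c) - G b (snd c)\<bar> \<le> 1"
  proof
    fix b assume "b \<in> B"
    then have "touch G a b" using edges[of a b] a B8 unfolding B_def by blast
    then show "\<exists>c. \<bar>G a (fst c) - G b (snd c)\<bar> \<le> 1" unfolding touch_def by auto
  qed
  then obtain c where c: "\<And>b. b \<in> B \<Longrightarrow> \<bar>G a (fst (c b)) - G b (snd (c b))\<bar> \<le> 1" by metis
  \<comment> \<open>The slot used for the neighbour \<open>b\<close>: the interval of
    \<open>a\<close> and the side on which \<open>b\<close> meets it.\<close>
  define cls where "cls b = (fst (c b), G b (snd (c b)) > G a (fst (c b)))" for b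
  have "cls ` B \<subseteq> {(i0, False), (\<not> i0, False), (\<not> i0, True)}"
  proof
    fix z assume "z \<in> cls ` B"
    then obtain b where b: "b \<in> B" "z = cls b" by blast
    have "pos (b, snd (c b)) \<le> pos m" using assms(2) B8[OF b(1)] by auto
    then show "z \<in> {(i0, False), (\<not> i0, False), (\<not> i0, True)}"
      using b m by (cases "fst (c b) = i0") (auto simp: cls_def pos_def)
  qed
  then have "card (cls ` B) \<le> card {(i0, False), (\<not> i0, False), (\<not> i0, True)}" by (intro card_mono) auto
  also have "\<dots> \<le> 3" by (auto simp: card_insert_if)
  finally have "\<not> inj_on cls B" using cB by (auto simp: card_image)
  then obtain b b' where b: "b \<in> B" "b' \<in> B" "b \<noteq> b'" "cls b = cls b'" unfolding inj_on_def by blast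
  have "\<bar>G b (snd (c b)) - G b' (snd (c b'))\<bar> \<le> 1"
    using b(4) c[OF b(1)] c[OF b(2)] by (auto simp: cls_def split: if_splits)
  then show False
    using no_triple[of a b b' "fst (c b)" "snd (c b)" "snd (c b')"] a B8 b c[OF b(1)] c[OF b(2)]
    by (auto simp: cls_def)
qed

text \<open>If \<open>x\<close> started to the right of the last interval \<open>m\<close> and still
  touched the gadget, it would touch \<open>m\<close>, whose owner is 0 or 4.\<close>

lemma last_touch:
  assumes "\<bar>x - G a k\<bar> \<le> 1" "a < 8" "\<And>l. \<bar>x - G 0 l\<bar> > 1" "\<And>l. \<bar>x - G 4 l\<bar> > 1"
  obtains m where "m \<in> P" "x \<le> pos m" "\<And>z. z \<in> P \<Longrightarrow> pos z \<le> pos m"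
proof -
  obtain m where m: "m \<in> P" "\<And>z. z \<in> P \<Longrightarrow> z \<noteq> m \<Longrightarrow> before z m" using obtain_last_all by blast
  have le: "pos z \<le> pos m" if "z \<in> P" for z using m(2)[OF that] before_pos by (cases "z = m") auto
  have "x \<le> pos m"
  proof (rule ccontr)
    assume "\<not> x \<le> pos m"
    moreover have "x \<le> pos (a, k) + 1" "pos (a, k) \<le> pos m" using assms(1,2) le[of "(a, k)"] by (auto simp: pos_def)
    ultimately have "\<bar>x - pos m\<bar> \<le> 1" by auto
    then show False using last_owner[OF m(1) le] assms(3)[of "snd m"] assms(4)[of "snd m"] by (auto simp: pos_def)
  qed
  then show thesis using that m(1) le by blast
qed

text \<open>The chain has no gaps: if \<open>r\<close> lay beyond the end of the last interval
  starting at or before \<open>r\<close>, the successor of that interval would also start before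
  \<open>r\<close>.\<close>

lemma cover:
  assumes "m \<in> P" "m' \<in> P" "pos m' \<le> r" "r \<le> pos m + 1"
  obtains z where "z \<in> P" "pos z \<le> r" "r \<le> pos z + 1"
proof -
  obtain t where t: "t \<in> P" "\<And>x. x \<in> P \<Longrightarrow> x \<noteq> t \<Longrightarrow> before x t" using obtain_last_all by blast
  have "m' \<in> {x \<in> P. pos x \<le> r}" using assms(2,3) by blast
  then obtain z where "z \<in> {x \<in> P. pos x \<le> r}" "\<And>x. x \<in> {x \<in> P. pos x \<le> r} \<Longrightarrow> x \<noteq> z \<Longrightarrow> before x z"
    using obtain_last[of "{x \<in> P. pos x \<le> r}"] by blast
  then have z: "z \<in> P" "pos z \<le> r" "\<And>x. x \<in> P \<Longrightarrow> pos x \<le> r \<Longrightarrow> x \<noteq> z \<Longrightarrow> before x z" by blast+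
  have "r \<le> pos z + 1"
  proof (rule ccontr)
    assume r: "\<not> r \<le> pos z + 1"
    have "pos m \<le> pos t" using t(2)[OF assms(1)] before_pos by (cases "m = t") auto
    then have "z \<noteq> t" using r assms(4) by auto
    then obtain y where y: "y \<in> P" "before z y" "pos y \<le> pos z + 1" using has_next[OF t z(1)] by blast
    then have "before y z" using z(3)[of y] r before_irrefl by force
    then show False using y(2) before_trans before_irrefl by blast
  qed
  then show thesis using that z by blast
qed

end

lemma abs_diff_minus: "\<bar>- x - - y\<bar> = \<bar>x - y\<bar>" for x y :: real
  by arith

lemma k44_layout_reflect: "k44_layout G \<Longrightarrow> k44_layout (\<lambda>a i. - G a i)"
  unfolding k44_layout_def touch_def abs_diff_minus .

text \<open>By \<open>last_touch\<close> and its mirror image, \<open>x\<close> starts between the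
  first and the last interval of the chain, so the chain covers all of \<open>x\<close>. Anything
  that meets \<open>x\<close> shares the point \<open>max x y\<close> with it and therefore meets a
  gadget interval.\<close>

lemma white_interval:
  assumes "k44_layout G" "\<bar>x - G a k\<bar> \<le> 1" "a < 8" "\<And>l. \<bar>x - G 0 l\<bar> > 1" "\<And>l. \<bar>x - G 4 l\<bar> > 1"
    and y: "\<And>b l. b < 8 \<Longrightarrow> \<bar>y - G b l\<bar> > 1"
  shows "\<bar>x - y\<bar> > 1"
proof (rule ccontr)
  assume xy: "\<not> \<bar>x - y\<bar> > 1"
  interpret k44_layout G by fact
  interpret R: k44_layout "\<lambda>a i. - G a i" by (rule k44_layout_reflect) fact
  obtain m where m: "m \<in> P" "x \<le> pos m" using last_touch[OF assms(2-5)] by blast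
  have 1: "\<bar>- x - - G a k\<bar> \<le> 1" "\<And>l. \<bar>- x - - G 0 l\<bar> > 1" "\<And>l. \<bar>- x - - G 4 l\<bar> > 1"
    unfolding abs_diff_minus using assms(2,4,5) by blast+
  obtain m' where m': "m' \<in> P" "- x \<le> R.pos m'" using R.last_touch[OF 1(1) assms(3) 1(2,3)] by blast
  then have m'': "m' \<in> P" "pos m' \<le> x" by (auto simp: pos_def R.pos_def)
  obtain z where z: "z \<in> P" "pos z \<le> max x y" "max x y \<le> pos z + 1"
    using cover[OF m(1) m''(1), of "max x y"] m(2) m''(2) xy by (auto simp: max_def abs_if split: if_splits)
  have "\<bar>y - pos z\<bar> \<le> 1" using z xy by (auto simp: max_def abs_if split: if_splits)
  then show False using y[of "fst z" "snd z"] z(1) by (auto simp: pos_def)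
qed

section \<open>The graph of a clause table\<close>

text \<open>
  Every cell (clause \<open>c\<close>, variable \<open>j\<close>) of the table has 24 vertices: the hidden vertices
  \<open>A = 0\<close> and \<open>M = 1\<close> with their gadgets 8 to 15 and 16 to 23, a pendant vertex 2 at \<open>A\<close>, and
  \<open>s = 3\<close>, \<open>v = 4\<close>, \<open>h = 5\<close> with the contact vertices 6 of \<open>v\<close> (and \<open>s\<close>) and 7 of \<open>h\<close>. At \<open>A\<close>
  only one of its neighbours \<open>s\<close>, \<open>v\<close> and the next \<open>v\<close> can reach its contact, at \<open>M\<close> only two of
  \<open>s\<close>, \<open>h\<close> and the next \<open>h\<close>.
\<close>

type_synonym vertex = "nat \<times> nat \<times> nat"

definition nx :: "nat \<Rightarrow> nat \<Rightarrow> nat" where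
  "nx n i = (if Suc i = n then 0 else Suc i)"

text \<open>\<open>A\<close> and \<open>M\<close> are attached to the gadget vertices 1 and 5
  (numbered 9, 13 and 17, 21). These are adjacent, so one interval can meet both, and they are not
  the chain ends 0 and 4. An entry 1 of \<open>tab\<close> is a positive literal, 2 a negative one,
  0 absence.\<close>

definition cell_edge :: "(nat \<Rightarrow> nat \<Rightarrow> nat) \<Rightarrow> nat \<Rightarrow> nat \<Rightarrow> nat \<Rightarrow> nat \<Rightarrow> bool" where
  "cell_edge tab c j t t' \<longleftrightarrow>
     (t, t') \<in> {(0, 2), (0, 4), (0, 3), (1, 5), (1, 3), (3, 4), (4, 6), (5, 7), (0, 9), (0, 13), (1, 17), (1, 21)} \<or>
     8 \<le> t \<and> 8 \<le> t' \<and> k44 (t - 8) (t' - 8) \<or> 16 \<le> t \<and> 16 \<le> t' \<and> k44 (t - 16) (t' - 16) \<or>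
     t = 3 \<and> t' = 5 \<and> tab c j \<noteq> 0 \<and> j \<noteq> 0 \<or> t = 3 \<and> t' = 6 \<and> tab c j = 2"

text \<open>Both directions are cyclic. In a column this makes the signal return to its start; in a
  row it joins the \<open>h\<close> of column 0 to the last \<open>M\<close> too, while the
  conditions \<open>j \<noteq> 0\<close> and \<open>j' \<noteq> 0\<close> keep it away from every
  \<open>s\<close> and every other \<open>h\<close>. The contact of \<open>s\<close> is that of the
  \<open>v\<close> sticking out at the same end of \<open>A\<close> when the literal is true; with
  separate contacts only the farther one could be reached.\<close>

fun dedge :: "nat \<Rightarrow> nat \<Rightarrow> (nat \<Rightarrow> nat \<Rightarrow> nat) \<Rightarrow> vertex \<Rightarrow> vertex \<Rightarrow> bool" where
  "dedge C N tab (c, j, t) (c', j', t') \<longleftrightarrow>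
     c' = c \<and> j' = j \<and> cell_edge tab c j t t' \<or>
     c' = nx C c \<and> j' = j \<and> ((t, t') \<in> {(0, 4), (3, 4), (4, 4)} \<or> t = 3 \<and> t' = 6 \<and> tab c j = 1) \<or>
     c' = c \<and> j' = nx N j \<and> (t = 1 \<and> t' = 5 \<or> t = 3 \<and> t' = 5 \<and> tab c j \<noteq> 0 \<and> j' \<noteq> 0 \<or>
       t = 5 \<and> t' = 5 \<and> j \<noteq> 0 \<and> j' \<noteq> 0)"

definition adj :: "nat \<Rightarrow> nat \<Rightarrow> (nat \<Rightarrow> nat \<Rightarrow> nat) \<Rightarrow> vertex \<Rightarrow> vertex \<Rightarrow> bool" where
  "adj C N tab u v \<longleftrightarrow> dedge C N tab u v \<or> dedge C N tab v u"

definition verts :: "nat \<Rightarrow> nat \<Rightarrow> vertex set" where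
  "verts C N = {..<C} \<times> {..<N} \<times> {..<24}"

definition table_sat :: "nat \<Rightarrow> nat \<Rightarrow> (nat \<Rightarrow> nat \<Rightarrow> nat) \<Rightarrow> (nat \<Rightarrow> bool) \<Rightarrow> bool" where
  "table_sat C N tab a \<longleftrightarrow> (\<forall>c<C. \<exists>j<N. tab c j = 1 \<and> a j \<or> tab c j = 2 \<and> \<not> a j)"

lemma adj_sym: "adj C N tab u v \<longleftrightarrow> adj C N tab v u"
  by (auto simp: adj_def)

lemma nx_lt: "i < n \<Longrightarrow> nx n i < n"
  by (auto simp: nx_def)

lemma nx_neq: "1 < n \<Longrightarrow> nx n i \<noteq> i"
  by (auto simp: nx_def)

lemma nx_nx_neq: "2 < n \<Longrightarrow> nx n (nx n i) \<noteq> i"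
  by (auto simp: nx_def)

lemma nx_inj: "nx n i = nx n i' \<Longrightarrow> i = i'"
  by (auto simp: nx_def split: if_splits)

subsection \<open>From layouts to assignments\<close>

text \<open>The witness \<open>J\<close> is an interval meeting \<open>x\<close> outside
  \<open>X\<close> and missing all of \<open>Y\<close>: near \<open>X\<close>, \<open>x\<close>
  reaches a place that no member of \<open>Y\<close> reaches.\<close>

definition exposed :: "'a layout \<Rightarrow> real \<Rightarrow> 'a \<Rightarrow> 'a set \<Rightarrow> bool" where
  "exposed L X x Y \<longleftrightarrow> (\<exists>i J. \<bar>L x i - X\<bar> \<le> 1 \<and> \<bar>J - L x i\<bar> \<le> 1 \<and> \<bar>J - X\<bar> > 1 \<and> (\<forall>y\<in>Y. \<forall>k. \<bar>J - L y k\<bar> > 1))"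

text \<open>If one interval of \<open>x\<close> meets both \<open>X\<close> and \<open>X'\<close>,
  then \<open>X'\<close> is itself a witness of exposure at \<open>X\<close>. Otherwise the two
  intervals of \<open>x\<close> are used up at \<open>X\<close> and \<open>X'\<close>, and the
  contact \<open>k\<close> has to meet one of them there, outside.\<close>

lemma exposed_somewhere:
  assumes "\<exists>i. \<bar>L x i - X\<bar> \<le> 1" "\<exists>i. \<bar>L x i - X'\<bar> \<le> 1" "touch L x k" "\<bar>X - X'\<bar> > 1"
    "\<And>l. \<bar>L k l - X\<bar> > 1" "\<And>l. \<bar>L k l - X'\<bar> > 1"
    "\<And>y. y \<in> Y \<Longrightarrow> \<not> touch L k y" "\<And>y. y \<in> Y' \<Longrightarrow> \<not> touch L k y"
    "\<And>y l. y \<in> Y \<Longrightarrow> \<bar>X' - L y l\<bar> > 1" "\<And>y l. y \<in> Y' \<Longrightarrow> \<bar>X - L y l\<bar> > 1"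
  shows "exposed L X x Y \<or> exposed L X' x Y'"
proof -
  obtain i i' where i: "\<bar>L x i - X\<bar> \<le> 1" and i': "\<bar>L x i' - X'\<bar> \<le> 1" using assms(1,2) by blast
  obtain l m where lm: "\<bar>L x l - L k m\<bar> \<le> 1" using assms(3) unfolding touch_def by blast
  show ?thesis
  proof (cases "i = i'")
    case True
    have "exposed L X x Y" unfolding exposed_def
      by (rule exI[of _ i], rule exI[of _ X'])
         (use i i' assms(4,9) True in \<open>auto simp: abs_minus_commute\<close>)
    then show ?thesis ..
  next
    case False
    then consider "l = i" | "l = i'" by auto
    then show ?thesis
    proof cases
      case 1
      have "exposed L X x Y" unfolding exposed_def
        by (rule exI[of _ i], rule exI[of _ "L k m"])
           (use i lm 1 assms(5,7) in \<open>auto simp: abs_minus_commute touch_def not_le\<close>)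
      then show ?thesis ..
    next
      case 2
      have "exposed L X' x Y'" unfolding exposed_def
        by (rule exI[of _ i'], rule exI[of _ "L k m"])
           (use i' lm 2 assms(6,8) in \<open>auto simp: abs_minus_commute touch_def not_le\<close>)
      then show ?thesis ..
    qed
  qed
qed

text \<open>As \<open>l\<close> overlaps \<open>X\<close> and is disjoint from \<open>a\<close> and
  \<open>b\<close>, both can leave \<open>X\<close> only on the side opposite to \<open>l\<close>.
  There the one reaching farther is met by everything that meets the other outside
  \<open>X\<close>.\<close>

lemma one_end_aux:
  fixes X l a b J J' :: real
  assumes "\<bar>l - X\<bar> \<le> 1" "\<bar>a - X\<bar> \<le> 1" "\<bar>b - X\<bar> \<le> 1" "\<bar>a - l\<bar> > 1" "\<bar>b - l\<bar> > 1"
    "\<bar>J - a\<bar> \<le> 1" "\<bar>J - X\<bar> > 1" "\<bar>J - b\<bar> > 1" "\<bar>J' - b\<bar> \<le> 1" "\<bar>J' - X\<bar> > 1" "\<bar>J' - a\<bar> > 1"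
  shows False
  using assms by (auto simp: abs_if split: if_splits)

lemma one_end:
  assumes "exposed L X x Y" "y \<in> Y" "exposed L X y Y'" "x \<in> Y'"
    "\<exists>i. \<bar>L l i - X\<bar> \<le> 1" "\<not> touch L l x" "\<not> touch L l y"
  shows False
proof -
  obtain i J where J: "\<bar>L x i - X\<bar> \<le> 1" "\<bar>J - L x i\<bar> \<le> 1" "\<bar>J - X\<bar> > 1" "\<And>k. \<bar>J - L y k\<bar> > 1"
    using assms(1,2) unfolding exposed_def by blast
  obtain i' J' where J': "\<bar>L y i' - X\<bar> \<le> 1" "\<bar>J' - L y i'\<bar> \<le> 1" "\<bar>J' - X\<bar> > 1" "\<And>k. \<bar>J' - L x k\<bar> > 1"
    using assms(3,4) unfolding exposed_def by blast
  obtain m where "\<bar>L l m - X\<bar> \<le> 1" using assms(5) by blast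
  moreover have "\<bar>L x i - L l m\<bar> > 1" "\<bar>L y i' - L l m\<bar> > 1"
    using assms(6,7) unfolding touch_def by (metis abs_minus_commute not_le)+
  ultimately show False using one_end_aux J J' by blast
qed

text \<open>Whatever meets the middle interval outside \<open>X\<close> also meets the outer
  interval on that side.\<close>

lemma two_ends_aux:
  fixes X a b c J :: real
  assumes "a \<le> b" "b \<le> c" "\<bar>a - X\<bar> \<le> 1" "\<bar>c - X\<bar> \<le> 1"
    "\<bar>J - b\<bar> \<le> 1" "\<bar>J - X\<bar> > 1" "\<bar>J - a\<bar> > 1" "\<bar>J - c\<bar> > 1"
  shows False
  using assms by (auto simp: abs_if split: if_splits)

lemma two_ends:
  assumes "exposed L X x {y, z}" "exposed L X y {x, z}" "exposed L X z {x, y}"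
  shows False
proof -
  obtain i J where x: "\<bar>L x i - X\<bar> \<le> 1" "\<bar>J - L x i\<bar> \<le> 1" "\<bar>J - X\<bar> > 1"
    "\<And>k. \<bar>J - L y k\<bar> > 1" "\<And>k. \<bar>J - L z k\<bar> > 1"
    using assms(1) unfolding exposed_def by blast
  obtain i' J' where y: "\<bar>L y i' - X\<bar> \<le> 1" "\<bar>J' - L y i'\<bar> \<le> 1" "\<bar>J' - X\<bar> > 1"
    "\<And>k. \<bar>J' - L x k\<bar> > 1" "\<And>k. \<bar>J' - L z k\<bar> > 1"
    using assms(2) unfolding exposed_def by blast
  obtain i'' J'' where z: "\<bar>L z i'' - X\<bar> \<le> 1" "\<bar>J'' - L z i''\<bar> \<le> 1" "\<bar>J'' - X\<bar> > 1"
    "\<And>k. \<bar>J'' - L x k\<bar> > 1" "\<And>k. \<bar>J'' - L y k\<bar> > 1"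
    using assms(3) unfolding exposed_def by blast
  let ?a = "L x i" and ?b = "L y i'" and ?c = "L z i''"
  consider "?a \<le> ?b" "?b \<le> ?c" | "?a \<le> ?c" "?c \<le> ?b" | "?b \<le> ?a" "?a \<le> ?c" | "?b \<le> ?c" "?c \<le> ?a"
    | "?c \<le> ?a" "?a \<le> ?b" | "?c \<le> ?b" "?b \<le> ?a" by linarith
  then show False
    using two_ends_aux[of ?a ?b ?c X J'] two_ends_aux[of ?a ?c ?b X J''] two_ends_aux[of ?b ?a ?c X J]
      two_ends_aux[of ?b ?c ?a X J''] two_ends_aux[of ?c ?a ?b X J] two_ends_aux[of ?c ?b ?a X J'] x y z
    by cases blast+
qed

section \<open>The visible intervals of \<open>A\<close> and \<open>M\<close>\<close>

locale table_layout =
  fixes C N :: nat and tab :: "nat \<Rightarrow> nat \<Rightarrow> nat" and L :: "vertex layout"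
  assumes C: "2 < C" and N: "2 < N" and ends: "\<And>c. c < C \<Longrightarrow> tab c 0 \<noteq> 0 \<and> tab c (N - 1) \<noteq> 0"
    and rep: "represents L (verts C N) (adj C N tab)"
begin

lemma adj_touch:
  "c < C \<Longrightarrow> j < N \<Longrightarrow> t < 24 \<Longrightarrow> c' < C \<Longrightarrow> j' < N \<Longrightarrow> t' < 24 \<Longrightarrow> (c, j, t) \<noteq> (c', j', t') \<Longrightarrow>
   touch L (c, j, t) (c', j', t') \<longleftrightarrow> adj C N tab (c, j, t) (c', j', t')"
  using rep unfolding represents_def verts_def by auto

lemma nx_simps [simp]:
  "nx C i \<noteq> i" "nx N i \<noteq> i" "i \<noteq> nx C i" "i \<noteq> nx N i" "nx C (nx C i) \<noteq> i" "nx N (nx N i) \<noteq> i"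
  "i \<noteq> nx C (nx C i)" "i \<noteq> nx N (nx N i)"
  "nx C i = nx C i' \<longleftrightarrow> i = i'" "nx N i = nx N i' \<longleftrightarrow> i = i'" "i < C \<Longrightarrow> nx C i < C" "i < N \<Longrightarrow> nx N i < N"
  using C N nx_neq[of C i] nx_neq[of N i] nx_nx_neq[of C i] nx_nx_neq[of N i] nx_inj[of C i i'] nx_inj[of N i i']
    nx_lt[of i C] nx_lt[of i N] by auto

lemma adj_cell:
  "adj C N tab (c, j, t) (c, j, t') \<longleftrightarrow> cell_edge tab c j t t' \<or> cell_edge tab c j t' t"
proof -
  have "nx C c \<noteq> c" "c \<noteq> nx C c" "nx N j \<noteq> j" "j \<noteq> nx N j" using C N nx_neq[of C c] nx_neq[of N j] by auto
  then show ?thesis by (simp add: adj_def)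
qed

lemma gadget_edge:
  assumes "t < 2" "a < 8" "b < 8"
  shows "cell_edge tab c j (8 + 8 * t + a) (8 + 8 * t + b) \<longleftrightarrow> k44 a b"
    "cell_edge tab c j t (8 + 8 * t + b) \<longleftrightarrow> b = 1 \<or> b = 5" "\<not> cell_edge tab c j (8 + 8 * t + b) t"
proof -
  have "t = 0 \<or> t = 1" using assms by auto
  then show "cell_edge tab c j (8 + 8 * t + a) (8 + 8 * t + b) \<longleftrightarrow> k44 a b"
    "cell_edge tab c j t (8 + 8 * t + b) \<longleftrightarrow> b = 1 \<or> b = 5" "\<not> cell_edge tab c j (8 + 8 * t + b) t"
    using assms unfolding cell_edge_def by (auto simp: k44_def)
qed

lemma gadget_nonadjacent:
  assumes "t < 2" "b < 8" "t' < 8" "(c', j', t') \<noteq> (c, j, t)"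
  shows "\<not> adj C N tab (c', j', t') (c, j, 8 + 8 * t + b)"
proof -
  have "t = 0 \<or> t = 1" using assms by auto
  then show ?thesis using assms by (elim disjE) (auto simp: adj_def cell_edge_def)
qed

text \<open>The interval that touches the gadget is out of reach for all vertices of type below 8 by
  \<open>white_interval\<close>. All adjacencies with these are therefore realised at the other
  interval \<open>X\<close>, the visible one.\<close>

lemma white_exists:
  assumes "c < C" "j < N" "t < 2"
  shows "\<exists>X i. X = L (c, j, t) i \<and> (\<forall>c' j' t'. c' < C \<longrightarrow> j' < N \<longrightarrow> t' < 8 \<longrightarrow> (c', j', t') \<noteq> (c, j, t) \<longrightarrow>
    ((\<exists>k. \<bar>L (c', j', t') k - X\<bar> \<le> 1) \<longleftrightarrow> adj C N tab (c, j, t) (c', j', t')))"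
proof -
  define g where "g a = (c, j, 8 + 8 * t + a)" for a
  have t: "t = 0 \<or> t = 1" using assms(3) by auto
  have G: "k44_layout (\<lambda>a. L (g a))"
  proof
    fix a :: nat assume "a < 8"
    then have "g a \<in> verts C N" using assms by (auto simp: g_def verts_def)
    then show "\<bar>L (g a) False - L (g a) True\<bar> > 1" using rep by (auto simp: represents_def)
  next
    fix a b :: nat assume ab: "a < 8" "b < 8" "a \<noteq> b"
    have "touch (\<lambda>a. L (g a)) a b \<longleftrightarrow> touch L (g a) (g b)" by (simp add: touch_def)
    also have "\<dots> \<longleftrightarrow> adj C N tab (g a) (g b)" unfolding g_def using ab assms by (intro adj_touch) auto
    also have "\<dots> \<longleftrightarrow> k44 a b \<or> k44 b a"
      unfolding g_def adj_cell using gadget_edge assms(3) ab by simp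
    finally show "touch (\<lambda>a. L (g a)) a b \<longleftrightarrow> k44 a b \<or> k44 b a" .
  qed
  have mg: "touch L (c, j, t) (g a) \<longleftrightarrow> a = 1 \<or> a = 5" if "a < 8" for a
  proof -
    have "touch L (c, j, t) (g a) \<longleftrightarrow> adj C N tab (c, j, t) (g a)"
      unfolding g_def using that assms by (intro adj_touch) auto
    also have "\<dots> \<longleftrightarrow> a = 1 \<or> a = 5"
      unfolding g_def adj_cell using gadget_edge assms(3) that by simp
    finally show ?thesis .
  qed
  obtain i k where ik: "\<bar>L (c, j, t) i - L (g 1) k\<bar> \<le> 1" using mg[of 1] unfolding touch_def by auto
  have far: "\<bar>L (c, j, t) i - L (c', j', t') l\<bar> > 1"
    if "c' < C" "j' < N" "t' < 8" "(c', j', t') \<noteq> (c, j, t)" for c' j' t' l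
  proof (rule white_interval[OF G ik])
    have "\<not> touch L (c, j, t) (g 0)" "\<not> touch L (c, j, t) (g 4)" using mg[of 0] mg[of 4] by simp_all
    then show "\<bar>L (c, j, t) i - L (g 0) l\<bar> > 1" "\<bar>L (c, j, t) i - L (g 4) l\<bar> > 1" for l
      unfolding touch_def by (auto simp: not_le)
  next
    fix b :: nat and l' assume b: "b < 8"
    have "\<not> adj C N tab (c', j', t') (g b)" unfolding g_def using assms(3) b that(3,4) by (rule gadget_nonadjacent)
    then have "\<not> touch L (c', j', t') (g b)"
      using that assms b adj_touch[of c' j' t' c j "8 + 8 * t + b"] by (auto simp: g_def)
    then show "\<bar>L (c', j', t') l - L (g b) l'\<bar> > 1" unfolding touch_def by (simp add: not_le)
  qed simp
  show ?thesis
  proof (intro exI conjI allI impI)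
    show "L (c, j, t) (\<not> i) = L (c, j, t) (\<not> i)" ..
    fix c' j' t' assume v: "c' < C" "j' < N" "t' < 8" "(c', j', t') \<noteq> (c, j, t)"
    have "(\<exists>k. \<bar>L (c', j', t') k - L (c, j, t) (\<not> i)\<bar> \<le> 1) \<longleftrightarrow> touch L (c, j, t) (c', j', t')" (is "?l \<longleftrightarrow> ?r")
    proof
      assume ?r
      then obtain i' k where k: "\<bar>L (c, j, t) i' - L (c', j', t') k\<bar> \<le> 1" unfolding touch_def by blast
      have "i' \<noteq> i" using far[OF v, of k] k by fastforce
      then have "i' = (\<not> i)" by blast
      then show ?l using k abs_minus_commute[of "L (c, j, t) (\<not> i)" "L (c', j', t') k"] by auto
    next
      assume ?l
      then obtain k where "\<bar>L (c, j, t) (\<not> i) - L (c', j', t') k\<bar> \<le> 1" by (auto simp: abs_minus_commute)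
      then show ?r unfolding touch_def by blast
    qed
    also have "\<dots> \<longleftrightarrow> adj C N tab (c, j, t) (c', j', t')" using v assms by (intro adj_touch) auto
    finally show "(\<exists>k. \<bar>L (c', j', t') k - L (c, j, t) (\<not> i)\<bar> \<le> 1) \<longleftrightarrow> adj C N tab (c, j, t) (c', j', t')" .
  qed
qed

definition W :: "nat \<Rightarrow> nat \<Rightarrow> nat \<Rightarrow> real" where
  "W c j t = (SOME X. \<exists>i. X = L (c, j, t) i \<and> (\<forall>c' j' t'. c' < C \<longrightarrow> j' < N \<longrightarrow> t' < 8 \<longrightarrow> (c', j', t') \<noteq> (c, j, t) \<longrightarrow>
    ((\<exists>k. \<bar>L (c', j', t') k - X\<bar> \<le> 1) \<longleftrightarrow> adj C N tab (c, j, t) (c', j', t'))))"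

lemma W:
  assumes "c < C" "j < N" "t < 2"
  shows "\<exists>i. W c j t = L (c, j, t) i"
    "c' < C \<Longrightarrow> j' < N \<Longrightarrow> t' < 8 \<Longrightarrow> (c', j', t') \<noteq> (c, j, t) \<Longrightarrow>
      (\<exists>k. \<bar>L (c', j', t') k - W c j t\<bar> \<le> 1) \<longleftrightarrow> adj C N tab (c, j, t) (c', j', t')"
  using someI_ex[OF white_exists[OF assms]] unfolding W_def[symmetric] by blast+

lemma W_far:
  assumes "c < C" "j < N" "t < 2" "c' < C" "j' < N" "t' < 8" "(c', j', t') \<noteq> (c, j, t)"
    "\<not> adj C N tab (c, j, t) (c', j', t')"
  shows "\<bar>L (c', j', t') k - W c j t\<bar> > 1" "\<bar>W c j t - L (c', j', t') k\<bar> > 1"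
  using W(2)[OF assms(1-7)] assms(8) by (auto simp: not_le abs_minus_commute)

text \<open>Here all distances in \<open>exposed_somewhere\<close> become adjacencies, which
  simplification decides for concrete vertex types.\<close>

lemma expose:
  assumes b: "c1 < C" "j1 < N" "t1 < 2" "c2 < C" "j2 < N" "t2 < 2" "cx < C" "jx < N" "tx < 8" "1 < tx"
    "ck < C" "jk < N" "tk < 8" "1 < tk" "(c1, j1, t1) \<noteq> (c2, j2, t2)" "(cx, jx, tx) \<noteq> (ck, jk, tk)"
    and adj: "adj C N tab (c1, j1, t1) (cx, jx, tx)" "adj C N tab (c2, j2, t2) (cx, jx, tx)"
    "adj C N tab (cx, jx, tx) (ck, jk, tk)"
    and nadj: "\<not> adj C N tab (c1, j1, t1) (c2, j2, t2)" "\<not> adj C N tab (c1, j1, t1) (ck, jk, tk)"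
    "\<not> adj C N tab (c2, j2, t2) (ck, jk, tk)"
    and Y: "\<forall>y\<in>Y \<union> Y'. \<exists>c j t. y = (c, j, t) \<and> c < C \<and> j < N \<and> 1 < t \<and> t < 8 \<and> y \<noteq> (ck, jk, tk) \<and>
      \<not> adj C N tab (ck, jk, tk) y"
    "\<forall>y\<in>Y. \<not> adj C N tab (c2, j2, t2) y" "\<forall>y\<in>Y'. \<not> adj C N tab (c1, j1, t1) y"
  shows "exposed L (W c1 j1 t1) (cx, jx, tx) Y \<or> exposed L (W c2 j2 t2) (cx, jx, tx) Y'"
proof (rule exposed_somewhere[where k = "(ck, jk, tk)"])
  show "\<exists>i. \<bar>L (cx, jx, tx) i - W c1 j1 t1\<bar> \<le> 1" using b adj W(2)[of c1 j1 t1 cx jx tx] by auto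
  show "\<exists>i. \<bar>L (cx, jx, tx) i - W c2 j2 t2\<bar> \<le> 1" using b adj W(2)[of c2 j2 t2 cx jx tx] by auto
  show "touch L (cx, jx, tx) (ck, jk, tk)" using b adj adj_touch[of cx jx tx ck jk tk] by auto
  obtain i where "W c2 j2 t2 = L (c2, j2, t2) i" using W(1) b by blast
  then show "\<bar>W c1 j1 t1 - W c2 j2 t2\<bar> > 1" using W_far(2)[of c1 j1 t1 c2 j2 t2] b nadj by auto
  show "\<bar>L (ck, jk, tk) l - W c1 j1 t1\<bar> > 1" for l using W_far(1)[of c1 j1 t1 ck jk tk] b nadj by auto
  show "\<bar>L (ck, jk, tk) l - W c2 j2 t2\<bar> > 1" for l using W_far(1)[of c2 j2 t2 ck jk tk] b nadj by auto
  have *: "\<not> touch L (ck, jk, tk) y" if y: "y \<in> Y \<union> Y'" for y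
  proof -
    obtain c j t where "y = (c, j, t)" "c < C" "j < N" "t < 8" "y \<noteq> (ck, jk, tk)" "\<not> adj C N tab (ck, jk, tk) y"
      using Y(1) y by blast
    then show ?thesis using adj_touch[of ck jk tk c j t] b by auto
  qed
  show "\<not> touch L (ck, jk, tk) y" if "y \<in> Y" for y using * that by blast
  show "\<not> touch L (ck, jk, tk) y" if "y \<in> Y'" for y using * that by blast
  show "\<bar>W c2 j2 t2 - L y l\<bar> > 1" if y: "y \<in> Y" for y l
  proof -
    obtain c j t where "y = (c, j, t)" "c < C" "j < N" "1 < t" "t < 8" using Y(1) y by blast
    then show ?thesis using W_far(2)[of c2 j2 t2 c j t] b Y(2) y by auto
  qed
  show "\<bar>W c1 j1 t1 - L y l\<bar> > 1" if y: "y \<in> Y'" for y l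
  proof -
    obtain c j t where "y = (c, j, t)" "c < C" "j < N" "1 < t" "t < 8" using Y(1) y by blast
    then show ?thesis using W_far(2)[of c1 j1 t1 c j t] b Y(3) y by auto
  qed
qed

text \<open>This is \<open>one_end\<close> with the blocker \<open>(cl, jl, te)\<close>: adjacent to
  the owner of the visible interval, but to neither competitor.\<close>

lemma leaf_conflict:
  assumes b: "cm < C" "jm < N" "tm < 2" "cl < C" "jl < N" "te < 8" "1 < te" "cx < C" "jx < N" "tx < 8"
    "cy < C" "jy < N" "ty < 8" "(cl, jl, te) \<noteq> (cx, jx, tx)" "(cl, jl, te) \<noteq> (cy, jy, ty)"
    and adj: "adj C N tab (cm, jm, tm) (cl, jl, te)" "\<not> adj C N tab (cl, jl, te) (cx, jx, tx)"
      "\<not> adj C N tab (cl, jl, te) (cy, jy, ty)"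
    and e: "exposed L (W cm jm tm) (cx, jx, tx) Y" "(cy, jy, ty) \<in> Y"
      "exposed L (W cm jm tm) (cy, jy, ty) Y'" "(cx, jx, tx) \<in> Y'"
  shows False
proof (rule one_end[OF e, of "(cl, jl, te)"])
  show "\<exists>i. \<bar>L (cl, jl, te) i - W cm jm tm\<bar> \<le> 1" using W(2)[of cm jm tm cl jl te] b adj by auto
  show "\<not> touch L (cl, jl, te) (cx, jx, tx)" using adj_touch[of cl jl te cx jx tx] b adj by auto
  show "\<not> touch L (cl, jl, te) (cy, jy, ty)" using adj_touch[of cl jl te cy jy ty] b adj by auto
qed

section \<open>Signals along columns and rows\<close>

lemma ball_if_singleton: "(\<forall>y\<in>(if b then {x} else {}). P y) \<longleftrightarrow> (b \<longrightarrow> P x)"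
  by simp

lemmas adj_simps = adj_def cell_edge_def k44_def ball_Un ball_if_singleton

text \<open>A \<open>v\<close> reaches its contact either at the \<open>A\<close> of its own row
  (\<open>Fw\<close>) or at that of the previous row (\<open>Bw\<close>). In both definitions
  \<open>s\<close> is listed as a competitor just when it uses the contact of the other
  \<open>v\<close>.\<close>

definition Fw :: "nat \<Rightarrow> nat \<Rightarrow> bool" where
  "Fw k j \<longleftrightarrow> exposed L (W k j 0) (k, j, 4) ({(nx C k, j, 4)} \<union> (if tab k j = 1 then {(k, j, 3)} else {}))"

definition Bw :: "nat \<Rightarrow> nat \<Rightarrow> bool" where
  "Bw k j \<longleftrightarrow> exposed L (W k j 0) (nx C k, j, 4) ({(k, j, 4)} \<union> (if tab k j = 2 then {(k, j, 3)} else {}))"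

definition SA :: "nat \<Rightarrow> nat \<Rightarrow> bool" where
  "SA k j \<longleftrightarrow> exposed L (W k j 0) (k, j, 3) {(if tab k j = 1 then k else nx C k, j, 4)}"

definition SM :: "nat \<Rightarrow> nat \<Rightarrow> bool" where
  "SM k j \<longleftrightarrow> exposed L (W k j 1) (k, j, 3) {(k, j, 5), (k, nx N j, 5)}"

lemma Bw_or_Fw:
  assumes "k < C" "j < N"
  shows "Bw k j \<or> Fw (nx C k) j"
  unfolding Bw_def Fw_def
  by (rule expose[of _ _ _ _ _ _ _ _ _ "nx C k" j 6])
     (use assms in \<open>simp_all add: adj_simps\<close>)

text \<open>The pendant vertex 2 blocks one end of \<open>A\<close>, and the two \<open>v\<close>
  cannot both be exposed at the other.\<close>

lemma not_Fw_Bw: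
  assumes "k < C" "j < N"
  shows "\<not> (Fw k j \<and> Bw k j)"
proof
  assume *: "Fw k j \<and> Bw k j"
  show False
    by (rule leaf_conflict[OF _ _ _ _ _ _ _ _ _ _ _ _ _ _ _ _ _ _ *[THEN conjunct1, unfolded Fw_def] _ *[THEN conjunct2, unfolded Bw_def], of k j 2])
       (use assms in \<open>simp_all add: adj_simps\<close>)
qed

lemma SA_or_SM:
  assumes "k < C" "j < N" "tab k j = 1 \<or> tab k j = 2"
  shows "SA k j \<or> SM k j"
  unfolding SA_def SM_def
  by (rule expose[of _ _ _ _ _ _ _ _ _ "if tab k j = 1 then nx C k else k" j 6])
     (use assms in \<open>simp_all add: adj_simps, blast\<close>)

lemma not_Fw_SA:
  assumes "k < C" "j < N" "tab k j = 1"
  shows "\<not> (Fw k j \<and> SA k j)"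
proof
  assume *: "Fw k j \<and> SA k j"
  show False
    by (rule leaf_conflict[OF _ _ _ _ _ _ _ _ _ _ _ _ _ _ _ _ _ _ *[THEN conjunct1, unfolded Fw_def] _ *[THEN conjunct2, unfolded SA_def], of k j 2])
       (use assms in \<open>simp_all add: adj_simps\<close>)
qed

lemma not_Bw_SA:
  assumes "k < C" "j < N" "tab k j = 2"
  shows "\<not> (Bw k j \<and> SA k j)"
proof
  assume *: "Bw k j \<and> SA k j"
  show False
    by (rule leaf_conflict[OF _ _ _ _ _ _ _ _ _ _ _ _ _ _ _ _ _ _ *[THEN conjunct1, unfolded Bw_def] _ *[THEN conjunct2, unfolded SA_def], of k j 2])
       (use assms in \<open>simp_all add: adj_simps\<close>)
qed

lemma Fw_step: "k < C \<Longrightarrow> j < N \<Longrightarrow> Fw k j \<Longrightarrow> Fw (nx C k) j"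
  using Bw_or_Fw not_Fw_Bw by blast

text \<open>Going up to the last row, around to row 0 and up again carries \<open>Fw\<close> from
  any row to any other, so a column has one value.\<close>

lemma Fw_all:
  assumes "j < N" "k < C" "Fw k j" "k' < C"
  shows "Fw k' j"
proof -
  have up: "Fw (k + d) j" if "k + d < C" "Fw k j" for k d
    using that
  proof (induction d)
    case (Suc d)
    then show ?case using Fw_step[of "k + d" j] assms(1) by (simp add: nx_def)
  qed simp
  have "Fw (C - 1) j" using up[of k "C - 1 - k"] assms by simp
  then have "Fw 0 j" using Fw_step[of "C - 1" j] C assms(1) by (simp add: nx_def)
  then show ?thesis using up[of 0 k'] assms(4) by simp
qed

definition value_of :: "nat \<Rightarrow> bool" where "value_of j \<longleftrightarrow> \<not> Fw 0 j"

text \<open>At \<open>A\<close>, \<open>s\<close> shares the free end with the \<open>v\<close>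
  whose contact it uses, so the other \<open>v\<close> cannot be exposed there; which
  \<open>v\<close> this is depends on the sign of the literal.\<close>

lemma SA_value:
  assumes "k < C" "j < N" "SA k j" "tab k j = 1 \<or> tab k j = 2"
  shows "tab k j = 1 \<and> value_of j \<or> tab k j = 2 \<and> \<not> value_of j"
proof (cases "tab k j = 1")
  case True
  then have "\<not> Fw k j" using not_Fw_SA assms by blast
  then have "\<not> Fw 0 j" using Fw_all[OF assms(2), of 0 k] C assms(1) by auto
  then show ?thesis using True by (simp add: value_of_def)
next
  case False
  then have "\<not> Bw k j" using not_Bw_SA assms by blast
  then have "Fw (nx C k) j" using Bw_or_Fw assms by blast
  then have "Fw 0 j" using Fw_all[OF assms(2), of "nx C k" 0] C nx_lt[OF assms(1)] by auto
  then show ?thesis using False assms(4) by (simp add: value_of_def)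
qed

text \<open>\<open>HL\<close> is exposure of an \<open>h\<close> at the \<open>M\<close> of its own
  column, \<open>HR\<close> at that of the column before it. The \<open>s\<close> of an absent
  variable and the \<open>h\<close> of column 0 are not listed: they are disjoint from the
  competitors and act as blockers.\<close>

definition HL :: "nat \<Rightarrow> nat \<Rightarrow> bool" where
  "HL c j \<longleftrightarrow> exposed L (W c j 1) (c, j, 5)
     ((if tab c j \<noteq> 0 then {(c, j, 3)} else {}) \<union> (if Suc j < N then {(c, Suc j, 5)} else {}))"

definition HR :: "nat \<Rightarrow> nat \<Rightarrow> bool" where
  "HR c j \<longleftrightarrow> exposed L (W c j 1) (c, Suc j, 5)
     ((if tab c j \<noteq> 0 then {(c, j, 3)} else {}) \<union> (if j \<noteq> 0 then {(c, j, 5)} else {}))"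

lemma HR_or_HL:
  assumes "c < C" "Suc j < N"
  shows "HR c j \<or> HL c (Suc j)"
proof -
  have sn: "nx N j = Suc j" using assms by (simp add: nx_def)
  have sn': "nx N (Suc j) = Suc (Suc j)" if "Suc (Suc j) < N" using that by (simp add: nx_def)
  show ?thesis
  unfolding HR_def HL_def
  by (rule expose[of _ _ _ _ _ _ _ _ _ c "Suc j" 7])
     (use assms sn in \<open>simp_all add: adj_simps, (auto simp: nx_def)?\<close>)
qed

text \<open>In a row without a true literal every present \<open>s\<close> is exposed at
  \<open>M\<close>, by \<open>SA_value\<close>. This leaves no end for the next \<open>h\<close>, so
  each \<open>h\<close> is forced to its own \<open>M\<close>, column after column, until the only
  free end of the last \<open>M\<close> is claimed twice.\<close>

lemma table_sat_value:
  assumes vals: "\<And>c j. tab c j \<le> 2"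
  shows "table_sat C N tab value_of"
  unfolding table_sat_def
proof (rule ccontr, clarsimp)
  fix c assume c: "c < C" and unsat: "\<forall>j<N. (tab c j = Suc 0 \<longrightarrow> \<not> value_of j) \<and> (tab c j = 2 \<longrightarrow> value_of j)"
  have tab012: "tab c j = 1 \<or> tab c j = 2" if "tab c j \<noteq> 0" for j using vals[of c j] that by linarith
  have SM: "SM c j" if "j < N" "tab c j \<noteq> 0" for j
    using SA_or_SM[OF c that(1)] SA_value[OF c that(1)] tab012[OF that(2)] unsat that(1) by auto
  have HL: "HL c (Suc j)" if "Suc j < N" for j
    using that
  proof (induction j)
    case 0
    have "\<not> HR c 0"
    proof
      assume hr: "HR c 0"
      have t: "tab c 0 \<noteq> 0" using ends[OF c] by simp
      have sm: "SM c 0" using SM[of 0] N t by auto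
      \<comment> \<open>The blocker at the first \<open>M\<close> is the \<open>h\<close> of column
        0.\<close>
      show False
        by (rule leaf_conflict[OF _ _ _ _ _ _ _ _ _ _ _ _ _ _ _ _ _ _ sm[unfolded SM_def] _ hr[unfolded HR_def], of c 0 5])
           (use c C N t nx_neq[of C c] in \<open>simp_all add: adj_simps, (auto simp: nx_def split: if_splits)?\<close>)
    qed
    then show ?case using HR_or_HL[OF c, of 0] 0 by simp
  next
    case (Suc j)
    have hl: "HL c (Suc j)" using Suc by simp
    have "\<not> HR c (Suc j)"
    proof
      assume hr: "HR c (Suc j)"
      show False
      proof (cases "tab c (Suc j) = 0")
        case True
        \<comment> \<open>For an absent variable \<open>s\<close> is adjacent to neither
          \<open>h\<close> and blocks an end.\<close>
        show False
          by (rule leaf_conflict[OF _ _ _ _ _ _ _ _ _ _ _ _ _ _ _ _ _ _ hl[unfolded HL_def] _ hr[unfolded HR_def], of c "Suc j" 3])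
             (use c C N True Suc.prems nx_neq[of C c] in \<open>simp_all add: adj_simps, (auto simp: nx_def split: if_splits)?\<close>)
      next
        case False
        have sm: "SM c (Suc j)" using SM[of "Suc j"] Suc.prems False by simp
        show False
          by (rule two_ends[of L "W c (Suc j) 1" "(c, Suc j, 3)" "(c, Suc j, 5)" "(c, Suc (Suc j), 5)"])
             (use sm hl hr False Suc.prems in \<open>simp_all add: SM_def HL_def HR_def nx_def insert_commute\<close>)
      qed
    qed
    then show ?case using HR_or_HL[OF c, of "Suc j"] Suc.prems by simp
  qed
  define n where "n = N - 2"
  have n: "N = Suc (Suc n)" using N by (simp add: n_def)
  have hl: "HL c (Suc n)" using HL[of n] n by simp
  have t: "tab c (Suc n) \<noteq> 0" using ends[OF c] n by simp
  have sm: "SM c (Suc n)" using SM[of "Suc n"] n t by simp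
  \<comment> \<open>By the cyclic indexing the \<open>h\<close> of column 0 blocks an end of the
    last \<open>M\<close> as well.\<close>
  show False
    by (rule leaf_conflict[OF _ _ _ _ _ _ _ _ _ _ _ _ _ _ _ _ _ _ sm[unfolded SM_def] _ hl[unfolded HL_def], of c 0 5])
       (use c C N t n nx_neq[of C c] in \<open>simp_all add: adj_simps, (auto simp: nx_def split: if_splits)?\<close>)
qed

end

theorem graph_sound:
  assumes "2 < C" "2 < N" "\<And>c. c < C \<Longrightarrow> tab c 0 \<noteq> 0 \<and> tab c (N - 1) \<noteq> 0" "\<And>c j. tab c j \<le> 2"
    "unit_d_interval_graph 2 (verts C N) (adj C N tab)"
  shows "\<exists>a. table_sat C N tab a"
proof -
  obtain L where "represents L (verts C N) (adj C N tab)" using assms(5) unit_2_interval_graph_iff by blast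
  then interpret table_layout C N tab L by unfold_locales (use assms in auto)
  show ?thesis using table_sat_value assms(4) by blast
qed

subsection \<open>From assignments to layouts\<close>

lemma scaled_distance:
  fixes a b x y :: int
  assumes "0 \<le> x" "x < 200" "0 \<le> y" "y < 200"
  shows "\<bar>(1000 * a + x) - (1000 * b + y)\<bar> \<le> 10 \<longleftrightarrow> a = b \<and> \<bar>x - y\<bar> \<le> 10"
proof (cases a b rule: linorder_cases)
  case less
  then have "1000 * (a + 1) \<le> 1000 * b" by simp
  then show ?thesis using assms less by (auto simp: abs_le_iff)
next
  case greater
  then have "1000 * (b + 1) \<le> 1000 * a" by simp
  then show ?thesis using assms greater by (auto simp: abs_le_iff)
qed simp

text \<open>A layout may be given piecewise: sites lie 1000 apart and hold offsets below 200, so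
  intervals of different sites never meet. The factor 1/10 turns length 10 into 1.\<close>

lemma represents_sites:
  fixes pos :: "'a \<Rightarrow> bool \<Rightarrow> 's :: countable \<times> int"
  assumes range: "\<And>v i. v \<in> V \<Longrightarrow> 0 \<le> snd (pos v i) \<and> snd (pos v i) < 200"
    and two: "\<And>v. v \<in> V \<Longrightarrow> fst (pos v False) \<noteq> fst (pos v True) \<or> \<bar>snd (pos v False) - snd (pos v True)\<bar> > 10"
    and E: "\<And>u v. u \<in> V \<Longrightarrow> v \<in> V \<Longrightarrow> u \<noteq> v \<Longrightarrow> E u v \<longleftrightarrow>
      (\<exists>i k. fst (pos u i) = fst (pos v k) \<and> \<bar>snd (pos u i) - snd (pos v k)\<bar> \<le> 10)"
  shows "unit_d_interval_graph 2 V E"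
proof -
  define L where "L v i = real_of_int (1000 * int (to_nat (fst (pos v i))) + snd (pos v i)) / 10" for v i
  have L: "\<bar>L u i - L v k\<bar> \<le> 1 \<longleftrightarrow> fst (pos u i) = fst (pos v k) \<and> \<bar>snd (pos u i) - snd (pos v k)\<bar> \<le> 10"
    if "u \<in> V" "v \<in> V" for u v i k
  proof -
    let ?a = "int (to_nat (fst (pos u i)))" and ?b = "int (to_nat (fst (pos v k)))"
    let ?x = "snd (pos u i)" and ?y = "snd (pos v k)"
    have "\<bar>real_of_int m / 10 - real_of_int n / 10\<bar> \<le> 1 \<longleftrightarrow> \<bar>m - n\<bar> \<le> 10" for m n
      by (auto simp: abs_le_iff)
    then have "\<bar>L u i - L v k\<bar> \<le> 1 \<longleftrightarrow> \<bar>(1000 * ?a + ?x) - (1000 * ?b + ?y)\<bar> \<le> 10"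
      unfolding L_def .
    also have "\<dots> \<longleftrightarrow> ?a = ?b \<and> \<bar>?x - ?y\<bar> \<le> 10"
      using range[OF that(1), of i] range[OF that(2), of k] by (intro scaled_distance) auto
    also have "?a = ?b \<longleftrightarrow> fst (pos u i) = fst (pos v k)" by simp
    finally show ?thesis .
  qed
  have "represents L V E" unfolding represents_def touch_def
  proof (intro conjI ballI impI)
    fix v assume v: "v \<in> V"
    have "\<not> \<bar>L v False - L v True\<bar> \<le> 1" unfolding L[OF v v] using two[OF v] by auto
    then show "\<bar>L v False - L v True\<bar> > 1" by simp
  next
    fix u v assume "u \<in> V" "v \<in> V" "u \<noteq> v"
    then show "E u v \<longleftrightarrow> (\<exists>i k. \<bar>L u i - L v k\<bar> \<le> 1)" unfolding E[OF \<open>u \<in> V\<close> \<open>v \<in> V\<close> \<open>u \<noteq> v\<close>] L[OF \<open>u \<in> V\<close> \<open>v \<in> V\<close>] by simp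
  qed
  then show ?thesis using unit_2_interval_graph_iff by blast
qed

text \<open>An Euler trail of the gadget from 0 to 4; it passes from 5 to 1 in its second step.\<close>

definition trail :: "nat \<Rightarrow> bool \<Rightarrow> int" where
  "trail a i = 10 + 9 * ((if i then [8, 10, 12, 14, 15, 5, 11, 13] else [0, 2, 4, 6, 3, 1, 7, 9]) ! a)"

lemma less_8: "a < 8 \<longleftrightarrow> a \<in> {0, 1, 2, 3, 4, 5, 6, 7}" for a :: nat
  by auto

lemma ex_bool: "(\<exists>i. P i) \<longleftrightarrow> P False \<or> P True"
  by (metis (full_types))

text \<open>The stations are 0 5 1 4 2 5 3 6 0 7 1 6 2 7 3 4. They are 9 apart, so exactly the
  consecutive ones are within distance 10.\<close>

lemma trail_edge:
  assumes "a < 8" "b < 8" "a \<noteq> b"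
  shows "(\<exists>i k. \<bar>trail a i - trail b k\<bar> \<le> 10) \<longleftrightarrow> k44 a b \<or> k44 b a"
  using assms unfolding less_8 k44_def ex_bool trail_def by (elim insertE emptyE) simp_all

text \<open>The place 23 lies between the second and third stations, 19 and 28, which belong to 5
  and 1; the next ones, 10 and 37, are too far away.\<close>

lemma trail_white:
  assumes "a < 8"
  shows "(\<exists>i. \<bar>23 - trail a i\<bar> \<le> 10) \<longleftrightarrow> a = 1 \<or> a = 5"
  using assms unfolding less_8 ex_bool trail_def by (elim insertE emptyE) simp_all

lemma trail_far:
  assumes "a < 8"
  shows "\<bar>trail a False - trail a True\<bar> > 10" "0 \<le> trail a i \<and> trail a i < 200"
  using assms unfolding less_8 trail_def by (elim insertE emptyE; simp)+

definition pr :: "nat \<Rightarrow> nat \<Rightarrow> nat" where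
  "pr n i = (if i = 0 then n - 1 else i - 1)"

lemma pr_lt: "i < n \<Longrightarrow> pr n i < n"
  by (auto simp: pr_def)

lemma pr_nx: "i < n \<Longrightarrow> pr n (nx n i) = i"
  by (auto simp: pr_def nx_def)

lemma nx_pr: "i < n \<Longrightarrow> nx n (pr n i) = i"
  by (auto simp: pr_def nx_def)

locale satisfied_table =
  fixes C N :: nat and tab :: "nat \<Rightarrow> nat \<Rightarrow> nat" and a :: "nat \<Rightarrow> bool" and w :: "nat \<Rightarrow> nat"
  assumes C: "2 < C" and N: "2 < N" and ends: "\<And>c. c < C \<Longrightarrow> tab c 0 \<noteq> 0" "\<And>c. c < C \<Longrightarrow> tab c (N - 1) \<noteq> 0"
    and vals: "\<And>c j. tab c j \<le> 2"
    and w: "\<And>c. c < C \<Longrightarrow> w c < N"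
      "\<And>c. c < C \<Longrightarrow> tab c (w c) = 1 \<and> a (w c) \<or> tab c (w c) = 2 \<and> \<not> a (w c)"
begin

definition lit :: "nat \<Rightarrow> nat \<Rightarrow> bool" where
  "lit c j \<longleftrightarrow> tab c j = 1 \<and> a j \<or> tab c j = 2 \<and> \<not> a j"

text \<open>
  The intervals live at sites: 0 and 1 are the places of \<open>A\<close> and \<open>M\<close> outside their gadgets, 2 and 3
  the gadgets, and 4 to 6 serve the spare intervals of \<open>2\<close>, \<open>6\<close> and \<open>7\<close>. Lengths are scaled by 10.
\<close>

definition sM :: "nat \<Rightarrow> nat \<Rightarrow> int" where
  "sM c j = (if j = w c then if j = 0 then 52 else 48 else if tab c j = 0 then 59 else 54)"

text \<open>Up to column \<open>w c\<close> each \<open>h\<close> reaches its contact at its own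
  \<open>M\<close>, after it at the \<open>M\<close> of the previous column. At \<open>w c\<close>
  two of them stick out, one at each end, which is possible because \<open>s\<close> is served at
  \<open>A\<close> and can stay inside \<open>M\<close>. The values 41 and 46 are in reach of a
  contact at 37, 54 and 59 of one at 63, 48 and 52 of neither; 41 and 59 place the \<open>h\<close>
  of column 0, which must miss its competitors.\<close>

definition hM :: "nat \<Rightarrow> nat \<Rightarrow> int" where
  "hM c j = (if j \<le> w c then if j = 0 then 41 else 46 else if j = N - 1 then 52 else 48)"

definition hN :: "nat \<Rightarrow> nat \<Rightarrow> int" where
  "hN c j = (if j < w c then if j = 0 then 52 else 48
     else if j = w c then if j = N - 1 then 59 else 54 else if j = N - 1 then 41 else 46)"

definition lam :: "nat \<Rightarrow> nat \<Rightarrow> vertex \<times> int" where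
  "lam c j = (if j \<le> w c then ((c, j, 1), 37) else ((c, j - 1, 1), if j - 1 = w c then 63 else 37))"

text \<open>The first interval of a contact 6 is spent where its \<open>v\<close> sticks out. If the
  \<open>s\<close> sharing it has a false literal, that \<open>s\<close> is out of reach there and
  has to be met at its \<open>M\<close>, at place 63.\<close>

definition kap :: "nat \<Rightarrow> nat \<Rightarrow> vertex \<times> int" where
  "kap c j = (if a j \<and> tab c j = 2 then ((c, j, 1), 63)
     else if \<not> a j \<and> tab (pr C c) j = 1 then ((pr C c, j, 1), 63) else ((c, j, 5), 0))"

fun pos :: "vertex \<Rightarrow> bool \<Rightarrow> vertex \<times> int" where
  pos_def: "pos (c, j, t) i =
    (if t = 0 then if i then ((c, j, 2), 23) else ((c, j, 0), 50)
     else if t = 1 then if i then ((c, j, 3), 23) else ((c, j, 1), 50)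
     else if t = 2 then if i then ((c, j, 4), 0) else ((c, j, 0), 41)
     else if t = 3 then if i then ((c, j, 1), sM c j) else ((c, j, 0), if lit c j then 57 else 55)
     else if t = 4 then if i then ((pr C c, j, 0), if a j then 58 else 54) else ((c, j, 0), if a j then 54 else 58)
     else if t = 5 then if i then ((c, pr N j, 1), hN c (pr N j)) else ((c, j, 1), hM c j)
     else if t = 6 then if i then kap c j else ((if a j then pr C c else c, j, 0), 66)
     else if t = 7 then if i then ((c, j, 6), 0) else lam c j
     else if t < 16 then ((c, j, 2), trail (t - 8) i) else ((c, j, 3), trail (t - 16) i))"

declare pos_def [simp del]

lemma pos_simps [simp]:
  "pos (c, j, 0) i = (if i then ((c, j, 2), 23) else ((c, j, 0), 50))"
  "pos (c, j, Suc 0) i = (if i then ((c, j, 3), 23) else ((c, j, 1), 50))"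
  "pos (c, j, 2) i = (if i then ((c, j, 4), 0) else ((c, j, 0), 41))"
  "pos (c, j, 3) i = (if i then ((c, j, 1), sM c j) else ((c, j, 0), if lit c j then 57 else 55))"
  "pos (c, j, 4) i = (if i then ((pr C c, j, 0), if a j then 58 else 54) else ((c, j, 0), if a j then 54 else 58))"
  "pos (c, j, 5) i = (if i then ((c, pr N j, 1), hN c (pr N j)) else ((c, j, 1), hM c j))"
  "pos (c, j, 6) i = (if i then kap c j else ((if a j then pr C c else c, j, 0), 66))"
  "pos (c, j, 7) i = (if i then ((c, j, 6), 0) else lam c j)"
  by (simp_all add: pos_def)

lemma pos_gadget: "s < 2 \<Longrightarrow> b < 8 \<Longrightarrow> pos (c, j, 8 + 8 * s + b) i = ((c, j, 2 + s), trail b i)"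
  by (auto simp: pos_def less_Suc_eq numeral_2_eq_2)

lemma verts_cases:
  assumes "v \<in> verts C N"
  obtains c j t where "v = (c, j, t)" "c < C" "j < N" "t \<in> {0, 1, 2, 3, 4, 5, 6, 7}"
    | c j s b where "v = (c, j, 8 + 8 * s + b)" "c < C" "j < N" "s < 2" "b < 8"
proof -
  obtain c j t where v: "v = (c, j, t)" "c < C" "j < N" "t < 24" using assms by (auto simp: verts_def)
  show thesis
  proof (cases "t < 8")
    case True
    then show ?thesis using that(1) v unfolding less_8 by blast
  next
    case False
    then have "t = 8 + 8 * ((t - 8) div 8) + (t - 8) mod 8" "(t - 8) div 8 < 2" "(t - 8) mod 8 < 8" using v by auto
    then show ?thesis using that(2) v by metis
  qed
qed

definition meet :: "vertex \<Rightarrow> vertex \<Rightarrow> bool" where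
  "meet u v \<longleftrightarrow> (\<exists>i k. fst (pos u i) = fst (pos v k) \<and> \<bar>snd (pos u i) - snd (pos v k)\<bar> \<le> 10)"

lemma nx_simps [simp]:
  "nx C i \<noteq> i" "nx N i \<noteq> i" "i \<noteq> nx C i" "i \<noteq> nx N i" "nx C (nx C i) \<noteq> i" "nx N (nx N i) \<noteq> i"
  "i \<noteq> nx C (nx C i)" "i \<noteq> nx N (nx N i)"
  "nx C i = nx C i' \<longleftrightarrow> i = i'" "nx N i = nx N i' \<longleftrightarrow> i = i'" "i < C \<Longrightarrow> nx C i < C" "i < N \<Longrightarrow> nx N i < N"
  "i < C \<Longrightarrow> pr C i < C" "i < N \<Longrightarrow> pr N i < N" "i < C \<Longrightarrow> pr C (nx C i) = i" "i < N \<Longrightarrow> pr N (nx N i) = i"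
  "i < C \<Longrightarrow> nx C (pr C i) = i" "i < N \<Longrightarrow> nx N (pr N i) = i"
  using C N nx_neq[of C i] nx_neq[of N i] nx_nx_neq[of C i] nx_nx_neq[of N i] nx_inj[of C i i'] nx_inj[of N i i']
    nx_lt[of i C] nx_lt[of i N] pr_lt[of i C] pr_lt[of i N] pr_nx[of i C] pr_nx[of i N] nx_pr[of i C] nx_pr[of i N] by auto

lemma pr_eq [simp]: "i < C \<Longrightarrow> i' < C \<Longrightarrow> pr C i = i' \<longleftrightarrow> i = nx C i'" "i < N \<Longrightarrow> i' < N \<Longrightarrow> pr N i = i' \<longleftrightarrow> i = nx N i'"
  by auto

lemma pr_neq [simp]: "i < C \<Longrightarrow> pr C i \<noteq> i" "i < N \<Longrightarrow> pr N i \<noteq> i" "i < C \<Longrightarrow> i \<noteq> pr C i" "i < N \<Longrightarrow> i \<noteq> pr N i"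
  using C N by (auto simp: pr_def)

lemma pos_range: "v \<in> verts C N \<Longrightarrow> 0 \<le> snd (pos v i) \<and> snd (pos v i) < 200"
proof (erule verts_cases)
  fix c j t assume "v = (c, j, t)" "t \<in> {0, 1, 2, 3, 4, 5, 6, 7 :: nat}"
  then show ?thesis
    by (elim insertE emptyE) (simp_all add: sM_def hM_def hN_def lam_def kap_def)
qed (use trail_far(2) in \<open>simp add: pos_gadget\<close>)

lemma pos_two: "v \<in> verts C N \<Longrightarrow> fst (pos v False) \<noteq> fst (pos v True) \<or> \<bar>snd (pos v False) - snd (pos v True)\<bar> > 10"
proof (erule verts_cases)
  fix c j t assume "v = (c, j, t)" "c < C" "j < N" "t \<in> {0, 1, 2, 3, 4, 5, 6, 7 :: nat}"
  then have "fst (pos v False) \<noteq> fst (pos v True)"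
    by (elim insertE emptyE) (simp_all add: lam_def kap_def)
  then show ?thesis ..
qed (use trail_far(1) in \<open>simp add: pos_gadget\<close>)

lemma sM_values: "sM c j \<in> {48, 52, 54, 59}"
  and hM_values: "hM c j \<in> {41, 46, 48, 52}"
  and hN_values: "hN c j \<in> {41, 46, 48, 52, 54, 59}"
  by (auto simp: sM_def hM_def hN_def)

lemma meet_site:
  assumes "fst (pos u i) = fst (pos v k)" "\<bar>snd (pos u i) - snd (pos v k)\<bar> \<le> 10"
  shows "meet u v"
  using assms unfolding meet_def by blast

lemma not_lit: "c < C \<Longrightarrow> \<not> lit c j \<Longrightarrow> j \<noteq> w c"
  using w(2)[of c] by (auto simp: lit_def)

lemma meet_gadget:
  assumes "t < 2" "d < 8" "b < 8" "k44 d b"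
  shows "meet (c, j, 8 + 8 * t + d) (c, j, 8 + 8 * t + b)"
proof -
  obtain i k where "\<bar>trail d i - trail b k\<bar> \<le> 10" using trail_edge[of d b] assms by (auto simp: k44_def)
  then show ?thesis using assms(1-3) by (intro meet_site[of _ i _ k]) (simp_all add: pos_gadget)
qed

lemma meet_white:
  assumes "t < 2" "b = 1 \<or> b = 5"
  shows "meet (c, j, t) (c, j, 8 + 8 * t + b)"
proof -
  obtain k where k: "\<bar>23 - trail b k\<bar> \<le> 10" using trail_white[of b] assms by auto
  have "b < 8" using assms by auto
  then show ?thesis using k assms by (intro meet_site[of _ True _ k]) (auto simp: pos_gadget less_Suc_eq numeral_2_eq_2)
qed

lemma meet_h_lam:
  assumes "j < N"
  shows "meet (c, j, 5) (c, j, 7)"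
proof (cases "j \<le> w c")
  case True
  then show ?thesis by (intro meet_site[of _ False _ False]) (auto simp: lam_def hM_def)
next
  case False
  then have "pr N j = j - 1" "j - 1 \<noteq> N - 1" "\<not> j - 1 < w c" using assms by (auto simp: pr_def)
  then show ?thesis using False by (intro meet_site[of _ True _ False]) (auto simp: lam_def hN_def)
qed

lemma meet_cell:
  assumes "c < C" "j < N" "cell_edge tab c j t t'"
  shows "meet (c, j, t) (c, j, t')"
  using assms(3) unfolding cell_edge_def
proof (elim disjE conjE)
    assume *: "(t, t') \<in> {(0, 2), (0, 4), (0, 3), (1, 5), (1, 3), (3, 4), (4, 6), (5, 7), (0, 9), (0, 13), (1, 17), (1, 21)}"
    note white = meet_white[of 0 1 c j] meet_white[of 0 5 c j] meet_white[of 1 1 c j] meet_white[of 1 5 c j]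
    have "meet (c, j, 0) (c, j, 2)" "meet (c, j, 0) (c, j, 4)" "meet (c, j, 0) (c, j, 3)" "meet (c, j, 1) (c, j, 5)"
      "meet (c, j, 1) (c, j, 3)" "meet (c, j, 3) (c, j, 4)" "meet (c, j, 4) (c, j, 6)"
      using sM_values[of c j] hM_values[of c j] by (auto simp: meet_def ex_bool)
    then show ?thesis using * white meet_h_lam[OF assms(2), of c] by (elim insertE emptyE) simp_all
  next
    assume "8 \<le> t" "8 \<le> t'" "k44 (t - 8) (t' - 8)"
    then show ?thesis using meet_gadget[of 0 "t - 8" "t' - 8" c j] by (simp add: k44_def)
  next
    assume "16 \<le> t" "16 \<le> t'" "k44 (t - 16) (t' - 16)"
    then show ?thesis using meet_gadget[of 1 "t - 16" "t' - 16" c j] by (simp add: k44_def)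
  next
    assume "t = 3" "t' = 5" "tab c j \<noteq> 0" "j \<noteq> 0"
    then show ?thesis by (intro meet_site[of _ True _ False]) (auto simp: sM_def hM_def)
  next
    assume 5: "t = 3" "t' = 6" "tab c j = 2"
    show ?thesis
    proof (cases "a j")
      case True
      then have "j \<noteq> w c" using not_lit[OF assms(1)] 5 by (auto simp: lit_def)
      then show ?thesis using 5 True by (intro meet_site[of _ True _ True]) (auto simp: sM_def kap_def)
    next
      case False
      then show ?thesis using 5 by (intro meet_site[of _ False _ False]) (auto simp: lit_def)
    qed
qed

lemma meet_dedge:
  assumes "dedge C N tab (c, j, t) (c', j', t')" "c < C" "j < N"
  shows "meet (c, j, t) (c', j', t')"
proof -
  consider "c' = c" "j' = j" "cell_edge tab c j t t'"
    | "c' = nx C c" "j' = j" "(t, t') \<in> {(0, 4), (3, 4), (4, 4)}"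
    | "c' = nx C c" "j' = j" "t = 3" "t' = 6" "tab c j = 1"
    | "c' = c" "j' = nx N j" "t = 1" "t' = 5"
    | "c' = c" "j' = nx N j" "t = 3" "t' = 5" "tab c j \<noteq> 0" "j' \<noteq> 0"
    | "c' = c" "j' = nx N j" "t = 5" "t' = 5" "j \<noteq> 0" "j' \<noteq> 0"
    using assms(1) by auto
  then show ?thesis
  proof cases
    case 1
    then show ?thesis using meet_cell assms by auto
  next
    case 2
    then show ?thesis using assms(2,3) by (intro meet_site[of _ False _ True]) auto
  next
    case 3
    show ?thesis
    proof (cases "a j")
      case True
      then show ?thesis using 3 assms(2,3) by (intro meet_site[of _ False _ False]) (auto simp: lit_def)
    next
      case False
      then have "j \<noteq> w c" using not_lit[OF assms(2)] 3 by (auto simp: lit_def)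
      then show ?thesis using 3 False assms(2,3) by (intro meet_site[of _ True _ True]) (auto simp: sM_def kap_def)
    qed
  next
    case 4
    then show ?thesis using assms(2,3) hN_values[of c j] by (intro meet_site[of _ False _ True]) auto
  next
    case 5
    then have "j \<noteq> N - 1" using N by (auto simp: nx_def split: if_splits)
    then show ?thesis using 5 assms(2,3) by (intro meet_site[of _ True _ True]) (auto simp: sM_def hN_def)
  next
    case 6
    then have "j \<noteq> N - 1" using N by (auto simp: nx_def split: if_splits)
    then show ?thesis using 6 assms(2,3) by (intro meet_site[of _ False _ True]) (auto simp: hM_def hN_def)
  qed
qed

lemma meet_sym: "meet u v \<Longrightarrow> meet v u"
  unfolding meet_def by (metis abs_minus_commute)

text \<open>At a true value the \<open>v\<close> of the next row sticks out, at 58, and at a false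
  one that of the same row. The contact at 66 also reaches \<open>s\<close> at 57, but not at
  55.\<close>

definition occA :: "nat \<Rightarrow> nat \<Rightarrow> (vertex \<times> int) set" where
  "occA c j = {((c, j, 0), 50), ((c, j, 2), 41), ((c, j, 3), if lit c j then 57 else 55),
     ((c, j, 4), if a j then 54 else 58), ((nx C c, j, 4), if a j then 58 else 54),
     ((if a j then nx C c else c, j, 6), 66)}"

definition occM :: "nat \<Rightarrow> nat \<Rightarrow> (vertex \<times> int) list" where
  "occM c j = [((c, j, 1), 50), ((c, j, 3), sM c j), ((c, j, 5), hM c j), ((c, nx N j, 5), hN c j)] @
     (if tab c j = 2 \<and> a j then [((c, j, 6), 63)] else if tab c j = 1 \<and> \<not> a j then [((nx C c, j, 6), 63)] else []) @
     (if j \<le> w c then [((c, j, 7), 37)] else []) @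
     (if w c \<le> j \<and> j \<noteq> N - 1 then [((c, nx N j, 7), if j = w c then 63 else 37)] else [])"

lemma site_0: "v \<in> verts C N \<Longrightarrow> c < C \<Longrightarrow> j < N \<Longrightarrow> fst (pos v i) = (c, j, 0) \<Longrightarrow> (v, snd (pos v i)) \<in> occA c j"
proof (erule verts_cases)
  fix c' j' t assume "c < C" "j < N" "fst (pos v i) = (c, j, 0)" "v = (c', j', t)" "c' < C" "j' < N" "t \<in> {0, 1, 2, 3, 4, 5, 6, 7 :: nat}"
  then show ?thesis
    by (elim insertE emptyE) (auto simp: occA_def lam_def kap_def split: if_splits)
qed (simp add: pos_gadget)

lemma site_1: "v \<in> verts C N \<Longrightarrow> c < C \<Longrightarrow> j < N \<Longrightarrow> fst (pos v i) = (c, j, 1) \<Longrightarrow> (v, snd (pos v i)) \<in> set (occM c j)"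
proof (erule verts_cases)
  fix c' j' t assume *: "c < C" "j < N" "fst (pos v i) = (c, j, 1)" "v = (c', j', t)" "c' < C" "j' < N" "t \<in> {0, 1, 2, 3, 4, 5, 6, 7 :: nat}"
  have sn: "nx N (j' - Suc 0) = j'" if "\<not> j' \<le> x" for x using that * by (auto simp: nx_def)
  have sn': "j' = nx N y" if "\<not> j' \<le> x" "j' - Suc 0 = y" for x y using that * by (auto simp: nx_def)
  show ?thesis using *
    by (elim insertE emptyE) (auto simp: occM_def lam_def kap_def sn intro: sn' split: if_splits)
qed (simp add: pos_gadget)

lemma site_gadget:
  "v \<in> verts C N \<Longrightarrow> s < 2 \<Longrightarrow> fst (pos v i) = (c, j, 2 + s) \<Longrightarrow>
   v = (c, j, s) \<and> snd (pos v i) = 23 \<or> (\<exists>b<8. v = (c, j, 8 + 8 * s + b) \<and> snd (pos v i) = trail b i)"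
proof (erule verts_cases)
  fix c' j' t assume "s < 2" "fst (pos v i) = (c, j, 2 + s)" "v = (c', j', t)" "c' < C" "j' < N" "t \<in> {0, 1, 2, 3, 4, 5, 6, 7 :: nat}"
  then show ?thesis
    by (elim insertE emptyE) (auto simp: lam_def kap_def split: if_splits)
qed (auto simp: pos_gadget)

lemma site_spare: "v \<in> verts C N \<Longrightarrow> 4 \<le> s \<Longrightarrow> fst (pos v i) = (c, j, s) \<Longrightarrow>
   v = (c, j, if s = 4 then 2 else if s = 5 then 6 else 7)"
proof (erule verts_cases)
  fix c' j' t assume "4 \<le> s" "fst (pos v i) = (c, j, s)" "v = (c', j', t)" "c' < C" "j' < N" "t \<in> {0, 1, 2, 3, 4, 5, 6, 7 :: nat}"
  then show ?thesis
    by (elim insertE emptyE) (auto simp: lam_def kap_def split: if_splits)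
qed (simp add: pos_gadget)

lemma pos_site: "v \<in> verts C N \<Longrightarrow> \<exists>c j s. fst (pos v i) = (c, j, s) \<and> c < C \<and> j < N"
proof (erule verts_cases)
  fix c j t assume "v = (c, j, t)" "c < C" "j < N" "t \<in> {0, 1, 2, 3, 4, 5, 6, 7 :: nat}"
  then show ?thesis
    by (elim insertE emptyE) (simp_all add: lam_def kap_def less_imp_diff_less)
qed (simp add: pos_gadget)

lemma nx_eq_0: "j < N \<Longrightarrow> nx N j = 0 \<longleftrightarrow> j = N - 1" "j < N \<Longrightarrow> 0 = nx N j \<longleftrightarrow> j = N - 1"
  using N by (auto simp: nx_def)

lemma adj_site_0:
  assumes "c < C" "j < N" "(u, x) \<in> occA c j" "(v, y) \<in> occA c j" "u \<noteq> v" "\<bar>x - y\<bar> \<le> 10"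
  shows "adj C N tab u v"
  using assms unfolding occA_def
  by (elim insertE emptyE; cases "a j"; simp add: adj_def cell_edge_def k44_def lit_def split: if_splits)

text \<open>For a symmetric relation each unordered pair needs to be examined only once, in list
  order; this keeps the case analysis in \<open>adj_site_1\<close> small.\<close>

lemma close_pairs:
  assumes "\<And>u v. R u v \<Longrightarrow> R v u" "sorted_wrt (\<lambda>p q. \<bar>snd p - snd q\<bar> \<le> (10 :: int) \<longrightarrow> R (fst p) (fst q)) xs"
    "(u, x) \<in> set xs" "(v, y) \<in> set xs" "u \<noteq> v" "\<bar>x - y\<bar> \<le> 10"
  shows "R u v"
proof -
  obtain m n where mn: "m < length xs" "xs ! m = (u, x)" "n < length xs" "xs ! n = (v, y)"
    using assms(3,4) by (auto simp: in_set_conv_nth)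
  consider "m < n" | "n < m" using mn assms(5) by (cases m n rule: linorder_cases) auto
  then show ?thesis
  proof cases
    case 1
    then show ?thesis using sorted_wrt_nth_less[OF assms(2) 1] mn assms(6) by simp
  next
    case 2
    then show ?thesis using sorted_wrt_nth_less[OF assms(2) 2] mn assms(1,6) by (simp add: abs_minus_commute)
  qed
qed

lemma adj_site_1:
  assumes "c < C" "j < N" "(u, x) \<in> set (occM c j)" "(v, y) \<in> set (occM c j)" "u \<noteq> v" "\<bar>x - y\<bar> \<le> 10"
  shows "adj C N tab u v"
proof -
  let ?M = "(c, j, 1)" and ?s = "(c, j, 3)" and ?h = "(c, j, 5)" and ?h' = "(c, nx N j, 5)"
  let ?adj = "adj C N tab"
  have e: "tab c 0 \<noteq> 0" "tab c (N - 1) \<noteq> 0" using ends assms(1) by auto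
  have edges: "?adj ?M ?s" "?adj ?M ?h" "?adj ?M ?h'" "tab c j \<noteq> 0 \<Longrightarrow> j \<noteq> 0 \<Longrightarrow> ?adj ?s ?h"
    "tab c j \<noteq> 0 \<Longrightarrow> j \<noteq> N - 1 \<Longrightarrow> ?adj ?s ?h'" "j \<noteq> 0 \<Longrightarrow> j \<noteq> N - 1 \<Longrightarrow> ?adj ?h ?h'"
    "tab c j = 2 \<Longrightarrow> ?adj ?s (c, j, 6)" "tab c j = 1 \<Longrightarrow> ?adj ?s (nx C c, j, 6)"
    "?adj ?h (c, j, 7)" "?adj ?h' (c, nx N j, 7)"
    using assms(1,2) by (simp_all add: adj_def cell_edge_def nx_eq_0)
  have wN: "w c < N" using w(1) assms(1) by simp
  have "sorted_wrt (\<lambda>p q. \<bar>snd p - snd q\<bar> \<le> 10 \<longrightarrow> ?adj (fst p) (fst q)) (occM c j)"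
  proof (cases "j = w c")
    case True
    then have "tab c j = 1 \<and> a j \<or> tab c j = 2 \<and> \<not> a j" using w(2)[OF assms(1)] by simp
    then show ?thesis using True edges N unfolding occM_def sM_def hM_def hN_def
      by (cases "j = 0"; cases "j = N - 1"; cases "a j"; simp)
  next
    case False
    show ?thesis
    proof (cases "j < w c")
      case True
      then have "j \<noteq> N - 1" "\<not> w c \<le> j" "j \<le> w c" using wN by simp_all
      then show ?thesis using False True edges e N unfolding occM_def sM_def hM_def hN_def
        by (cases "j = 0"; cases "tab c j = 0"; cases "a j"; simp)
    next
      case 2: False
      then have "j \<noteq> 0" "\<not> j \<le> w c" "w c \<le> j" using False by simp_all
      then show ?thesis using False edges e unfolding occM_def sM_def hM_def hN_def
        by (cases "j = N - 1"; cases "tab c j = 0"; cases "a j"; simp)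
    qed
  qed
  then show ?thesis using close_pairs[of ?adj "occM c j"] adj_sym assms(3-) by blast
qed

lemma cell_edge_adj: "cell_edge tab c j t t' \<Longrightarrow> adj C N tab (c, j, t) (c, j, t') \<and> adj C N tab (c, j, t') (c, j, t)"
  by (simp add: adj_def)

lemma white_edge: "r < 2 \<Longrightarrow> b = 1 \<or> b = 5 \<Longrightarrow> cell_edge tab c j r (8 + 8 * r + b)"
  by (elim disjE; cases "r = 0"; simp add: cell_edge_def)

lemma trail_cell_edge: "r < 2 \<Longrightarrow> k44 b b' \<Longrightarrow> cell_edge tab c j (8 + 8 * r + b) (8 + 8 * r + b')"
  by (cases "r = 0") (simp_all add: cell_edge_def less_2_cases_iff)

text \<open>Intervals meet only at a common site, so inspecting the complete inventory of each kind
  of site suffices.\<close>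

lemma meet_adj:
  assumes "u \<in> verts C N" "v \<in> verts C N" "u \<noteq> v" "meet u v"
  shows "adj C N tab u v"
proof -
  obtain i k where ik: "fst (pos u i) = fst (pos v k)" "\<bar>snd (pos u i) - snd (pos v k)\<bar> \<le> 10"
    using assms(4) unfolding meet_def by blast
  obtain c j s where s: "fst (pos u i) = (c, j, s)" "c < C" "j < N" using pos_site[OF assms(1)] by blast
  have s': "fst (pos v k) = (c, j, s)" using s ik by simp
  consider "s = 0" | "s = 1" | "s = 2 + (s - 2)" "s - 2 < 2" | "4 \<le> s" by linarith
  then show ?thesis
  proof cases
    case 1
    then show ?thesis using adj_site_0[OF s(2,3) site_0 site_0 assms(3) ik(2)] s s' assms by blast
  next
    case 2
    then show ?thesis using adj_site_1[OF s(2,3) site_1 site_1 assms(3) ik(2)] s s' assms by blast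
  next
    case 3
    define r where "r = s - 2"
    have r: "r < 2" "fst (pos u i) = (c, j, 2 + r)" "fst (pos v k) = (c, j, 2 + r)" using 3 s s' r_def by simp_all
    have edge: "adj C N tab (c, j, r) (c, j, 8 + 8 * r + b)" "adj C N tab (c, j, 8 + 8 * r + b) (c, j, r)"
      if "b = 1 \<or> b = 5" for b
      using cell_edge_adj white_edge[OF r(1) that] by blast+
    have edge': "adj C N tab (c, j, 8 + 8 * r + b) (c, j, 8 + 8 * r + b')" if "k44 b b' \<or> k44 b' b" for b b'
      using that cell_edge_adj trail_cell_edge[OF r(1)] by blast
    consider "u = (c, j, r)" "snd (pos u i) = 23" | b where "b < 8" "u = (c, j, 8 + 8 * r + b)" "snd (pos u i) = trail b i"
      using site_gadget[OF assms(1) r(1,2)] by blast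
    then show ?thesis
    proof cases
      case 1
      then obtain b where "b < 8" "v = (c, j, 8 + 8 * r + b)" "snd (pos v k) = trail b k"
        using site_gadget[OF assms(2) r(1,3)] assms(3) by blast
      then show ?thesis using 1 ik(2) trail_white[of b] edge(1)[of b] by auto
    next
      case (2 b)
      consider "v = (c, j, r)" "snd (pos v k) = 23" | b' where "b' < 8" "v = (c, j, 8 + 8 * r + b')" "snd (pos v k) = trail b' k"
        using site_gadget[OF assms(2) r(1,3)] by blast
      then show ?thesis
      proof cases
        case 1
        then have "\<bar>23 - trail b i\<bar> \<le> 10" using 2 ik(2) by (simp add: abs_minus_commute)
        then have "b = 1 \<or> b = 5" using trail_white[of b] 2(1) by blast
        then show ?thesis using edge(2)[of b] 1 2 by simp
      next
        case (2 b')
        then have "k44 b b' \<or> k44 b' b" using trail_edge[of b b'] \<open>b < 8\<close> \<open>u = _\<close> \<open>snd (pos u i) = _\<close> ik(2) assms(3) by auto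
        then show ?thesis using edge'[of b b'] 2 \<open>u = _\<close> by simp
      qed
    qed
  next
    case 4
    then show ?thesis using site_spare[OF assms(1) _ s(1)] site_spare[OF assms(2) _ s'] assms(3) by simp
  qed
qed

lemma adj_meet:
  assumes "u \<in> verts C N" "v \<in> verts C N" "adj C N tab u v"
  shows "meet u v"
  using assms meet_dedge meet_sym unfolding adj_def verts_def by auto

lemma graph_representable: "unit_d_interval_graph 2 (verts C N) (adj C N tab)"
proof (rule represents_sites[of _ pos])
  show "adj C N tab u v \<longleftrightarrow> (\<exists>i k. fst (pos u i) = fst (pos v k) \<and> \<bar>snd (pos u i) - snd (pos v k)\<bar> \<le> 10)"
    if "u \<in> verts C N" "v \<in> verts C N" "u \<noteq> v" for u v
    using adj_meet[OF that(1,2)] meet_adj[OF that] unfolding meet_def by blast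
qed (use pos_range pos_two in blast)+

end

theorem graph_complete:
  assumes "2 < C" "2 < N" "\<And>c. c < C \<Longrightarrow> tab c 0 \<noteq> 0 \<and> tab c (N - 1) \<noteq> 0" "\<And>c j. tab c j \<le> 2"
    "table_sat C N tab a"
  shows "unit_d_interval_graph 2 (verts C N) (adj C N tab)"
proof -
  obtain w where "\<And>c. c < C \<Longrightarrow> w c < N \<and> (tab c (w c) = 1 \<and> a (w c) \<or> tab c (w c) = 2 \<and> \<not> a (w c))"
    using assms(5) unfolding table_sat_def by metis
  then interpret satisfied_table C N tab a w by unfold_locales (use assms in auto)
  show ?thesis by (rule graph_representable)
qed

section \<open>Simplicity and maximum degree\<close>

lemma adj_simple:
  assumes "2 < C" "2 < N"
  shows "simple_graph (verts C N) (adj C N tab)"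
  unfolding simple_graph_def
proof (intro conjI ballI impI)
  fix v assume "v \<in> verts C N"
  obtain c j t where v: "v = (c, j, t)" by (cases v)
  show "\<not> adj C N tab v v"
    using assms nx_neq[of C c] nx_neq[of N j] unfolding v adj_def
    by (simp add: cell_edge_def k44_def) linarith
next
  show "finite (verts C N)" by (simp add: verts_def)
qed (use adj_sym in blast)

text \<open>The list may contain non-neighbours; only its length counts. Since an entry of
  \<open>tab\<close> has one sign, \<open>s\<close> has a single contact, which keeps its list at
  seven members.\<close>

definition neighbours :: "nat \<Rightarrow> nat \<Rightarrow> (nat \<Rightarrow> nat \<Rightarrow> nat) \<Rightarrow> vertex \<Rightarrow> vertex list" where
  "neighbours C N tab v = (case v of (c, j, t) \<Rightarrow>
     if t = 0 then [(c, j, 2), (c, j, 4), (c, j, 3), (c, j, 9), (c, j, 13), (nx C c, j, 4)]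
     else if t = 1 then [(c, j, 5), (c, j, 3), (c, j, 17), (c, j, 21), (c, nx N j, 5)]
     else if t = 2 then [(c, j, 0)]
     else if t = 3 then [(c, j, 0), (c, j, 1), (c, j, 4), (nx C c, j, 4), (c, j, 5), (c, nx N j, 5),
       (if tab c j = 1 then nx C c else c, j, 6)]
     else if t = 4 then [(c, j, 0), (pr C c, j, 0), (c, j, 3), (pr C c, j, 3), (nx C c, j, 4), (pr C c, j, 4), (c, j, 6)]
     else if t = 5 then [(c, j, 1), (c, pr N j, 1), (c, j, 3), (c, pr N j, 3), (c, nx N j, 5), (c, pr N j, 5), (c, j, 7)]
     else if t = 6 then [(c, j, 4), (c, j, 3), (pr C c, j, 3)]
     else if t = 7 then [(c, j, 5)]
     else if t < 12 then [(c, j, 12), (c, j, 13), (c, j, 14), (c, j, 15), (c, j, 0)]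
     else if t < 16 then [(c, j, 8), (c, j, 9), (c, j, 10), (c, j, 11), (c, j, 0)]
     else if t < 20 then [(c, j, 20), (c, j, 21), (c, j, 22), (c, j, 23), (c, j, 1)]
     else [(c, j, 16), (c, j, 17), (c, j, 18), (c, j, 19), (c, j, 1)])"

lemma k44_cases:
  assumes "8 \<le> t" "8 \<le> t'" "k44 (t - 8) (t' - 8)"
  shows "t \<in> {8, 9, 10, 11} \<and> t' \<in> {12, 13, 14, 15}"
  using assms by (auto simp: k44_def)

lemma k44_cases':
  assumes "16 \<le> t" "16 \<le> t'" "k44 (t - 16) (t' - 16)"
  shows "t \<in> {16, 17, 18, 19} \<and> t' \<in> {20, 21, 22, 23}"
  using assms by (auto simp: k44_def)

lemma cell_edge_neighbours:
  assumes "cell_edge tab c j t t'"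
  shows "(c, j, t') \<in> set (neighbours C N tab (c, j, t)) \<and> (c, j, t) \<in> set (neighbours C N tab (c, j, t'))"
  using assms unfolding cell_edge_def
proof (elim disjE conjE)
  assume "(t, t') \<in> {(0, 2), (0, 4), (0, 3), (1, 5), (1, 3), (3, 4), (4, 6), (5, 7), (0, 9), (0, 13), (1, 17), (1, 21)}"
  then show ?thesis by (elim insertE emptyE; simp add: neighbours_def)
next
  assume "8 \<le> t" "8 \<le> t'" "k44 (t - 8) (t' - 8)"
  from k44_cases[OF this] have "t \<in> {8, 9, 10, 11}" "t' \<in> {12, 13, 14, 15}" by blast+
  then show ?thesis by (elim insertE emptyE; simp add: neighbours_def)
next
  assume "16 \<le> t" "16 \<le> t'" "k44 (t - 16) (t' - 16)"
  from k44_cases'[OF this] have "t \<in> {16, 17, 18, 19}" "t' \<in> {20, 21, 22, 23}" by blast+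
  then show ?thesis by (elim insertE emptyE; simp add: neighbours_def)
qed (simp_all add: neighbours_def)

lemma dedge_neighbours:
  assumes "dedge C N tab (c, j, t) (c', j', t')" "c < C" "j < N"
  shows "(c', j', t') \<in> set (neighbours C N tab (c, j, t)) \<and> (c, j, t) \<in> set (neighbours C N tab (c', j', t'))"
proof (cases "c' = c \<and> j' = j \<and> cell_edge tab c j t t'")
  case True
  then show ?thesis using cell_edge_neighbours by blast
next
  case False
  then have "c' = nx C c \<and> j' = j \<and> ((t, t') \<in> {(0, 4), (3, 4), (4, 4)} \<or> t = 3 \<and> t' = 6 \<and> tab c j = 1) \<or>
     c' = c \<and> j' = nx N j \<and> (t, t') \<in> {(1, 5), (3, 5), (5, 5)}" using assms(1) by auto
  then show ?thesis using pr_nx[OF assms(2)] pr_nx[OF assms(3)]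
    by (elim disjE conjE insertE emptyE; simp add: neighbours_def)
qed

lemma adj_neighbours:
  assumes "u \<in> verts C N" "v \<in> verts C N" "adj C N tab v u"
  shows "u \<in> set (neighbours C N tab v)"
  using assms dedge_neighbours unfolding adj_def verts_def by auto

lemma adj_degree: "max_degree_le 7 (verts C N) (adj C N tab)"
  unfolding max_degree_le_def degree_in_def
proof
  fix v assume v: "v \<in> verts C N"
  have "card {u \<in> verts C N. adj C N tab v u} \<le> card (set (neighbours C N tab v))"
    using adj_neighbours[OF _ v] by (intro card_mono) auto
  also have "\<dots> \<le> length (neighbours C N tab v)" by (rule card_length)
  also have "\<dots> \<le> 7" by (auto simp: neighbours_def split: prod.splits)
  finally show "card {u \<in> verts C N. adj C N tab v u} \<le> 7" .
qed

section \<open>Register programs on Turing machines\<close>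

datatype instr = IInc nat | IDec nat | IOut bool | IJz nat nat | IJs nat nat | IJmp nat

type_synonym rstate = "(nat \<Rightarrow> nat) \<times> bool list"

definition sym_at :: "nat list \<Rightarrow> nat \<Rightarrow> nat" where
  "sym_at w i = (if i < length w then w ! i else 0)"

fun instr_step :: "nat list \<Rightarrow> instr \<Rightarrow> nat \<times> rstate \<Rightarrow> nat \<times> rstate" where
  "instr_step w (IInc r) (pc, \<sigma>, o') = (Suc pc, \<sigma>(r := Suc (\<sigma> r)), o')"
| "instr_step w (IDec r) (pc, \<sigma>, o') = (Suc pc, \<sigma>(r := \<sigma> r - 1), o')"
| "instr_step w (IOut b) (pc, \<sigma>, o') = (Suc pc, \<sigma>, o' @ [b])"
| "instr_step w (IJz r t) (pc, \<sigma>, o') = (if \<sigma> r = 0 then t else Suc pc, \<sigma>, o')"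
| "instr_step w (IJs a t) (pc, \<sigma>, o') = (if sym_at w (\<sigma> 0) = a then t else Suc pc, \<sigma>, o')"
| "instr_step w (IJmp t) (pc, \<sigma>, o') = (t, \<sigma>, o')"

definition code_step :: "instr list \<Rightarrow> nat list \<Rightarrow> nat \<times> rstate \<Rightarrow> nat \<times> rstate" where
  "code_step code w c = (if fst c < length code then instr_step w (code ! fst c) c else c)"

text \<open>With code length \<open>L\<close>, the targets \<open>L\<close> and \<open>Suc L\<close>
  are the accepting and the rejecting state of \<open>code_tm\<close>.\<close>

fun wf_instr :: "nat \<Rightarrow> nat \<Rightarrow> instr \<Rightarrow> bool" where
  "wf_instr R L (IInc r) = (r < R)"
| "wf_instr R L (IDec r) = (r < R)"
| "wf_instr R L (IOut b) = True"
| "wf_instr R L (IJz r t) = (r < R \<and> t \<le> Suc L)"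
| "wf_instr R L (IJs a t) = (t \<le> Suc L)"
| "wf_instr R L (IJmp t) = (t \<le> Suc L)"

definition bit_sym :: "bool \<Rightarrow> nat" where
  "bit_sym b = (if b then 2 else 1)"

text \<open>
  The registers are the head positions of the first \<open>R\<close> tapes. Cell 0 of each of these tapes is
  marked by adding 4 to its symbol, which makes zero tests possible.
\<close>

fun instr_acts :: "nat \<Rightarrow> instr \<Rightarrow> nat list \<Rightarrow> (nat \<times> dir) list" where
  "instr_acts R (IInc r) ss = (map (\<lambda>s. (s, Stay)) ss)[r := (ss ! r, MoveRight)]"
| "instr_acts R (IDec r) ss =
     (map (\<lambda>s. (s, Stay)) ss)[r := (ss ! r, if 4 \<le> ss ! r then Stay else MoveLeft)]"
| "instr_acts R (IOut b) ss = (map (\<lambda>s. (s, Stay)) ss)[R := (bit_sym b, MoveRight)]"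
| "instr_acts R (IJz r t) ss = map (\<lambda>s. (s, Stay)) ss"
| "instr_acts R (IJs a t) ss = map (\<lambda>s. (s, Stay)) ss"
| "instr_acts R (IJmp t) ss = map (\<lambda>s. (s, Stay)) ss"

fun instr_next :: "instr \<Rightarrow> nat list \<Rightarrow> nat \<Rightarrow> nat" where
  "instr_next (IJz r t) ss q = (if 4 \<le> ss ! r then t else Suc q)"
| "instr_next (IJs a t) ss q = (if ss ! 0 mod 4 = a then t else Suc q)"
| "instr_next (IJmp t) ss q = t"
| "instr_next _ ss q = Suc q"

definition code_delta :: "nat \<Rightarrow> instr list \<Rightarrow> nat \<Rightarrow> nat list \<Rightarrow> nat \<times> (nat \<times> dir) list" where
  "code_delta R code q ss =
     (if q < length code then (instr_next (code ! q) ss q, instr_acts R (code ! q) ss)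
      else (0, map (\<lambda>i. (if i < R \<and> ss ! i < 4 then ss ! i + 4 else ss ! i, Stay)) [0..<Suc R]))"

text \<open>States below the code length are instruction addresses. The extra start state only sets
  the marks, which costs the one additional step in \<open>run_code_tm\<close>. The last tape stays
  unmarked, because its contents must be exactly the output word.\<close>

definition code_tm :: "nat \<Rightarrow> instr list \<Rightarrow> turing_machine" where
  "code_tm R code = \<lparr> tape_count = Suc R, symbol_count = 8, state_count = length code + 3,
     start_state = length code + 2, accept_state = length code, reject_state = Suc (length code),
     delta = code_delta R code \<rparr>"

lemma instr_acts_wf:
  assumes "wf_instr R L c" "length ss = Suc R" "set ss \<subseteq> {..<8}"
  shows "length (instr_acts R c ss) = Suc R \<and> (\<forall>(a, d) \<in> set (instr_acts R c ss). a < 8)"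
proof -
  have *: "(\<forall>(a, d) \<in> set ((map (\<lambda>s. (s, Stay)) ss)[r := (b, d')]). a < 8)" if "b < 8" for r b d'
    using set_update_subset_insert[of "map (\<lambda>s. (s, Stay)) ss" r "(b, d')"] assms(3) that by fastforce
  have nth: "ss ! r < 8" if "r < R" for r
    using assms that nth_mem[of r ss] by (metis lessThan_iff less_Suc_eq subsetD)
  show ?thesis
    using assms by (cases c) (auto simp: nth bit_sym_def simp del: set_update_subset_insert dest!: set_update_subset_insert[THEN subsetD])
qed

lemma wf_code_tm:
  assumes "\<forall>c \<in> set code. wf_instr R (length code) c"
  shows "wf_tm (code_tm R code)"
  unfolding wf_tm_def code_tm_def
proof (simp, intro allI impI)
  fix q and ss :: "nat list" assume q: "q < length code + 3" and ss: "length ss = Suc R \<and> set ss \<subseteq> {..<8}"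
  show "case code_delta R code q ss of (q', as) \<Rightarrow>
      q' < length code + 3 \<and> length as = Suc R \<and> (\<forall>(a, d) \<in> set as. a < 8)"
  proof (cases "q < length code")
    case True
    then have wf: "wf_instr R (length code) (code ! q)" using assms by auto
    then have "instr_next (code ! q) ss q < length code + 3"
      using True by (cases "code ! q") auto
    then show ?thesis using True instr_acts_wf[OF wf, of ss] ss by (simp add: code_delta_def)
  next
    case False
    have "ss ! i < 8" if "i < Suc R" for i using that ss by (metis lessThan_iff nth_mem subsetD)
    then show ?thesis using False by (auto simp: code_delta_def simp del: upt_Suc)
  qed
qed

definition mark_cell :: "(int \<Rightarrow> nat) \<Rightarrow> int \<Rightarrow> nat" where
  "mark_cell f = f(0 := f 0 + 4)"

definition reg_tape :: "nat list \<Rightarrow> nat \<Rightarrow> int \<Rightarrow> nat" where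
  "reg_tape w r = mark_cell (word_contents (if r = 0 then w else []))"

definition code_config :: "nat \<Rightarrow> nat list \<Rightarrow> nat \<times> rstate \<Rightarrow> config" where
  "code_config R w c = (case c of (pc, \<sigma>, o') \<Rightarrow>
     (pc, map (\<lambda>r. (reg_tape w r, int (\<sigma> r))) [0..<R] @
          [(word_contents (encode_word o'), int (length o'))]))"

lemma word_contents_lt: "set w \<subseteq> {..<4} \<Longrightarrow> word_contents w i < 4"
  using nth_mem[of "nat i" w] by (fastforce simp: word_contents_def)

lemma reg_tape_marked:
  assumes "set w \<subseteq> {..<4}"
  shows "4 \<le> reg_tape w r (int n) \<longleftrightarrow> n = 0" and "reg_tape w 0 (int n) mod 4 = sym_at w n"
proof -
  have *: "word_contents (if r = 0 then w else []) i < 4" for i r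
    using assms by (simp add: word_contents_lt)
  show "4 \<le> reg_tape w r (int n) \<longleftrightarrow> n = 0"
    using *[of r "int n"] by (simp add: reg_tape_def mark_cell_def)
  show "reg_tape w 0 (int n) mod 4 = sym_at w n"
    using *[of 0 "int n"] by (auto simp: reg_tape_def mark_cell_def word_contents_def sym_at_def)
qed

lemma word_contents_snoc:
  "(word_contents (encode_word u))(int (length u) := bit_sym b) = word_contents (encode_word (u @ [b]))"
  by (auto simp: word_contents_def encode_word_def bit_sym_def nth_append fun_eq_iff nat_less_iff)

lemma act_tape_read: "act_tape t (read_tape t, Stay) = t"
  by (cases t) simp

lemma map2_act_tape_stay: "map2 act_tape ts (map (\<lambda>s. (s, Stay)) (map read_tape ts)) = ts"
  by (rule nth_equalityI) (auto simp: act_tape_read simp del: act_tape.simps)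

lemma map2_act_tape_upd:
  assumes "r < length ts"
  shows "map2 act_tape ts ((map (\<lambda>s. (s, Stay)) (map read_tape ts))[r := a]) = ts[r := act_tape (ts ! r) a]"
  using assms by (intro nth_equalityI) (auto simp: act_tape_read nth_list_update simp del: act_tape.simps)

lemma code_config_simps:
  "fst (code_config R w (pc, \<sigma>, o')) = pc"
  "snd (code_config R w (pc, \<sigma>, o')) = map (\<lambda>r. (reg_tape w r, int (\<sigma> r))) [0..<R] @
          [(word_contents (encode_word o'), int (length o'))]"
  by (auto simp: code_config_def)

lemma reg_tapes_upd:
  "r < R \<Longrightarrow> (map (\<lambda>r. (f r, int (\<sigma> r))) [0..<R] @ x)[r := (f r, int n)] =
     map (\<lambda>r'. (f r', int ((\<sigma>(r := n)) r'))) [0..<R] @ x"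
  by (rule nth_equalityI) (auto simp: nth_append nth_list_update)

lemma step_code_config:
  assumes wf: "\<forall>c \<in> set code. wf_instr R (length code) c" and w: "set w \<subseteq> {..<4}" and R: "0 < R"
    and pc: "fst c \<le> Suc (length code)"
  shows "step (code_tm R code) (code_config R w c) = code_config R w (code_step code w c)"
proof -
  obtain pc \<sigma> o' where c: "c = (pc, \<sigma>, o')" by (cases c)
  show ?thesis
  proof (cases "pc < length code")
    case False
    then have "halted (code_tm R code) (code_config R w c)"
      using pc by (auto simp: halted_def code_tm_def code_config_simps c)
    then show ?thesis using False by (simp add: step_def code_step_def c)
  next
    case True
    define ts where "ts = snd (code_config R w (pc, \<sigma>, o'))"
    have ts: "ts = map (\<lambda>r. (reg_tape w r, int (\<sigma> r))) [0..<R] @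
          [(word_contents (encode_word o'), int (length o'))]"
      by (simp add: ts_def code_config_simps)
    have len: "length ts = Suc R" by (simp add: ts)
    have nth: "ts ! r = (reg_tape w r, int (\<sigma> r))" if "r < R" for r
      using that by (simp add: ts nth_append)
    have nthR: "ts ! R = (word_contents (encode_word o'), int (length o'))"
      by (simp add: ts nth_append)
    have wfi: "wf_instr R (length code) (code ! pc)" using wf True by auto
    have st: "step (code_tm R code) (code_config R w c) =
      (instr_next (code ! pc) (map read_tape ts) pc,
       map2 act_tape ts (instr_acts R (code ! pc) (map read_tape ts)))"
      using True by (simp add: step_def halted_def code_tm_def code_config_simps c code_delta_def ts_def)
    have rd: "map read_tape ts ! r = reg_tape w r (int (\<sigma> r))" if "r < R" for r
      using that len nth by simp
    have conf: "code_config R w (q, \<tau>, u) = (q, map (\<lambda>r. (reg_tape w r, int (\<tau> r))) [0..<R] @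
          [(word_contents (encode_word u), int (length u))])" for q \<tau> u
      by (simp add: code_config_def)
    have tseq: "map (\<lambda>r. (reg_tape w r, int (\<sigma> r))) [0..<R] @
          [(word_contents (encode_word o'), int (length o'))] = ts" by (simp add: ts)
    have upd: "map (\<lambda>r'. (reg_tape w r', int ((\<sigma>(r := n)) r'))) [0..<R] @
          [(word_contents (encode_word o'), int (length o'))] = ts[r := (reg_tape w r, int n)]"
      if "r < R" for r n
      unfolding ts by (rule reg_tapes_upd[OF that, symmetric])
    have code_step: "code_step code w c = instr_step w (code ! pc) (pc, \<sigma>, o')"
      using True by (simp add: code_step_def c)
    show ?thesis
    proof (cases "code ! pc")
      case (IInc r)
      then have r: "r < R" using wfi by simp
      show ?thesis unfolding st code_step IInc instr_step.simps conf upd[OF r]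
        using r len by (simp add: map2_act_tape_upd nth add.commute del: map_map)
    next
      case (IDec r)
      then have r: "r < R" using wfi by simp
      have *: "act_tape (ts ! r) (map read_tape ts ! r,
           if 4 \<le> map read_tape ts ! r then Stay else MoveLeft) = (reg_tape w r, int (\<sigma> r - 1))"
        using r by (auto simp: rd nth reg_tape_marked[OF w] of_nat_diff)
      show ?thesis unfolding st code_step IDec instr_step.simps conf upd[OF r] instr_acts.simps
        using r len by (subst map2_act_tape_upd) (simp_all add: * del: map_map nth_map)
    next
      case (IOut b)
      have *: "ts[R := act_tape (ts ! R) (bit_sym b, MoveRight)] = map (\<lambda>r. (reg_tape w r, int (\<sigma> r))) [0..<R] @
          [(word_contents (encode_word (o' @ [b])), int (length (o' @ [b])))]"
        using word_contents_snoc[of o' b] unfolding nthR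
        by (intro nth_equalityI) (auto simp: ts nth_append nth_list_update)
      show ?thesis unfolding st code_step IOut instr_step.simps conf instr_acts.simps
        using len by (subst map2_act_tape_upd) (simp_all add: * del: map_map nth_map)
    next
      case (IJz r t)
      then have r: "r < R" using wfi by simp
      show ?thesis unfolding st code_step IJz instr_step.simps conf instr_acts.simps map2_act_tape_stay tseq
        using r by (simp add: rd reg_tape_marked[OF w] del: nth_map)
    next
      case (IJs a t)
      show ?thesis unfolding st code_step IJs instr_step.simps conf instr_acts.simps map2_act_tape_stay tseq
        using R by (simp add: rd reg_tape_marked[OF w] del: nth_map)
    next
      case (IJmp t)
      show ?thesis unfolding st code_step IJmp instr_step.simps conf instr_acts.simps map2_act_tape_stay tseq
        by simp
    qed
  qed
qed

lemma code_step_pc: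
  assumes "\<forall>c \<in> set code. wf_instr R (length code) c" "fst c \<le> Suc (length code)"
  shows "fst (code_step code w c) \<le> Suc (length code)"
proof (cases "fst c < length code")
  case True
  then have "wf_instr R (length code) (code ! fst c)" using assms by auto
  then show ?thesis using True by (cases c; cases "code ! fst c") (auto simp: code_step_def)
qed (use assms in \<open>simp add: code_step_def\<close>)

lemma step_init_config:
  assumes w: "set w \<subseteq> {..<4}" and R: "0 < R"
  shows "step (code_tm R code) (init_config (code_tm R code) w) = code_config R w (0, \<lambda>_. 0, [])"
proof -
  have lt: "word_contents v 0 < 4" if "set v \<subseteq> {..<4}" for v using that by (simp add: word_contents_lt)
  let ?ts = "(word_contents w, 0) # replicate R (word_contents [], 0)"
  let ?rs = "word_contents w 0 # replicate R (word_contents [] 0)"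
  have "map2 act_tape ?ts (map (\<lambda>i. (if i < R \<and> ?rs ! i < 4 then ?rs ! i + 4
      else ?rs ! i, Stay)) [0..<Suc R])
    = map (\<lambda>r. (reg_tape w r, int 0)) [0..<R] @ [(word_contents (encode_word []), int (length []))]"
    using R lt[OF w] lt[of "[]"]
    by (intro nth_equalityI)
       (auto simp: nth_append nth_Cons' reg_tape_def mark_cell_def encode_word_def less_Suc_eq
             simp del: upt_Suc)
  then show ?thesis
    by (simp add: step_def halted_def code_tm_def init_config_def code_delta_def code_config_def
             del: upt_Suc zip_replicate2 )
qed

lemma run_code_tm:
  assumes wf: "\<forall>c \<in> set code. wf_instr R (length code) c" and w: "set w \<subseteq> {..<4}" and R: "0 < R"
  shows "run (code_tm R code) w (Suc n) = code_config R w ((code_step code w ^^ n) (0, \<lambda>_. 0, []))"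
    "fst ((code_step code w ^^ n) (0, \<lambda>_. 0, [])) \<le> Suc (length code)"
proof -
  have "run (code_tm R code) w (Suc n) = code_config R w ((code_step code w ^^ n) (0, \<lambda>_. 0, [])) \<and>
    fst ((code_step code w ^^ n) (0, \<lambda>_. 0, [])) \<le> Suc (length code)"
  proof (induction n)
    case 0
    show ?case by (simp add: run_def step_init_config[OF w R])
  next
    case (Suc n)
    have "run (code_tm R code) w (Suc (Suc n)) = step (code_tm R code) (run (code_tm R code) w (Suc n))"
      by (simp add: run_def)
    then show ?case
      using Suc step_code_config[OF wf w R, of "(code_step code w ^^ n) (0, \<lambda>_. 0, [])"] code_step_pc[OF wf]
      by simp
  qed
  then show "run (code_tm R code) w (Suc n) = code_config R w ((code_step code w ^^ n) (0, \<lambda>_. 0, []))"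
    "fst ((code_step code w ^^ n) (0, \<lambda>_. 0, [])) \<le> Suc (length code)" by auto
qed

subsection \<open>Structured programs\<close>

datatype com = Skip | Inc nat | Dec nat | Out bool | Seq com com (infixr ";;" 60)
  | IfZ nat com com | IfSym nat com com | Rep nat com | Scan nat

definition decr :: "nat \<Rightarrow> rstate \<Rightarrow> rstate" where
  "decr r s = ((fst s)(r := fst s r - 1), snd s)"

text \<open>\<open>Rep r c\<close> decrements register \<open>r\<close> and executes \<open>c\<close> until the register is 0.\<close>

primrec exec :: "nat list \<Rightarrow> com \<Rightarrow> rstate \<Rightarrow> rstate" where
  "exec w Skip s = s"
| "exec w (Inc r) s = ((fst s)(r := Suc (fst s r)), snd s)"
| "exec w (Dec r) s = decr r s"
| "exec w (Out b) s = (fst s, snd s @ [b])"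
| "exec w (c1 ;; c2) s = exec w c2 (exec w c1 s)"
| "exec w (IfZ r c1 c2) s = (if fst s r = 0 then exec w c1 s else exec w c2 s)"
| "exec w (IfSym a c1 c2) s = (if sym_at w (fst s 0) = a then exec w c1 s else exec w c2 s)"
| "exec w (Rep r c) s = ((\<lambda>s. exec w c (decr r s)) ^^ fst s r) s"
| "exec w (Scan r) s = ((fst s)(0 := fst s 0 + (length w - fst s 0),
     r := fst s r + (length w - fst s 0)), snd s)"

text \<open>These are exact step counts of the compiled code: an untaken test is followed by a jump
  over the other branch, and a round of \<open>Rep\<close> adds test, decrement and jump
  back.\<close>

primrec cost :: "nat list \<Rightarrow> com \<Rightarrow> rstate \<Rightarrow> nat" where
  "cost w Skip s = 0"
| "cost w (Inc r) s = 1"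
| "cost w (Dec r) s = 1"
| "cost w (Out b) s = 1"
| "cost w (c1 ;; c2) s = cost w c1 s + cost w c2 (exec w c1 s)"
| "cost w (IfZ r c1 c2) s = (if fst s r = 0 then 1 + cost w c1 s else 2 + cost w c2 s)"
| "cost w (IfSym a c1 c2) s = (if sym_at w (fst s 0) = a then 1 + cost w c1 s else 2 + cost w c2 s)"
| "cost w (Rep r c) s =
     1 + (\<Sum>i<fst s r. 3 + cost w c (decr r (((\<lambda>s. exec w c (decr r s)) ^^ i) s)))"
| "cost w (Scan r) s = 1 + 4 * (length w - fst s 0)"

primrec csize :: "com \<Rightarrow> nat" where
  "csize Skip = 0"
| "csize (Inc r) = 1"
| "csize (Dec r) = 1"
| "csize (Out b) = 1"
| "csize (c1 ;; c2) = csize c1 + csize c2"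
| "csize (IfZ r c1 c2) = csize c1 + csize c2 + 2"
| "csize (IfSym a c1 c2) = csize c1 + csize c2 + 2"
| "csize (Rep r c) = csize c + 3"
| "csize (Scan r) = 4"

primrec comp :: "com \<Rightarrow> nat \<Rightarrow> instr list" where
  "comp Skip b = []"
| "comp (Inc r) b = [IInc r]"
| "comp (Dec r) b = [IDec r]"
| "comp (Out x) b = [IOut x]"
| "comp (c1 ;; c2) b = comp c1 b @ comp c2 (b + csize c1)"
| "comp (IfZ r c1 c2) b = IJz r (b + csize c2 + 2) # comp c2 (b + 1) @
     IJmp (b + csize c2 + 2 + csize c1) # comp c1 (b + csize c2 + 2)"
| "comp (IfSym a c1 c2) b = IJs a (b + csize c2 + 2) # comp c2 (b + 1) @
     IJmp (b + csize c2 + 2 + csize c1) # comp c1 (b + csize c2 + 2)"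
| "comp (Rep r c) b = IJz r (b + csize c + 3) # IDec r # comp c (b + 2) @ [IJmp b]"
| "comp (Scan r) b = [IJs 0 (b + 4), IInc 0, IInc r, IJmp b]"

lemma length_comp[simp]: "length (comp c b) = csize c"
  by (induction c arbitrary: b) auto

primrec mods :: "com \<Rightarrow> nat set" where
  "mods Skip = {}"
| "mods (Inc r) = {r}"
| "mods (Dec r) = {r}"
| "mods (Out b) = {}"
| "mods (c1 ;; c2) = mods c1 \<union> mods c2"
| "mods (IfZ r c1 c2) = mods c1 \<union> mods c2"
| "mods (IfSym a c1 c2) = mods c1 \<union> mods c2"
| "mods (Rep r c) = insert r (mods c)"
| "mods (Scan r) = {0, r}"

text \<open>Since the body of \<open>Rep\<close> leaves the counter alone, the number of rounds is
  the value at entry, as \<open>exec\<close> presupposes.\<close>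

primrec wf_com :: "nat \<Rightarrow> com \<Rightarrow> bool" where
  "wf_com R Skip = True"
| "wf_com R (Inc r) = (r < R)"
| "wf_com R (Dec r) = (r < R)"
| "wf_com R (Out b) = True"
| "wf_com R (c1 ;; c2) = (wf_com R c1 \<and> wf_com R c2)"
| "wf_com R (IfZ r c1 c2) = (r < R \<and> wf_com R c1 \<and> wf_com R c2)"
| "wf_com R (IfSym a c1 c2) = (wf_com R c1 \<and> wf_com R c2)"
| "wf_com R (Rep r c) = (r < R \<and> wf_com R c \<and> r \<notin> mods c)"
| "wf_com R (Scan r) = (r < R \<and> 0 < R \<and> r \<noteq> 0)"

lemma wf_com_mono: "wf_com R c \<Longrightarrow> R \<le> R' \<Longrightarrow> wf_com R' c"
  by (induction c) auto

lemma wf_comp: "x \<in> set (comp c b) \<Longrightarrow> wf_com R c \<Longrightarrow> b + csize c \<le> L \<Longrightarrow> wf_instr R L x"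
proof (induction c arbitrary: b)
  case (Seq c1 c2)
  then show ?case using Seq.IH(1)[of b] Seq.IH(2)[of "b + csize c1"] by auto
next
  case (IfZ r c1 c2)
  then show ?case using IfZ.IH(1)[of "b + csize c2 + 2"] IfZ.IH(2)[of "b + 1"] by auto
next
  case (IfSym a c1 c2)
  then show ?case using IfSym.IH(1)[of "b + csize c2 + 2"] IfSym.IH(2)[of "b + 1"] by auto
next
  case (Rep r c)
  then show ?case using Rep.IH[of "b + 2"] by auto
qed auto

lemma exec_mods: "r \<notin> mods c \<Longrightarrow> fst (exec w c s) r = fst s r"
proof (induction c arbitrary: s)
  case (Rep r' c)
  have "fst (((\<lambda>s. exec w c (decr r' s)) ^^ n) s) r = fst s r" for n
    by (induction n) (use Rep in \<open>auto simp: decr_def\<close>)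
  then show ?case by simp
qed (auto simp: decr_def)

definition code_at :: "instr list \<Rightarrow> nat \<Rightarrow> instr list \<Rightarrow> bool" where
  "code_at code b xs \<longleftrightarrow> (\<exists>u v. code = u @ xs @ v \<and> length u = b)"

lemma code_at_Cons: "code_at code b (x # xs) \<longleftrightarrow> b < length code \<and> code ! b = x \<and> code_at code (Suc b) xs"
proof
  assume "code_at code b (x # xs)"
  then obtain u v where "code = u @ (x # xs) @ v" "length u = b" by (auto simp: code_at_def)
  then have "code = (u @ [x]) @ xs @ v" "length (u @ [x]) = Suc b" by auto
  then show "b < length code \<and> code ! b = x \<and> code_at code (Suc b) xs"
    by (metis code_at_def length_append less_Suc_eq nth_append_length trans_less_add1 append_assoc append_Cons nth_append \<open>length u = b\<close> lessI)
next
  assume *: "b < length code \<and> code ! b = x \<and> code_at code (Suc b) xs"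
  then obtain u v where u: "code = u @ xs @ v" "length u = Suc b" by (auto simp: code_at_def)
  then have "u \<noteq> []" by auto
  then have "u = butlast u @ [u ! b]" using u(2) by (metis append_butlast_last_id diff_Suc_1 last_conv_nth)
  moreover have "u ! b = x" using * u by (simp add: nth_append)
  ultimately have "code = butlast u @ (x # xs) @ v" using u(1) by (metis append_Cons append_assoc append_Nil)
  then show "code_at code b (x # xs)" using u(2) by (metis code_at_def diff_Suc_1 length_butlast)
qed

lemma code_at_append: "code_at code b (xs @ ys) \<Longrightarrow> code_at code b xs \<and> code_at code (b + length xs) ys"
proof -
  assume "code_at code b (xs @ ys)"
  then obtain u v where u: "code = u @ (xs @ ys) @ v" "length u = b" by (auto simp: code_at_def)
  then have "code = u @ xs @ (ys @ v)" "code = (u @ xs) @ ys @ v" by auto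
  then show ?thesis using u(2) unfolding code_at_def by (metis length_append)
qed

text \<open>As the input contains no blank, \<open>Scan\<close> recognises its end by the symbol
  0.\<close>

lemma comp_correct:
  assumes "code_at code b (comp c b)" "wf_com R c" "0 \<notin> set w"
  shows "(code_step code w ^^ cost w c s) (b, s) = (b + csize c, exec w c s)"
  using assms(1,2)
proof (induction c arbitrary: b s)
  case (Seq c1 c2)
  have *: "code_at code b (comp c1 b)" "code_at code (b + csize c1) (comp c2 (b + csize c1))"
    using Seq.prems(1) code_at_append by fastforce+
  have "(code_step code w ^^ cost w (c1 ;; c2) s) (b, s) =
    (code_step code w ^^ cost w c2 (exec w c1 s)) ((code_step code w ^^ cost w c1 s) (b, s))"
    by (simp add: funpow_add add.commute[of "cost w c1 s"])
  then show ?case using Seq.IH(1)[OF *(1)] Seq.IH(2)[OF *(2)] Seq.prems(2) by (simp add: add.assoc)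
next
  case (IfZ r c1 c2)
  obtain \<sigma> u where s: "s = (\<sigma>, u)" by (cases s)
  have *: "b < length code" "code ! b = IJz r (b + csize c2 + 2)" "code_at code (Suc b) (comp c2 (Suc b))"
    "b + csize c2 + 1 < length code" "code ! (b + csize c2 + 1) = IJmp (b + csize c2 + 2 + csize c1)"
    "code_at code (b + csize c2 + 2) (comp c1 (b + csize c2 + 2))"
    using IfZ.prems(1) by (auto simp: code_at_Cons dest!: code_at_append)
  show ?case
  proof (cases "\<sigma> r = 0")
    case True
    have 1: "code_step code w (b, s) = (b + csize c2 + 2, s)"
      using * True by (simp add: code_step_def s)
    show ?thesis using True IfZ.IH(1)[OF *(6), of s] IfZ.prems(2) 1
      by (simp add: s funpow_swap1 algebra_simps)
  next
    case False
    have 1: "code_step code w (b, s) = (Suc b, s)"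
      using * False by (simp add: code_step_def s)
    have 2: "code_step code w (b + csize c2 + 1, s') = (b + csize (IfZ r c1 c2), s')" for s'
      using * by (cases s') (simp add: code_step_def)
    have "(code_step code w ^^ cost w (IfZ r c1 c2) s) (b, s) =
       code_step code w ((code_step code w ^^ cost w c2 s) (code_step code w (b, s)))"
      using False by (simp add: s funpow_swap1)
    then show ?thesis using False IfZ.IH(2)[OF *(3), of s] IfZ.prems(2) 1 2
      by (simp add: s)
  qed
next
  case (IfSym a c1 c2)
  obtain \<sigma> u where s: "s = (\<sigma>, u)" by (cases s)
  have *: "b < length code" "code ! b = IJs a (b + csize c2 + 2)" "code_at code (Suc b) (comp c2 (Suc b))"
    "b + csize c2 + 1 < length code" "code ! (b + csize c2 + 1) = IJmp (b + csize c2 + 2 + csize c1)"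
    "code_at code (b + csize c2 + 2) (comp c1 (b + csize c2 + 2))"
    using IfSym.prems(1) by (auto simp: code_at_Cons dest!: code_at_append)
  show ?case
  proof (cases "sym_at w (\<sigma> 0) = a")
    case True
    have 1: "code_step code w (b, s) = (b + csize c2 + 2, s)"
      using * True by (simp add: code_step_def s)
    show ?thesis using True IfSym.IH(1)[OF *(6), of s] IfSym.prems(2) 1
      by (simp add: s funpow_swap1 algebra_simps)
  next
    case False
    have 1: "code_step code w (b, s) = (Suc b, s)"
      using * False by (simp add: code_step_def s)
    have 2: "code_step code w (b + csize c2 + 1, s') = (b + csize (IfSym a c1 c2), s')" for s'
      using * by (cases s') (simp add: code_step_def)
    have "(code_step code w ^^ cost w (IfSym a c1 c2) s) (b, s) =
       code_step code w ((code_step code w ^^ cost w c2 s) (code_step code w (b, s)))"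
      using False by (simp add: s funpow_swap1)
    then show ?thesis using False IfSym.IH(2)[OF *(3), of s] IfSym.prems(2) 1 2
      by (simp add: s)
  qed
next
  case (Rep r c)
  have *: "b < length code" "code ! b = IJz r (b + csize c + 3)" "Suc b < length code"
    "code ! (Suc b) = IDec r" "code_at code (b + 2) (comp c (b + 2))"
    "b + csize c + 2 < length code" "code ! (b + csize c + 2) = IJmp b"
    using Rep.prems(1) by (auto simp: code_at_Cons dest!: code_at_append)
  have wf: "wf_com R c" "r \<notin> mods c" using Rep.prems(2) by auto
  let ?f = "\<lambda>s. exec w c (decr r s)"
  have iter: "(code_step code w ^^ (3 + cost w c (decr r s))) (b, s) = (b, ?f s)" if "fst s r \<noteq> 0" for s
  proof -
    have 1: "code_step code w (b, s) = (Suc b, s)" using that * by (cases s) (simp add: code_step_def)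
    have 2: "code_step code w (Suc b, s) = (b + 2, decr r s)"
      using * by (cases s) (simp add: code_step_def decr_def)
    have 3: "code_step code w (b + csize c + 2, s') = (b, s')" for s'
      using * by (cases s') (simp add: code_step_def)
    have "3 + cost w c (decr r s) = Suc (cost w c (decr r s) + 2)" by simp
    then have "(code_step code w ^^ (3 + cost w c (decr r s))) (b, s) =
       code_step code w ((code_step code w ^^ cost w c (decr r s)) ((code_step code w ^^ 2) (b, s)))"
      by (simp only: funpow_add funpow.simps o_apply)
    also have "(code_step code w ^^ 2) (b, s) = (b + 2, decr r s)"
      using 1 2 by (simp add: numeral_2_eq_2)
    finally show ?thesis using Rep.IH[OF *(5) wf(1), of "decr r s"] 3
      by (simp add: algebra_simps)
  qed
  have reg: "fst ((?f ^^ n) s) r = fst s r - n" for n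
    by (induction n) (use exec_mods[OF wf(2)] in \<open>auto simp: decr_def\<close>)
  have "(code_step code w ^^ (\<Sum>i<n. 3 + cost w c (decr r ((?f ^^ i) s)))) (b, s) = (b, (?f ^^ n) s)"
    if "n \<le> fst s r" for n
    using that
  proof (induction n)
    case (Suc n)
    have "(\<Sum>i<Suc n. 3 + cost w c (decr r ((?f ^^ i) s))) =
      (3 + cost w c (decr r ((?f ^^ n) s))) + (\<Sum>i<n. 3 + cost w c (decr r ((?f ^^ i) s)))" by simp
    then show ?case using Suc iter[of "(?f ^^ n) s"] reg[of n]
      by (simp only: funpow_add o_apply) simp
  qed simp
  then have "(code_step code w ^^ (\<Sum>i<fst s r. 3 + cost w c (decr r ((?f ^^ i) s)))) (b, s)
    = (b, exec w (Rep r c) s)" by simp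
  moreover have "code_step code w (b, exec w (Rep r c) s) = (b + csize (Rep r c), exec w (Rep r c) s)"
    using * reg[of "fst s r"] by (cases "exec w (Rep r c) s") (simp add: code_step_def)
  ultimately show ?case by simp
next
  case (Scan r)
  have r: "r \<noteq> 0" using Scan.prems(2) by simp
  have *: "b < length code" "code ! b = IJs 0 (b + 4)" "Suc b < length code" "code ! (Suc b) = IInc 0"
    "Suc (Suc b) < length code" "code ! (Suc (Suc b)) = IInc r"
    "Suc (Suc (Suc b)) < length code" "code ! (Suc (Suc (Suc b))) = IJmp b"
    using Scan.prems(1) by (auto simp: code_at_Cons)
  have sym: "sym_at w i = 0 \<longleftrightarrow> length w \<le> i" for i
    using assms(3) by (metis neq0_conv not_le nth_mem sym_at_def)
  have "(code_step code w ^^ (1 + 4 * n)) (b, \<sigma>, u) =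
     (b + 4, \<sigma>(0 := \<sigma> 0 + n, r := \<sigma> r + n), u)" if "n = length w - \<sigma> 0" for n \<sigma> u
    using that
  proof (induction n arbitrary: \<sigma>)
    case 0
    then show ?case using * sym[of "\<sigma> 0"] by (simp add: code_step_def)
  next
    case (Suc n)
    let ?s = "\<sigma>(0 := Suc (\<sigma> 0), r := Suc (\<sigma> r))"
    have "sym_at w (\<sigma> 0) \<noteq> 0" using sym[of "\<sigma> 0"] Suc.prems by linarith
    then have "(code_step code w ^^ 4) (b, \<sigma>, u) = (b, ?s, u)"
      using * r by (simp add: code_step_def numeral_eq_Suc)
    moreover have "1 + 4 * Suc n = (1 + 4 * n) + 4" by simp
    moreover have "n = length w - ?s 0" using Suc.prems r by simp
    ultimately show ?case using Suc.IH[of ?s] r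
      by (simp only: funpow_add o_apply) (simp add: fun_eq_iff)
  qed
  then show ?case by (cases s) simp
qed (auto simp: code_step_def code_at_Cons decr_def split: prod.splits)

section \<open>Bounded arithmetic formulas\<close>

definition poly_bounded :: "(nat \<Rightarrow> nat) \<Rightarrow> bool" where
  "poly_bounded g \<longleftrightarrow> (\<exists>p :: nat poly. \<forall>n. g n \<le> poly p n)"

lemma poly_nat_mono: "x \<le> y \<Longrightarrow> poly p x \<le> poly (p :: nat poly) y"
  by (induction p) (auto intro: add_mono mult_mono)

lemma poly_bounded_const: "poly_bounded (\<lambda>n. c)"
  unfolding poly_bounded_def by (rule exI[of _ "[:c:]"]) simp

lemma poly_bounded_id: "poly_bounded (\<lambda>n. n)"
  unfolding poly_bounded_def by (rule exI[of _ "[:0, 1:]"]) simp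

lemma poly_bounded_add: "poly_bounded f \<Longrightarrow> poly_bounded g \<Longrightarrow> poly_bounded (\<lambda>n. f n + g n)"
  unfolding poly_bounded_def by (metis add_mono poly_add)

lemma poly_bounded_mult: "poly_bounded f \<Longrightarrow> poly_bounded g \<Longrightarrow> poly_bounded (\<lambda>n. f n * g n)"
  unfolding poly_bounded_def by (metis mult_le_mono poly_mult)

lemma poly_bounded_comp: "poly_bounded f \<Longrightarrow> poly_bounded g \<Longrightarrow> poly_bounded (\<lambda>n. f (g n))"
  unfolding poly_bounded_def by (metis poly_pcompose poly_nat_mono le_trans)

lemma poly_bounded_poly: "poly_bounded (poly p)"
  unfolding poly_bounded_def by blast

lemmas poly_bounded_intros = poly_bounded_const poly_bounded_id poly_bounded_add poly_bounded_mult
  poly_bounded_poly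

datatype trm = TC nat | TV nat | TAdd trm trm | TMul trm trm

primrec val :: "(nat \<Rightarrow> nat) \<Rightarrow> trm \<Rightarrow> nat" where
  "val e (TC c) = c"
| "val e (TV v) = e v"
| "val e (TAdd a b) = val e a + val e b"
| "val e (TMul a b) = val e a * val e b"

primrec tvars :: "trm \<Rightarrow> nat set" where
  "tvars (TC c) = {}"
| "tvars (TV v) = {v}"
| "tvars (TAdd a b) = tvars a \<union> tvars b"
| "tvars (TMul a b) = tvars a \<union> tvars b"

lemma val_cong: "(\<And>v. v \<in> tvars t \<Longrightarrow> e v = e' v) \<Longrightarrow> val e t = val e' t"
  by (induction t) auto

lemma val_mono: "(\<And>v. v \<in> tvars t \<Longrightarrow> e v \<le> e' v) \<Longrightarrow> val e t \<le> val e' t"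
  by (induction t) (auto intro: add_mono mult_mono)

datatype fm = FLe trm trm | FSym nat trm | FNot fm | FAnd fm fm | FEx nat trm fm

primrec sem :: "nat list \<Rightarrow> (nat \<Rightarrow> nat) \<Rightarrow> fm \<Rightarrow> bool" where
  "sem w e (FLe a b) = (val e a \<le> val e b)"
| "sem w e (FSym s t) = (sym_at w (val e t) = s)"
| "sem w e (FNot f) = (\<not> sem w e f)"
| "sem w e (FAnd f g) = (sem w e f \<and> sem w e g)"
| "sem w e (FEx v t f) = (\<exists>z < val e t. sem w (e(v := z)) f)"

text \<open>\<open>S\<close> collects the variables that may be nonzero. A quantifier binds a
  variable outside \<open>S\<close>, whose register is 0 at entry and can therefore count from
  0.\<close>

primrec wff :: "nat \<Rightarrow> nat set \<Rightarrow> fm \<Rightarrow> bool" where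
  "wff K S (FLe a b) = (tvars a \<union> tvars b \<subseteq> {..<K})"
| "wff K S (FSym s t) = (tvars t \<subseteq> {..<K})"
| "wff K S (FNot f) = wff K S f"
| "wff K S (FAnd f g) = (wff K S f \<and> wff K S g)"
| "wff K S (FEx v t f) = (v < K \<and> v \<notin> S \<and> tvars t \<subseteq> {..<K} \<and> wff K (insert v S) f)"

subsection \<open>Compiling formulas to register programs\<close>

primrec incn :: "nat \<Rightarrow> nat \<Rightarrow> com" where
  "incn 0 d = Skip"
| "incn (Suc n) d = Inc d ;; incn n d"

abbreviation clr :: "nat \<Rightarrow> com" where "clr r \<equiv> Rep r Skip"

text \<open>
  Variable \<open>v\<close> lives in register \<open>Suc v\<close>, register 0 is the head on the input, and registers from
  \<open>k\<close> on are free.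
\<close>

primrec addT :: "trm \<Rightarrow> nat \<Rightarrow> nat \<Rightarrow> com" where
  "addT (TC c) d k = incn c d"
| "addT (TV v) d k = Rep (Suc v) (Inc k ;; Inc d) ;; Rep k (Inc (Suc v))"
| "addT (TAdd a b) d k = addT a d k ;; addT b d k"
| "addT (TMul a b) d k = addT a k (Suc k) ;; Rep k (addT b d (Suc k))"

text \<open>At entry \<open>d\<close> and all registers from \<open>k\<close> on are 0; at exit
  \<open>d\<close> holds the truth value and everything else is restored. Comparison is by truncated
  subtraction, and a symbol test moves the input head, which is register 0, to the cell and
  back.\<close>

primrec setF :: "fm \<Rightarrow> nat \<Rightarrow> nat \<Rightarrow> com" where
  "setF (FLe a b) d k = addT b k (k + 2) ;; addT a (k + 1) (k + 2) ;; Rep k (Dec (k + 1)) ;;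
     IfZ (k + 1) (Inc d) Skip ;; clr (k + 1)"
| "setF (FSym s t) d k = addT t 0 k ;; IfSym s (Inc d) Skip ;; clr 0"
| "setF (FNot f) d k = setF f k (k + 1) ;; IfZ k (Inc d) (Dec k)"
| "setF (FAnd f g) d k = setF f k (k + 1) ;; IfZ k Skip (Dec k ;; setF g d (k + 1))"
| "setF (FEx v t f) d k = addT t k (k + 1) ;;
     Rep k (setF f (k + 1) (k + 2) ;; IfZ (k + 1) Skip (Dec (k + 1) ;; IfZ d (Inc d) Skip) ;; Inc (Suc v)) ;;
     clr (Suc v)"

text \<open>\<open>B\<close> bounds the values of the variables. A variable costs 9 per unit: 5 for
  moving it to \<open>k\<close> and \<open>d\<close>, 4 for moving it back.\<close>

primrec ct :: "trm \<Rightarrow> nat \<Rightarrow> nat" where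
  "ct (TC c) B = c"
| "ct (TV v) B = 2 + 9 * B"
| "ct (TAdd a b) B = ct a B + ct b B"
| "ct (TMul a b) B = ct a B + (1 + val (\<lambda>_. B) a * (3 + ct b B))"

text \<open>Below a quantifier the bound grows by the largest possible value of its limit. This
  composition keeps \<open>cf\<close> polynomial for each fixed formula.\<close>

primrec cf :: "fm \<Rightarrow> nat \<Rightarrow> nat" where
  "cf (FLe a b) B = ct b B + ct a B + (1 + val (\<lambda>_. B) b * 4) + 2 + (1 + 3 * val (\<lambda>_. B) a)"
| "cf (FSym s t) B = ct t B + 2 + (1 + 3 * val (\<lambda>_. B) t)"
| "cf (FNot f) B = cf f B + 3"
| "cf (FAnd f g) B = cf f B + cf g B + 3"
| "cf (FEx v t f) B = ct t B + (1 + val (\<lambda>_. B) t * (3 + (cf f (B + val (\<lambda>_. B) t) + 6))) +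
     (1 + 3 * val (\<lambda>_. B) t)"

lemma poly_bounded_val: "poly_bounded (\<lambda>B. val (\<lambda>_. B) t)"
  by (induction t) (auto intro!: poly_bounded_intros)

lemma poly_bounded_eqI: "(\<And>n. f n = g n) \<Longrightarrow> poly_bounded g \<Longrightarrow> poly_bounded f"
  by (simp add: poly_bounded_def)

lemma poly_bounded_ct: "poly_bounded (ct t)"
  by (induction t; rule poly_bounded_eqI, rule ct.simps, intro poly_bounded_intros poly_bounded_val; assumption)

lemma poly_bounded_cf: "poly_bounded (cf f)"
proof (induction f)
  case (FEx v t f)
  have "poly_bounded (\<lambda>B. cf f (B + val (\<lambda>_. B) t))"
    by (rule poly_bounded_comp[OF FEx]) (intro poly_bounded_intros poly_bounded_val)
  then show ?case
    by (rule_tac poly_bounded_eqI, rule_tac cf.simps) (intro poly_bounded_intros poly_bounded_val poly_bounded_ct)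
qed (rule poly_bounded_eqI, rule cf.simps, intro poly_bounded_intros poly_bounded_val poly_bounded_ct; assumption)+

text \<open>A loop is handled by naming the state \<open>S i\<close> reached after \<open>i\<close>
  rounds.\<close>

lemma exec_Rep:
  assumes "\<And>i. i < n \<Longrightarrow> exec w c (decr r (S i)) = S (Suc i)" "fst (S 0) r = n"
  shows "exec w (Rep r c) (S 0) = S n"
    and "(\<And>i. i < n \<Longrightarrow> cost w c (decr r (S i)) \<le> C) \<Longrightarrow> cost w (Rep r c) (S 0) \<le> 1 + n * (3 + C)"
proof -
  have it: "((\<lambda>s. exec w c (decr r s)) ^^ i) (S 0) = S i" if "i \<le> n" for i
    using that by (induction i) (use assms in auto)
  show "exec w (Rep r c) (S 0) = S n" using it[of n] assms(2) by simp
  assume C: "\<And>i. i < n \<Longrightarrow> cost w c (decr r (S i)) \<le> C"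
  have "(\<Sum>i<n. 3 + cost w c (decr r (((\<lambda>s. exec w c (decr r s)) ^^ i) (S 0)))) \<le> (\<Sum>i<n. 3 + C)"
    using it C by (intro sum_mono) simp
  then show "cost w (Rep r c) (S 0) \<le> 1 + n * (3 + C)" using assms(2) by simp
qed

lemma exec_clr:
  "exec w (clr r) (\<sigma>, u) = (\<sigma>(r := 0), u)" "cost w (clr r) (\<sigma>, u) \<le> 1 + 3 * \<sigma> r"
proof -
  let ?S = "\<lambda>i. (\<sigma>(r := \<sigma> r - i), u)"
  have *: "exec w Skip (decr r (?S i)) = ?S (Suc i)" for i by (simp add: decr_def)
  show "exec w (clr r) (\<sigma>, u) = (\<sigma>(r := 0), u)"
    using exec_Rep(1)[of "\<sigma> r" w Skip r ?S, OF *] by simp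
  show "cost w (clr r) (\<sigma>, u) \<le> 1 + 3 * \<sigma> r"
    using exec_Rep(2)[of "\<sigma> r" w Skip r ?S 0, OF *] by simp
qed

lemma exec_incn: "exec w (incn n d) (\<sigma>, u) = (\<sigma>(d := \<sigma> d + n), u) \<and> cost w (incn n d) (\<sigma>, u) = n"
  by (induction n arbitrary: \<sigma>) auto

lemma addT_correct:
  assumes "d < k" "\<forall>r \<ge> k. \<sigma> r = 0"
    "\<forall>v \<in> tvars t. \<sigma> (Suc v) = e v \<and> Suc v < k \<and> Suc v \<noteq> d \<and> e v \<le> B"
  shows "exec w (addT t d k) (\<sigma>, u) = (\<sigma>(d := \<sigma> d + val e t), u) \<and> cost w (addT t d k) (\<sigma>, u) \<le> ct t B"
  using assms
proof (induction t arbitrary: d k \<sigma>)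
  case (TC c)
  show ?case unfolding addT.simps val.simps ct.simps exec_incn[THEN conjunct1] exec_incn[THEN conjunct2]
    by (intro conjI refl order.refl)
next
  case (TV v)
  let ?n = "e v"
  have v: "\<sigma> (Suc v) = ?n" "Suc v < k" "Suc v \<noteq> d" "?n \<le> B" using TV by auto
  have k: "\<sigma> k = 0" using TV by auto
  let ?S = "\<lambda>i. (\<sigma>(Suc v := ?n - i, k := i, d := \<sigma> d + i), u)"
  have 1: "exec w (Inc k ;; Inc d) (decr (Suc v) (?S i)) = ?S (Suc i)" for i
    using v TV(1) by (auto simp: decr_def fun_eq_iff)
  have S0: "?S 0 = (\<sigma>, u)" using v(1) k by (auto simp: fun_eq_iff)
  have r1: "fst (?S 0) (Suc v) = ?n" "cost w (Inc k ;; Inc d) s \<le> 2" for s using v by auto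
  note e1 = exec_Rep(1)[of ?n w "Inc k ;; Inc d" "Suc v" ?S, OF 1 r1(1), unfolded S0]
  note c1 = exec_Rep(2)[of ?n w "Inc k ;; Inc d" "Suc v" ?S, OF 1 r1, unfolded S0]
  let ?S' = "\<lambda>i. (\<sigma>(Suc v := i, k := ?n - i, d := \<sigma> d + ?n), u)"
  have 2: "exec w (Inc (Suc v)) (decr k (?S' i)) = ?S' (Suc i)" for i
    using v TV(1) by (auto simp: decr_def fun_eq_iff)
  have S1: "?S' 0 = ?S ?n" by simp
  have r2: "fst (?S' 0) k = ?n" "cost w (Inc (Suc v)) s \<le> 1" for s using v TV(1) by auto
  note e2 = exec_Rep(1)[of ?n w "Inc (Suc v)" k ?S', OF 2 r2(1), unfolded S1]
  note c2 = exec_Rep(2)[of ?n w "Inc (Suc v)" k ?S', OF 2 r2, unfolded S1]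
  have "?S' ?n = (\<sigma>(d := \<sigma> d + ?n), u)" using v k by (auto simp: fun_eq_iff)
  then have "exec w (addT (TV v) d k) (\<sigma>, u) = (\<sigma>(d := \<sigma> d + val e (TV v)), u)"
    unfolding addT.simps exec.simps(5)[of _ "Rep _ _"] e1 e2 val.simps .
  moreover have "cost w (addT (TV v) d k) (\<sigma>, u) \<le> 2 + 9 * ?n"
    using c1 c2 unfolding addT.simps cost.simps(5)[of _ "Rep _ _"] e1 by simp
  ultimately show ?case using v(4) by (intro conjI) (assumption, simp del: addT.simps)
next
  case (TAdd a b)
  let ?\<sigma> = "\<sigma>(d := \<sigma> d + val e a)"
  have 1: "exec w (addT a d k) (\<sigma>, u) = (?\<sigma>, u) \<and> cost w (addT a d k) (\<sigma>, u) \<le> ct a B"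
    using TAdd.prems by (intro TAdd.IH(1)) auto
  have 2: "exec w (addT b d k) (?\<sigma>, u) = (?\<sigma>(d := ?\<sigma> d + val e b), u) \<and>
      cost w (addT b d k) (?\<sigma>, u) \<le> ct b B"
    using TAdd.prems by (intro TAdd.IH(2)) auto
  have 3: "?\<sigma>(d := ?\<sigma> d + val e b) = \<sigma>(d := \<sigma> d + val e (TAdd a b))"
    by (auto simp: fun_eq_iff)
  show ?case unfolding addT.simps exec.simps(5) cost.simps(5) ct.simps 1[THEN conjunct1] 2[THEN conjunct1] 3
    using 1 2 by (intro conjI refl add_mono) blast+
next
  case (TMul a b)
  let ?n = "val e a"
  let ?S = "\<lambda>i. (\<sigma>(k := ?n - i, d := \<sigma> d + i * val e b), u)"
  have k: "\<sigma> k = 0" using TMul.prems by auto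
  have 1: "exec w (addT a k (Suc k)) (\<sigma>, u) = (\<sigma>(k := \<sigma> k + val e a), u) \<and>
      cost w (addT a k (Suc k)) (\<sigma>, u) \<le> ct a B"
    using TMul.prems by (intro TMul.IH(1)) (auto intro: Suc_lessD)
  have S0: "?S 0 = (\<sigma>(k := ?n), u)" using TMul.prems(1) by (auto simp: fun_eq_iff)
  have 2: "exec w (addT b d (Suc k)) (decr k (?S i)) = ?S (Suc i) \<and>
      cost w (addT b d (Suc k)) (decr k (?S i)) \<le> ct b B" for i
  proof -
    let ?\<sigma> = "fst (decr k (?S i))"
    have "exec w (addT b d (Suc k)) (?\<sigma>, u) = (?\<sigma>(d := ?\<sigma> d + val e b), u) \<and>
        cost w (addT b d (Suc k)) (?\<sigma>, u) \<le> ct b B"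
      using TMul.prems by (intro TMul.IH(2)) (auto simp: decr_def intro: Suc_lessD)
    then show ?thesis using TMul.prems(1) by (auto simp: decr_def fun_eq_iff)
  qed
  have r2: "fst (?S 0) k = ?n" using TMul.prems(1) by auto
  note e = exec_Rep(1)[of ?n w "addT b d (Suc k)" k ?S, OF 2[THEN conjunct1] r2, unfolded S0]
  note c = exec_Rep(2)[of ?n w "addT b d (Suc k)" k ?S, OF 2[THEN conjunct1] r2 2[THEN conjunct2], unfolded S0]
  have "?n \<le> val (\<lambda>_. B) a" using TMul.prems(3) by (intro val_mono) auto
  then have "?n * (3 + ct b B) \<le> val (\<lambda>_. B) a * (3 + ct b B)" by simp
  moreover have "?S ?n = (\<sigma>(d := \<sigma> d + val e (TMul a b)), u)" using k TMul.prems(1) by (auto simp: fun_eq_iff)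
  then have "exec w (addT (TMul a b) d k) (\<sigma>, u) = (\<sigma>(d := \<sigma> d + val e (TMul a b)), u)"
    using 1 k unfolding addT.simps exec.simps(5) by (simp add: e del: exec.simps val.simps)
  moreover have "cost w (addT (TMul a b) d k) (\<sigma>, u) \<le> ct a B + (1 + ?n * (3 + ct b B))"
    using 1 k c unfolding addT.simps cost.simps(5) by (simp del: exec.simps cost.simps)
  ultimately show ?case unfolding ct.simps by linarith
qed

lemma setF_correct:
  assumes "K < d" "d < k" "\<forall>r \<ge> k. \<sigma> r = 0" "\<sigma> 0 = 0" "\<sigma> d = 0"
    "\<forall>v < K. \<sigma> (Suc v) = e v \<and> e v \<le> B" "\<forall>v < K. v \<notin> S \<longrightarrow> e v = 0" "wff K S f"
  shows "exec w (setF f d k) (\<sigma>, u) = (\<sigma>(d := of_bool (sem w e f)), u) \<and> cost w (setF f d k) (\<sigma>, u) \<le> cf f B"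
  using assms
proof (induction f arbitrary: d k \<sigma> e B S)
  case (FLe a b)
  let ?\<sigma>1 = "\<sigma>(k := val e b)" and ?\<sigma>2 = "\<sigma>(k := val e b, k + 1 := val e a)"
  have vars: "\<sigma> (Suc v) = e v \<and> e v \<le> B \<and> Suc v < d \<and> Suc v < k \<and> v < K"
    if "v \<in> tvars a \<union> tvars b" for v
    using that FLe.prems(1,2,6,8) by auto
  have 1: "exec w (addT b k (k + 2)) (\<sigma>, u) = (\<sigma>(k := \<sigma> k + val e b), u) \<and>
      cost w (addT b k (k + 2)) (\<sigma>, u) \<le> ct b B"
    using FLe.prems(1-3) vars by (intro addT_correct ballI) (force dest: vars)+
  have 2: "exec w (addT a (k + 1) (k + 2)) (?\<sigma>1, u) = (?\<sigma>1(k + 1 := ?\<sigma>1 (k + 1) + val e a), u) \<and>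
      cost w (addT a (k + 1) (k + 2)) (?\<sigma>1, u) \<le> ct a B"
    using FLe.prems(1-3) vars by (intro addT_correct ballI) (force dest: vars)+
  let ?S = "\<lambda>i. (\<sigma>(k := val e b - i, k + 1 := val e a - i), u)"
  have s: "exec w (Dec (k + 1)) (decr k (?S i)) = ?S (Suc i)" for i by (auto simp: decr_def fun_eq_iff)
  have S0: "?S 0 = (?\<sigma>2, u)" by simp
  have r2: "fst (?S 0) k = val e b" "cost w (Dec (k + 1)) s' \<le> 1" for s' by auto
  note 3 = exec_Rep(1)[of "val e b" w "Dec (k + 1)" k ?S, OF s r2(1), unfolded S0]
  note 4 = exec_Rep(2)[of "val e b" w "Dec (k + 1)" k ?S, OF s r2, unfolded S0]
  have b: "val e a \<le> val (\<lambda>_. B) a" "val e b \<le> val (\<lambda>_. B) b"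
    using vars by (intro val_mono; auto)+
  have k: "\<sigma> k = 0" "\<sigma> (k + 1) = 0" using FLe.prems by auto
  let ?\<sigma>3 = "(\<sigma>(k := 0, k + 1 := val e a - val e b))(d := of_bool (val e a \<le> val e b))"
  have 5: "exec w (IfZ (k + 1) (Inc d) Skip) (?S (val e b)) = (?\<sigma>3, u)"
    using FLe.prems(1,2,5) by (auto simp: fun_eq_iff)
  have 6: "cost w (IfZ (k + 1) (Inc d) Skip) (?S (val e b)) \<le> 2" by simp
  have 7: "?\<sigma>3(k + 1 := 0) = \<sigma>(d := of_bool (sem w e (FLe a b)))"
    using FLe.prems(1,2) k by (auto simp: fun_eq_iff)
  have 8: "?\<sigma>3 (k + 1) \<le> val e a" using FLe.prems(2) by simp
  have e: "exec w (setF (FLe a b) d k) (\<sigma>, u) = exec w (clr (k + 1)) (?\<sigma>3, u)"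
    using 1 2 3 5 k by (simp del: exec.simps(6,8))
  have c: "cost w (setF (FLe a b) d k) (\<sigma>, u) \<le> ct b B + ct a B + (1 + val e b * (3 + 1)) + 2 +
      cost w (clr (k + 1)) (?\<sigma>3, u)"
    using 1 2 3 4 5 6 k by (simp del: exec.simps(6,8) cost.simps(6,8))
  show ?case
    unfolding e exec_clr(1) 7 using c b 8 exec_clr(2)[of w "k + 1" ?\<sigma>3 u] by (intro conjI refl) simp
next
  case (FSym s t)
  have vars: "\<sigma> (Suc v) = e v \<and> e v \<le> B \<and> Suc v < d \<and> Suc v < k \<and> v < K" if "v \<in> tvars t" for v
    using that FSym.prems(1,2,6,8) by auto
  have 1: "exec w (addT t 0 k) (\<sigma>, u) = (\<sigma>(0 := \<sigma> 0 + val e t), u) \<and>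
      cost w (addT t 0 k) (\<sigma>, u) \<le> ct t B"
    using FSym.prems(1-3) vars by (intro addT_correct ballI) (force dest: vars)+
  have b: "val e t \<le> val (\<lambda>_. B) t" using vars by (intro val_mono) auto
  let ?\<sigma>3 = "\<sigma>(0 := val e t, d := of_bool (sym_at w (val e t) = s))"
  have 5: "exec w (IfSym s (Inc d) Skip) (\<sigma>(0 := val e t), u) = (?\<sigma>3, u)"
    "cost w (IfSym s (Inc d) Skip) (\<sigma>(0 := val e t), u) \<le> 2"
    using FSym.prems(1,5) by (auto simp: fun_eq_iff)
  have 7: "?\<sigma>3(0 := 0) = \<sigma>(d := of_bool (sem w e (FSym s t)))"
    using FSym.prems(1,4) by (auto simp: fun_eq_iff)
  have 8: "?\<sigma>3 0 = val e t" using FSym.prems(1) by simp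
  have e: "exec w (setF (FSym s t) d k) (\<sigma>, u) = exec w (clr 0) (?\<sigma>3, u)"
    using 1 5 FSym.prems(4) by (simp del: exec.simps(7,8))
  have c: "cost w (setF (FSym s t) d k) (\<sigma>, u) \<le> ct t B + 2 + cost w (clr 0) (?\<sigma>3, u)"
    using 1 5 FSym.prems(4) by (simp del: exec.simps(7,8) cost.simps(7,8))
  show ?case
    unfolding e exec_clr(1) 7 using c b 8 exec_clr(2)[of w 0 ?\<sigma>3 u] by (intro conjI refl) simp
next
  case (FNot f)
  have k: "\<sigma> k = 0" using FNot.prems by auto
  have "exec w (setF f k (k + 1)) (\<sigma>, u) = (\<sigma>(k := of_bool (sem w e f)), u) \<and>
      cost w (setF f k (k + 1)) (\<sigma>, u) \<le> cf f B"
    using FNot.prems by (intro FNot.IH[of _ _ _ _ _ S]) auto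
  then show ?case using FNot.prems(1,2,5) k by (auto simp: decr_def fun_eq_iff)
next
  case (FAnd f g)
  have k: "\<sigma> k = 0" using FAnd.prems by auto
  have 1: "exec w (setF f k (k + 1)) (\<sigma>, u) = (\<sigma>(k := of_bool (sem w e f)), u) \<and>
      cost w (setF f k (k + 1)) (\<sigma>, u) \<le> cf f B"
    using FAnd.prems by (intro FAnd.IH(1)[of _ _ _ _ _ S]) auto
  have 2: "exec w (setF g d (k + 1)) (\<sigma>, u) = (\<sigma>(d := of_bool (sem w e g)), u) \<and>
      cost w (setF g d (k + 1)) (\<sigma>, u) \<le> cf g B"
    using FAnd.prems by (intro FAnd.IH(2)[of _ _ _ _ _ S]) auto
  have 3: "decr k (\<sigma>(k := 1), u) = (\<sigma>, u)" using k by (auto simp: decr_def)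
  have 4: "\<sigma>(k := 0) = \<sigma>" "\<sigma>(d := 0) = \<sigma>" using k FAnd.prems(5) by auto
  show ?case
  proof (cases "sem w e f")
    case True
    then have f: "exec w (setF f k (k + 1)) (\<sigma>, u) = (\<sigma>(k := 1), u)" using 1 by simp
    have e: "exec w (setF (FAnd f g) d k) (\<sigma>, u) = exec w (setF g d (k + 1)) (\<sigma>, u)"
      using f 3 by simp
    have "cost w (setF (FAnd f g) d k) (\<sigma>, u) =
        cost w (setF f k (k + 1)) (\<sigma>, u) + (3 + cost w (setF g d (k + 1)) (\<sigma>, u))"
      using f 3 by simp
    then show ?thesis using 1 2 True unfolding e by (auto simp del: setF.simps)
  next
    case False
    then have f: "exec w (setF f k (k + 1)) (\<sigma>, u) = (\<sigma>, u)" using 1 4 by simp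
    have e: "exec w (setF (FAnd f g) d k) (\<sigma>, u) = (\<sigma>, u)"
      using f k by simp
    have "cost w (setF (FAnd f g) d k) (\<sigma>, u) = cost w (setF f k (k + 1)) (\<sigma>, u) + 1"
      using f k by simp
    then show ?thesis using 1 4 False unfolding e by (auto simp del: setF.simps)
  qed
next
  case (FEx v t f)
  let ?n = "val e t" and ?B = "val (\<lambda>_. B) t"
  have v: "v < K" "v \<notin> S" and wf: "wff K (insert v S) f"
    using FEx.prems(8) by auto
  have vars: "\<sigma> (Suc v) = e v \<and> e v \<le> B \<and> Suc v < d \<and> Suc v < k \<and> v < K" if "v \<in> tvars t" for v
    using that FEx.prems(1,2,6,8) by auto
  have k: "\<sigma> k = 0" "\<sigma> (k + 1) = 0" using FEx.prems by auto
  have ev: "\<sigma> (Suc v) = 0" using FEx.prems(6,7) v by auto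
  have b: "?n \<le> ?B" using vars by (intro val_mono) auto
  have 1: "exec w (addT t k (k + 1)) (\<sigma>, u) = (\<sigma>(k := \<sigma> k + ?n), u) \<and>
      cost w (addT t k (k + 1)) (\<sigma>, u) \<le> ct t B"
    using FEx.prems(1-3) vars by (intro addT_correct ballI) (force dest: vars)+
  let ?body = "setF f (k + 1) (k + 2) ;; IfZ (k + 1) Skip (Dec (k + 1) ;; IfZ d (Inc d) Skip) ;; Inc (Suc v)"
  \<comment> \<open>After \<open>i\<close> rounds the quantified variable equals \<open>i\<close>,
    the counter is down by \<open>i\<close>, and \<open>d\<close> holds the disjunction over the
    values tried so far.\<close>
  let ?st = "\<lambda>i j. \<sigma>(k := ?n - i, Suc v := j, d := of_bool (\<exists>z<j. sem w (e(v := z)) f))"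
  let ?S = "\<lambda>i. (?st i i, u)"
  have body: "exec w ?body (decr k (?S i)) = ?S (Suc i) \<and>
      cost w ?body (decr k (?S i)) \<le> cf f (B + ?B) + 6" if i: "i < ?n" for i
  proof -
    let ?\<tau> = "?st (Suc i) i"
    have dec: "decr k (?S i) = (?\<tau>, u)" using FEx.prems(1,2) v by (auto simp: decr_def fun_eq_iff)
    have \<tau>v: "?\<tau> (Suc v') = (e(v := i)) v'" if "v' < K" for v'
      using that FEx.prems(1,2,6) by auto
    have sf: "exec w (setF f (k + 1) (k + 2)) (?\<tau>, u) = (?\<tau>(k + 1 := of_bool (sem w (e(v := i)) f)), u) \<and>
        cost w (setF f (k + 1) (k + 2)) (?\<tau>, u) \<le> cf f (B + ?B)"
    proof (rule FEx.IH[of _ _ _ _ _ "insert v S"])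
      show "\<forall>v'<K. ?\<tau> (Suc v') = (e(v := i)) v' \<and> (e(v := i)) v' \<le> B + ?B"
        using \<tau>v FEx.prems(6) i b by (auto intro: le_trans)
    qed (use FEx.prems v wf in \<open>auto\<close>)
    have "cost w (IfZ (k + 1) Skip (Dec (k + 1) ;; IfZ d (Inc d) Skip)) s \<le> 5" for s by simp
    from this[of "exec w (setF f (k + 1) (k + 2)) (?\<tau>, u)"]
    have c: "cost w ?body (?\<tau>, u) \<le> cf f (B + ?B) + 6"
      unfolding cost.simps(5)[of w "setF _ _ _"] cost.simps(5)[of w "IfZ _ _ _" "Inc _"] cost.simps(2)
      using sf[THEN conjunct2] by linarith
    note e = sf[THEN conjunct1]
    have "exec w ?body (?\<tau>, u) = ?S (Suc i)"
      unfolding exec.simps(5) e using FEx.prems(1,2) v k by (auto simp: decr_def fun_eq_iff less_Suc_eq)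
    then show ?thesis unfolding dec using c by blast
  qed
  have S0: "?S 0 = (\<sigma>(k := ?n), u)" using FEx.prems(1,2,5) v ev by (auto simp: fun_eq_iff)
  have r2: "fst (?S 0) k = ?n" using FEx.prems(1,2) v by auto
  note 2 = exec_Rep(1)[of ?n w ?body k ?S, OF body[THEN conjunct1] r2, unfolded S0]
  have "cost w (Rep k ?body) (\<sigma>(k := ?n), u) \<le> 1 + ?n * (3 + (cf f (B + ?B) + 6))"
    by (rule exec_Rep(2)[of ?n w ?body k ?S, OF body[THEN conjunct1] r2 body[THEN conjunct2], unfolded S0])
  also have "\<dots> \<le> 1 + ?B * (3 + (cf f (B + ?B) + 6))" using b by simp
  finally have 3: "cost w (Rep k ?body) (\<sigma>(k := ?n), u) \<le> 1 + ?B * (3 + (cf f (B + ?B) + 6))" .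
  have 4: "(?st ?n ?n)(Suc v := 0) = \<sigma>(d := of_bool (sem w e (FEx v t f)))"
    using FEx.prems(1,2) v k ev by (auto simp: fun_eq_iff)
  have 5: "(?st ?n ?n) (Suc v) = ?n" using FEx.prems(1) v by auto
  have e: "exec w (setF (FEx v t f) d k) (\<sigma>, u) = exec w (clr (Suc v)) (?S ?n)"
    unfolding setF.simps exec.simps(5) using 1 2 k by (simp del: exec.simps)
  have c: "cost w (setF (FEx v t f) d k) (\<sigma>, u) = cost w (addT t k (k + 1)) (\<sigma>, u) +
      (cost w (Rep k ?body) (\<sigma>(k := ?n), u) + cost w (clr (Suc v)) (?S ?n))"
    unfolding setF.simps cost.simps(5)[of w "addT _ _ _"] cost.simps(5)[of w "Rep k _"] using 1 2 k
    by (simp del: exec.simps cost.simps)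
  have "cost w (clr (Suc v)) (?S ?n) \<le> 1 + 3 * ?n" using exec_clr(2)[of w "Suc v" "?st ?n ?n" u] unfolding 5 .
  moreover have "exec w (clr (Suc v)) (?S ?n) = (\<sigma>(d := of_bool (sem w e (FEx v t f))), u)"
    unfolding exec_clr(1) 4 ..
  ultimately show ?case unfolding e c cf.simps using 1 3 b by linarith
qed

subsection \<open>Formulas as machines\<close>

text \<open>This is well-formedness without a register bound; a sufficient number of registers is
  chosen afterwards.\<close>

primrec wf_rep :: "com \<Rightarrow> bool" where
  "wf_rep Skip = True"
| "wf_rep (Inc r) = True"
| "wf_rep (Dec r) = True"
| "wf_rep (Out b) = True"
| "wf_rep (c1 ;; c2) = (wf_rep c1 \<and> wf_rep c2)"
| "wf_rep (IfZ r c1 c2) = (wf_rep c1 \<and> wf_rep c2)"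
| "wf_rep (IfSym a c1 c2) = (wf_rep c1 \<and> wf_rep c2)"
| "wf_rep (Rep r c) = (wf_rep c \<and> r \<notin> mods c)"
| "wf_rep (Scan r) = (r \<noteq> 0)"

lemma wf_rep_wf_com: "wf_rep c \<Longrightarrow> \<exists>R. wf_com R c"
proof (induction c)
  case (Seq c1 c2)
  then obtain R1 R2 where "wf_com R1 c1" "wf_com R2 c2" by auto
  then have "wf_com (max R1 R2) (c1 ;; c2)" using wf_com_mono[of _ _ "max R1 R2"] by auto
  then show ?case by blast
next
  case (IfZ r c1 c2)
  then obtain R1 R2 where "wf_com R1 c1" "wf_com R2 c2" by auto
  then have "wf_com (max (Suc r) (max R1 R2)) (IfZ r c1 c2)"
    using wf_com_mono[of _ _ "max (Suc r) (max R1 R2)"] by (auto simp: max_def)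
  then show ?case by blast
next
  case (IfSym a c1 c2)
  then obtain R1 R2 where "wf_com R1 c1" "wf_com R2 c2" by auto
  then have "wf_com (max R1 R2) (IfSym a c1 c2)" using wf_com_mono[of _ _ "max R1 R2"] by auto
  then show ?case by blast
next
  case (Rep r c)
  then obtain R where "wf_com R c" by auto
  then have "wf_com (max (Suc r) R) (Rep r c)" using Rep.prems wf_com_mono[of R c "max (Suc r) R"] by auto
  then show ?case by blast
qed (auto intro: exI[of _ "Suc _"])

lemma mods_incn: "mods (incn n d) \<subseteq> {d}"
  by (induction n) auto

lemma wf_rep_incn: "wf_rep (incn n d)"
  by (induction n) auto

lemma mods_addT: "x \<in> mods (addT t d k) \<Longrightarrow> tvars t \<subseteq> {..<K} \<Longrightarrow> x = d \<or> 0 < x \<and> x \<le> K \<or> k \<le> x"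
proof (induction t arbitrary: d k)
  case (TC c)
  then show ?case using mods_incn[of c d] by auto
next
  case (TMul a b)
  have "x \<in> mods (addT a k (Suc k)) \<or> x = k \<or> x \<in> mods (addT b d (Suc k))" using TMul.prems by auto
  moreover have "tvars a \<subseteq> {..<K}" "tvars b \<subseteq> {..<K}" using TMul.prems by auto
  ultimately show ?case using TMul.IH(1)[of k "Suc k"] TMul.IH(2)[of d "Suc k"] by linarith
qed auto

lemma wf_rep_addT:
  assumes "d < k" "\<forall>v \<in> tvars t. Suc v < k \<and> Suc v \<noteq> d"
  shows "wf_rep (addT t d k)"
  using assms
proof (induction t arbitrary: d k)
  case (TMul a b)
  have "tvars b \<subseteq> {..<k - 1}" using TMul.prems(2) by (auto simp: less_diff_conv)
  then have "k \<notin> mods (addT b d (Suc k))" using mods_addT[of k b d "Suc k" "k - 1"] TMul.prems(1) by auto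
  moreover have "wf_rep (addT a k (Suc k))" using TMul.prems by (intro TMul.IH(1)) (auto intro: Suc_lessD)
  moreover have "wf_rep (addT b d (Suc k))" using TMul.prems by (intro TMul.IH(2)) (auto intro: Suc_lessD)
  ultimately show ?case by auto
qed (auto simp: wf_rep_incn)

text \<open>The counter of an enclosing loop lies above the variables and below the scratch
  registers of the body, so it is left alone.\<close>

lemma mods_setF: "x \<in> mods (setF f d k) \<Longrightarrow> wff K S f \<Longrightarrow> x = d \<or> x \<le> K \<or> k \<le> x"
proof (induction f arbitrary: d k S)
  case (FLe a b)
  have "x \<in> mods (addT b k (k + 2)) \<or> x \<in> mods (addT a (k + 1) (k + 2)) \<or> x \<in> {k, k + 1, d}"
    using FLe.prems(1) by auto
  then show ?case using mods_addT[of x b k "k + 2" K] mods_addT[of x a "k + 1" "k + 2" K] FLe.prems(2)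
    by auto
next
  case (FSym s t)
  have "x \<in> mods (addT t 0 k) \<or> x \<in> {0, d}" using FSym.prems(1) by auto
  then show ?case using mods_addT[of x t 0 k K] FSym.prems(2) by auto
next
  case (FNot f)
  have "x \<in> mods (setF f k (k + 1)) \<or> x \<in> {k, d}" using FNot.prems(1) by auto
  then show ?case using FNot.IH[of k "k + 1" S] FNot.prems(2) by auto
next
  case (FAnd f g)
  have "x \<in> mods (setF f k (k + 1)) \<or> x \<in> mods (setF g d (k + 1)) \<or> x = k" using FAnd.prems(1) by auto
  then show ?case using FAnd.IH(1)[of k "k + 1" S] FAnd.IH(2)[of d "k + 1" S] FAnd.prems(2) by auto
next
  case (FEx v t f)
  have "x \<in> mods (addT t k (k + 1)) \<or> x \<in> mods (setF f (k + 1) (k + 2)) \<or> x \<in> {k, k + 1, d, Suc v}"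
    using FEx.prems(1) by auto
  then show ?case
    using FEx.IH[of "k + 1" "k + 2" "insert v S"] mods_addT[of x t k "k + 1" K] FEx.prems(2) by auto
qed

lemma wf_rep_setF:
  assumes "wff K S f" "K < d" "d < k"
  shows "wf_rep (setF f d k)"
  using assms
proof (induction f arbitrary: d k S)
  case (FEx v t f)
  have "k \<notin> mods (setF f (k + 1) (k + 2))"
    using mods_setF[of k f "k + 1" "k + 2" K "insert v S"] FEx.prems by auto
  moreover have "wf_rep (setF f (k + 1) (k + 2))" using FEx.prems by (intro FEx.IH) auto
  moreover have "wf_rep (addT t k (k + 1))" using FEx.prems by (intro wf_rep_addT) fastforce+
  ultimately show ?case using FEx.prems by auto
next
  case (FLe a b)
  have "wf_rep (addT b k (k + 2))" "wf_rep (addT a (k + 1) (k + 2))"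
    using FLe.prems by (intro wf_rep_addT; fastforce)+
  then show ?case by simp
next
  case (FSym s t)
  have "wf_rep (addT t 0 k)" using FSym.prems by (intro wf_rep_addT) fastforce+
  then show ?case by simp
next
  case (FNot f)
  then show ?case using FNot.IH[of S k "k + 1"] by auto
next
  case (FAnd f g)
  then show ?case using FAnd.IH(1)[of S k "k + 1"] FAnd.IH(2)[of S d "k + 1"] by auto
qed

lemma code_step_stop: "length code \<le> fst c \<Longrightarrow> (code_step code w ^^ n) c = c"
  by (induction n) (auto simp: code_step_def)

lemma code_step_ge:
  assumes "(code_step code w ^^ m) c = c'" "length code \<le> fst c'" "m \<le> n"
  shows "(code_step code w ^^ n) c = c'"
proof -
  have "(code_step code w ^^ n) c = (code_step code w ^^ (n - m)) ((code_step code w ^^ m) c)"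
    using assms(3) by (metis funpow_add le_add_diff_inverse2 o_apply)
  then show ?thesis using assms code_step_stop by simp
qed

definition env0 :: "nat list \<Rightarrow> nat \<Rightarrow> nat" where
  "env0 w = (\<lambda>_. 0)(0 := length w)"

definition input_ok :: "nat list \<Rightarrow> bool" where
  "input_ok w \<longleftrightarrow> set w \<subseteq> {1..<4}"

lemma input_ok_encode: "input_ok (encode_word x)" "input_ok (encode_pair x y)"
  by (auto simp: input_ok_def encode_word_def encode_pair_def)

lemma scan_correct:
  "exec w (Scan 1 ;; clr 0) (\<lambda>_. 0, []) = ((\<lambda>_. 0)(1 := length w), [])"
  "cost w (Scan 1 ;; clr 0) (\<lambda>_. 0, []) \<le> 2 + 7 * length w"
  using exec_clr[of w 0 "(\<lambda>_. 0)(0 := length w, 1 := length w)" "[]"]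
  by (auto simp: fun_eq_iff simp del: exec.simps(8) cost.simps(8))

theorem decide_formula:
  assumes wff: "wff K {0} f" and K: "0 < K"
  shows "polytime_decidable_rel (\<lambda>x y. sem (encode_pair x y) (env0 (encode_pair x y)) f)"
proof -
  define c where "c = (Scan 1 ;; clr 0) ;; setF f (K + 1) (K + 2)"
  have "wf_rep c" using wf_rep_setF[OF wff] by (simp add: c_def)
  then obtain R0 where "wf_com R0 c" using wf_rep_wf_com by blast
  define R where "R = max R0 (K + 2)"
  have wfc: "wf_com R c" using wf_com_mono[OF \<open>wf_com R0 c\<close>] by (simp add: R_def)
  \<comment> \<open>The code has length \<open>csize c + 1\<close>, so this jump leads to the
    rejecting state and falling through to the accepting one.\<close>
  define code where "code = comp c 0 @ [IJz (K + 1) (csize c + 2)]"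
  have wfcode: "\<forall>x \<in> set code. wf_instr R (length code) x"
    using wf_comp[of _ c 0 R "length code"] wfc by (auto simp: code_def R_def)
  have at: "code_at code 0 (comp c 0)" unfolding code_at_def code_def by auto
  \<comment> \<open>Measuring the input and rewinding take at most \<open>2 + 7 * n\<close> steps;
    the final test and the initial marking add 2.\<close>
  have pb: "poly_bounded (\<lambda>n. 4 + 7 * n + cf f n)"
    by (intro poly_bounded_intros poly_bounded_cf)
  then obtain p :: "nat poly" where p: "\<And>n. 4 + 7 * n + cf f n \<le> poly p n" unfolding poly_bounded_def by blast
  have run: "halted (code_tm R code) (run (code_tm R code) w (poly p (length w))) \<and>
      (fst (run (code_tm R code) w (poly p (length w))) = accept_state (code_tm R code) \<longleftrightarrow> sem w (env0 w) f)"
    if "input_ok w" for w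
  proof -
    have w: "set w \<subseteq> {..<4}" "0 \<notin> set w" using that by (fastforce simp: input_ok_def)+
    let ?n = "length w"
    define \<sigma> :: "nat \<Rightarrow> nat" where "\<sigma> = (\<lambda>_. 0)(1 := ?n)"
    have sf: "exec w (setF f (K + 1) (K + 2)) (\<sigma>, []) = (\<sigma>(K + 1 := of_bool (sem w (env0 w) f)), []) \<and>
        cost w (setF f (K + 1) (K + 2)) (\<sigma>, []) \<le> cf f ?n"
      using K wff by (intro setF_correct[of K _ _ _ _ _ "{0}"]) (auto simp: \<sigma>_def env0_def)
    define s where "s = (\<sigma>(K + 1 := of_bool (sem w (env0 w) f)), [] :: bool list)"
    have ex: "exec w c (\<lambda>_. 0, []) = s"
      using scan_correct(1)[of w] sf by (simp add: c_def \<sigma>_def s_def del: exec.simps(8,9))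
    have co: "cost w c (\<lambda>_. 0, []) \<le> 2 + 7 * ?n + cf f ?n"
      using scan_correct[of w] sf unfolding c_def cost.simps(5)[of w "_ ;; _"] \<sigma>_def[symmetric]
      by (simp add: \<sigma>_def[symmetric] del: exec.simps cost.simps)
    let ?t = "cost w c (\<lambda>_. 0, [])"
    have 1: "(code_step code w ^^ ?t) (0, \<lambda>_. 0, []) = (csize c, s)"
      using comp_correct[OF at wfc w(2), of "(\<lambda>_. 0, [])"] ex by simp
    define q where "q = (if sem w (env0 w) f then csize c + 1 else csize c + 2)"
    have 2: "code_step code w (csize c, s) = (q, s)"
      by (simp add: code_step_def code_def s_def q_def nth_append)
    have 3: "(code_step code w ^^ Suc ?t) (0, \<lambda>_. 0, []) = (q, s)" using 1 2 by simp
    have "Suc (Suc ?t) \<le> poly p ?n" using co p[of ?n] by linarith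
    then obtain m where m: "poly p ?n = Suc m" "Suc ?t \<le> m" by (cases "poly p ?n") auto
    have 4: "(code_step code w ^^ m) (0, \<lambda>_. 0, []) = (q, s)"
      by (rule code_step_ge[OF 3 _ m(2)]) (simp add: q_def code_def)
    have "run (code_tm R code) w (poly p ?n) = code_config R w (q, s)"
      using run_code_tm(1)[OF wfcode w(1), of m] 4 m(1) by (simp add: R_def)
    then show ?thesis
      by (cases s) (auto simp: halted_def code_config_simps code_tm_def q_def code_def)
  qed
  show ?thesis unfolding polytime_decidable_rel_def
    by (rule exI[of _ "code_tm R code"], rule exI[of _ p])
       (use run input_ok_encode wf_code_tm[OF wfcode] in \<open>auto simp: Let_def\<close>)
qed

definition matrix_env :: "nat list \<Rightarrow> nat \<Rightarrow> nat \<Rightarrow> nat \<Rightarrow> nat" where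
  "matrix_env w i j = (env0 w)(1 := i, 2 := j)"

theorem compute_matrix:
  assumes wff: "wff K {0, 1, 2} f" and K: "2 < K" and N: "tvars N \<subseteq> {0}"
  shows "polytime_computable (\<lambda>x. encode_graph (val (env0 (encode_word x)) N)
    (\<lambda>i j. sem (encode_word x) (matrix_env (encode_word x) i j) f))"
proof -
  \<comment> \<open>Registers 2 and 3 are the variables 1 and 2 of \<open>f\<close>, the row and
    column index. Registers \<open>K + 2\<close> and \<open>K + 3\<close> count the remaining rows
    and columns.\<close>
  let ?d = "K + 1"
  define c3 where "c3 = setF f ?d (K + 4) ;; IfZ ?d (Out False) (Dec ?d ;; Out True) ;; Inc 3"
  define c2 where "c2 = addT N (K + 3) (K + 4) ;; Rep (K + 3) c3 ;; clr 3 ;; Inc 2"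
  define c1 where "c1 = addT N (K + 2) (K + 4) ;; Rep (K + 2) c2"
  define c where "c = (Scan 1 ;; clr 0) ;; c1"
  have m3: "x = ?d \<or> x \<le> K \<or> K + 4 \<le> x" if "x \<in> mods c3" for x
    using that mods_setF[OF _ wff, of x ?d "K + 4"] K by (auto simp: c3_def)
  have m2: "x = ?d \<or> x = K + 3 \<or> x \<le> K \<or> K + 4 \<le> x" if "x \<in> mods c2" for x
  proof -
    have "tvars N \<subseteq> {..<K}" using N K by auto
    then show ?thesis using that m3[of x] mods_addT[of x N "K + 3" "K + 4" K] K by (auto simp: c2_def)
  qed
  have wa: "wf_rep (addT N d (K + 4))" if "K < d" "d < K + 4" for d
    using N that K by (intro wf_rep_addT) auto
  have "wf_rep c3" using wf_rep_setF[OF wff, of ?d "K + 4"] by (simp add: c3_def)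
  then have "wf_rep c2" using wa[of "K + 3"] m3[of "K + 3"] by (auto simp: c2_def)
  then have "wf_rep c" using wa[of "K + 2"] m2[of "K + 2"] by (auto simp: c_def c1_def)
  then obtain R0 where "wf_com R0 c" using wf_rep_wf_com by blast
  define R where "R = max R0 1"
  have wfc: "wf_com R c" using wf_com_mono[OF \<open>wf_com R0 c\<close>] by (simp add: R_def)
  define code where "code = comp c 0"
  have wfcode: "\<forall>x \<in> set code. wf_instr R (length code) x"
    using wf_comp[of _ c 0 R "length code"] wfc by (auto simp: code_def)
  have at: "code_at code 0 (comp c 0)" unfolding code_at_def code_def by auto
  let ?M = "\<lambda>n. val (\<lambda>_. n) N"
  define C3 where "C3 n = cf f (n + ?M n) + 5" for n
  define C2 where "C2 n = ct N n + (1 + ?M n * (3 + C3 n)) + (1 + 3 * ?M n) + 1" for n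
  define T where "T n = 4 + 7 * n + (ct N n + (1 + ?M n * (3 + C2 n)))" for n
  have "poly_bounded (\<lambda>n. cf f (n + ?M n))"
    by (rule poly_bounded_comp[OF poly_bounded_cf]) (intro poly_bounded_intros poly_bounded_val)
  then have "poly_bounded T" unfolding T_def C2_def C3_def
    by (intro poly_bounded_intros poly_bounded_val poly_bounded_ct)
  then obtain p :: "nat poly" where p: "\<And>n. T n \<le> poly p n" unfolding poly_bounded_def by blast
  have run: "halted (code_tm R code) (run (code_tm R code) w (poly p (length w))) \<and>
      fst (last (snd (run (code_tm R code) w (poly p (length w))))) =
        word_contents (encode_word (encode_graph (val (env0 w) N) (\<lambda>i j. sem w (matrix_env w i j) f)))"
    if "input_ok w" for w
  proof -
    have w: "set w \<subseteq> {..<4}" "0 \<notin> set w" using that by (fastforce simp: input_ok_def)+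
    let ?n = "length w"
    define M where "M = val (env0 w) N"
    have MM: "M \<le> ?M ?n" unfolding M_def by (intro val_mono) (auto simp: env0_def)
    have M_eq: "val (matrix_env w i j) N = M" for i j
      unfolding M_def using N by (intro val_cong) (auto simp: matrix_env_def)
    define row where "row i m = map (\<lambda>j. sem w (matrix_env w i j) f) [0..<m]" for i m
    define rows where "rows m = concat (map (\<lambda>i. row i M) [0..<m])" for m
    define st :: "nat \<Rightarrow> nat \<Rightarrow> nat \<Rightarrow> nat \<Rightarrow> nat \<Rightarrow> nat" where
      "st a b i j = (\<lambda>_. 0)(1 := ?n, 2 := i, 3 := j, K + 2 := a, K + 3 := b)" for a b i j
    have body3: "exec w c3 (st a b i j, u) = (st a b i (Suc j), u @ [sem w (matrix_env w i j) f]) \<and>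
        cost w c3 (st a b i j, u) \<le> C3 ?n" if "i < M" "j < M" for a b i j u
    proof -
      have "exec w (setF f ?d (K + 4)) (st a b i j, u) =
          ((st a b i j)(?d := of_bool (sem w (matrix_env w i j) f)), u) \<and>
          cost w (setF f ?d (K + 4)) (st a b i j, u) \<le> cf f (?n + ?M ?n)"
        using K wff that MM
        by (intro setF_correct[of K _ _ _ _ _ "{0, 1, 2}"])
           (auto simp: st_def matrix_env_def env0_def numeral_eq_Suc)
      then show ?thesis using K
        by (auto simp: c3_def C3_def st_def decr_def fun_eq_iff simp del: setF.simps)
    qed
    have addN: "exec w (addT N d (K + 4)) (\<sigma>, u) = (\<sigma>(d := M), u) \<and>
        cost w (addT N d (K + 4)) (\<sigma>, u) \<le> ct N ?n"
      if "\<sigma> d = 0" "\<forall>r \<ge> K + 4. \<sigma> r = 0" "\<sigma> 1 = ?n" "K < d" "d < K + 4" for d \<sigma> u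
    proof -
      have "\<forall>v \<in> tvars N. \<sigma> (Suc v) = env0 w v \<and> Suc v < K + 4 \<and> Suc v \<noteq> d \<and> env0 w v \<le> ?n"
        using N that(3-5) K by (auto simp: env0_def)
      from addT_correct[OF that(5,2) this, of w u] show ?thesis using that(1) by (simp add: M_def)
    qed
    have body2: "exec w c2 (st a 0 i 0, u) = (st a 0 (Suc i) 0, u @ row i M) \<and>
        cost w c2 (st a 0 i 0, u) \<le> C2 ?n" if "i < M" for a i u
    proof -
      have 1: "exec w (addT N (K + 3) (K + 4)) (st a 0 i 0, u) = ((st a 0 i 0)(K + 3 := M), u) \<and>
        cost w (addT N (K + 3) (K + 4)) (st a 0 i 0, u) \<le> ct N ?n"
        using K by (intro addN) (auto simp: st_def)
      let ?S = "\<lambda>j. (st a (M - j) i j, u @ row i j)"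
      have 2: "exec w c3 (decr (K + 3) (?S j)) = ?S (Suc j) \<and> cost w c3 (decr (K + 3) (?S j)) \<le> C3 ?n"
        if "j < M" for j
      proof -
        have "decr (K + 3) (?S j) = (st a (M - Suc j) i j, u @ row i j)"
          using K by (auto simp: decr_def st_def fun_eq_iff)
        then show ?thesis using body3[OF \<open>i < M\<close> that, of a "M - Suc j" "u @ row i j"] by (simp add: row_def)
      qed
      have S0: "?S 0 = ((st a 0 i 0)(K + 3 := M), u)" by (auto simp: st_def fun_eq_iff row_def)
      have r: "fst (?S 0) (K + 3) = M" by (simp add: st_def)
      have 3: "exec w (Rep (K + 3) c3) ((st a 0 i 0)(K + 3 := M), u) = ?S M"
        using exec_Rep(1)[of M w c3 "K + 3" ?S, OF 2[THEN conjunct1] r] unfolding S0 .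
      have 4: "cost w (Rep (K + 3) c3) ((st a 0 i 0)(K + 3 := M), u) \<le> 1 + M * (3 + C3 ?n)"
        using exec_Rep(2)[of M w c3 "K + 3" ?S, OF 2[THEN conjunct1] r 2[THEN conjunct2]] unfolding S0 .
      have 5: "(st a (M - M) i M)(3 := 0) = st a 0 i 0" "st a (M - M) i M 3 = M"
        using K by (auto simp: st_def fun_eq_iff)
      have e: "exec w c2 (st a 0 i 0, u) = exec w (Inc 2) (exec w (clr 3) (?S M))"
        unfolding c2_def exec.simps(5) 1[THEN conjunct1] 3 ..
      have c: "cost w c2 (st a 0 i 0, u) = cost w (addT N (K + 3) (K + 4)) (st a 0 i 0, u) +
         (cost w (Rep (K + 3) c3) ((st a 0 i 0)(K + 3 := M), u) + (cost w (clr 3) (?S M) + 1))"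
        unfolding c2_def cost.simps(3,5) cost.simps(2) 1[THEN conjunct1] 3 ..
      have "M * (3 + C3 ?n) \<le> ?M ?n * (3 + C3 ?n)" using MM by simp
      then have "cost w c2 (st a 0 i 0, u) \<le> C2 ?n"
        unfolding c C2_def using 1 4 exec_clr(2)[of w 3 "st a (M - M) i M" "u @ row i M"] 5 MM by linarith
      moreover have "exec w c2 (st a 0 i 0, u) = (st a 0 (Suc i) 0, u @ row i M)"
        unfolding e exec_clr(1) 5(1) using K by (auto simp: st_def fun_eq_iff)
      ultimately show ?thesis by simp
    qed
    have e1: "exec w c1 (st 0 0 0 0, []) = (st 0 0 M 0, rows M) \<and>
        cost w c1 (st 0 0 0 0, []) \<le> ct N ?n + (1 + ?M ?n * (3 + C2 ?n))"
    proof -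
      have 1: "exec w (addT N (K + 2) (K + 4)) (st 0 0 0 0, []) = ((st 0 0 0 0)(K + 2 := M), []) \<and>
        cost w (addT N (K + 2) (K + 4)) (st 0 0 0 0, []) \<le> ct N ?n"
        using K by (intro addN) (auto simp: st_def)
      let ?S = "\<lambda>i. (st (M - i) 0 i 0, rows i)"
      have 2: "exec w c2 (decr (K + 2) (?S i)) = ?S (Suc i) \<and> cost w c2 (decr (K + 2) (?S i)) \<le> C2 ?n"
        if "i < M" for i
      proof -
        have "decr (K + 2) (?S i) = (st (M - Suc i) 0 i 0, rows i)"
          using K by (auto simp: decr_def st_def fun_eq_iff)
        then show ?thesis using body2[OF that, of "M - Suc i" "rows i"] by (simp add: rows_def)
      qed
      have S0: "?S 0 = ((st 0 0 0 0)(K + 2 := M), [])" by (auto simp: st_def fun_eq_iff rows_def)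
      have r: "fst (?S 0) (K + 2) = M" by (simp add: st_def)
      have 3: "exec w (Rep (K + 2) c2) ((st 0 0 0 0)(K + 2 := M), []) = ?S M"
        using exec_Rep(1)[of M w c2 "K + 2" ?S, OF 2[THEN conjunct1] r] unfolding S0 .
      have 4: "cost w (Rep (K + 2) c2) ((st 0 0 0 0)(K + 2 := M), []) \<le> 1 + M * (3 + C2 ?n)"
        using exec_Rep(2)[of M w c2 "K + 2" ?S, OF 2[THEN conjunct1] r 2[THEN conjunct2]] unfolding S0 .
      have e: "exec w c1 (st 0 0 0 0, []) = ?S M"
        unfolding c1_def exec.simps(5) 1[THEN conjunct1] 3 ..
      have c: "cost w c1 (st 0 0 0 0, []) = cost w (addT N (K + 2) (K + 4)) (st 0 0 0 0, []) +
         cost w (Rep (K + 2) c2) ((st 0 0 0 0)(K + 2 := M), [])"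
        unfolding c1_def cost.simps(5) 1[THEN conjunct1] ..
      have "M * (3 + C2 ?n) \<le> ?M ?n * (3 + C2 ?n)" using MM by simp
      then show ?thesis unfolding e c diff_self_eq_0 using 1 4 by (intro conjI refl) linarith
    qed
    have ini: "(\<lambda>_. 0)(1 := ?n) = st 0 0 0 0" by (auto simp: st_def fun_eq_iff)
    have ex: "exec w c (\<lambda>_. 0, []) = (st 0 0 M 0, rows M)"
      unfolding c_def exec.simps(5)[of w "_ ;; _"] scan_correct(1) ini using e1 by blast
    have co: "cost w c (\<lambda>_. 0, []) + 2 \<le> T ?n"
      unfolding c_def cost.simps(5)[of w "_ ;; _"] scan_correct(1) ini T_def
      using e1 scan_correct(2)[of w] by linarith
    let ?t = "cost w c (\<lambda>_. 0, [])"
    have 1: "(code_step code w ^^ ?t) (0, \<lambda>_. 0, []) = (csize c, st 0 0 M 0, rows M)"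
      using comp_correct[OF at wfc w(2), of "(\<lambda>_. 0, [])"] ex by simp
    have "Suc (Suc ?t) \<le> poly p ?n" using co p[of ?n] by linarith
    then obtain m where m: "poly p ?n = Suc m" "?t \<le> m" by (cases "poly p ?n") auto
    have 4: "(code_step code w ^^ m) (0, \<lambda>_. 0, []) = (csize c, st 0 0 M 0, rows M)"
      by (rule code_step_ge[OF 1 _ m(2)]) (simp add: code_def)
    have "run (code_tm R code) w (poly p ?n) = code_config R w (csize c, st 0 0 M 0, rows M)"
      using run_code_tm(1)[OF wfcode w(1), of m] 4 m(1) by (simp add: R_def)
    then show ?thesis
      by (auto simp: halted_def code_config_simps code_tm_def code_def rows_def row_def encode_graph_def M_def)
  qed
  have len: "length (encode_word x) = length x" for x by (simp add: encode_word_def)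
  show ?thesis unfolding polytime_computable_def
  proof (rule exI[of _ "code_tm R code"], rule exI[of _ p], intro conjI allI)
    fix x
    show "let c = run (code_tm R code) (encode_word x) (poly p (length x))
      in halted (code_tm R code) c \<and> fst (last (snd c)) = word_contents (encode_word
        (encode_graph (val (env0 (encode_word x)) N)
          (\<lambda>i j. sem (encode_word x) (matrix_env (encode_word x) i j) f)))"
      using run[OF input_ok_encode(1)[of x]] by (simp add: len Let_def)
  qed (rule wf_code_tm[OF wfcode])
qed

section \<open>Clause schemas\<close>

primrec fv :: "fm \<Rightarrow> nat set" where
  "fv (FLe a b) = tvars a \<union> tvars b"
| "fv (FSym s t) = tvars t"
| "fv (FNot f) = fv f"
| "fv (FAnd f g) = fv f \<union> fv g"
| "fv (FEx v t f) = tvars t \<union> (fv f - {v})"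

lemma sem_cong: "(\<And>v. v \<in> fv f \<Longrightarrow> e v = e' v) \<Longrightarrow> sem w e f \<longleftrightarrow> sem w e' f"
proof (induction f arbitrary: e e')
  case (FLe a b)
  then show ?case using val_cong[of a e e'] val_cong[of b e e'] by simp
next
  case (FSym s t)
  then show ?case using val_cong[of t e e'] by simp
next
  case (FNot f)
  then show ?case by (metis fv.simps(3) sem.simps(3))
next
  case (FAnd f g)
  have "sem w e f \<longleftrightarrow> sem w e' f" by (rule FAnd.IH(1)) (use FAnd.prems in simp)
  moreover have "sem w e g \<longleftrightarrow> sem w e' g" by (rule FAnd.IH(2)) (use FAnd.prems in simp)
  ultimately show ?case by simp
next
  case (FEx v t f)
  have "val e t = val e' t" by (rule val_cong) (use FEx.prems in simp)
  moreover have "sem w (e(v := z)) f \<longleftrightarrow> sem w (e'(v := z)) f" for z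
    by (rule FEx.IH) (use FEx.prems in auto)
  ultimately show ?case by simp
qed

definition FEq :: "trm \<Rightarrow> trm \<Rightarrow> fm" where "FEq a b = FAnd (FLe a b) (FLe b a)"
definition FOr :: "fm \<Rightarrow> fm \<Rightarrow> fm" where "FOr f g = FNot (FAnd (FNot f) (FNot g))"
definition FLt :: "trm \<Rightarrow> trm \<Rightarrow> fm" where "FLt a b = FNot (FLe b a)"

primrec FConj :: "fm list \<Rightarrow> fm" where
  "FConj [] = FLe (TC 0) (TC 0)"
| "FConj (f # fs) = FAnd f (FConj fs)"

primrec FDisj :: "fm list \<Rightarrow> fm" where
  "FDisj [] = FNot (FLe (TC 0) (TC 0))"
| "FDisj (f # fs) = FOr f (FDisj fs)"

lemma sem_connectives [simp]:
  "sem w e (FEq a b) \<longleftrightarrow> val e a = val e b"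
  "sem w e (FOr f g) \<longleftrightarrow> sem w e f \<or> sem w e g"
  "sem w e (FLt a b) \<longleftrightarrow> val e a < val e b"
  "sem w e (FConj fs) \<longleftrightarrow> (\<forall>f\<in>set fs. sem w e f)"
  "sem w e (FDisj fs) \<longleftrightarrow> (\<exists>f\<in>set fs. sem w e f)"
  by (induction fs) (auto simp: FEq_def FOr_def FLt_def)

lemma wff_connectives [simp]:
  "wff K S (FEq a b) \<longleftrightarrow> tvars a \<union> tvars b \<subseteq> {..<K}"
  "wff K S (FOr f g) \<longleftrightarrow> wff K S f \<and> wff K S g"
  "wff K S (FLt a b) \<longleftrightarrow> tvars a \<union> tvars b \<subseteq> {..<K}"
  "wff K S (FConj fs) \<longleftrightarrow> (\<forall>f\<in>set fs. wff K S f)"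
  "wff K S (FDisj fs) \<longleftrightarrow> (\<forall>f\<in>set fs. wff K S f)"
  by (induction fs) (auto simp: FEq_def FOr_def FLt_def)

lemma fv_connectives [simp]:
  "fv (FEq a b) = tvars a \<union> tvars b"
  "fv (FOr f g) = fv f \<union> fv g"
  "fv (FLt a b) = tvars a \<union> tvars b"
  "fv (FConj fs) = (\<Union>f\<in>set fs. fv f)"
  "fv (FDisj fs) = (\<Union>f\<in>set fs. fv f)"
  by (induction fs) (auto simp: FEq_def FOr_def FLt_def)

text \<open>
  A schema has one clause for all \<open>t\<close> and \<open>p\<close> below \<open>B\<close> (variables 5 and 6) that satisfy its
  condition; a literal is a sign and a term for the index of its propositional variable.
\<close>

type_synonym schema = "fm \<times> (bool \<times> trm) list"

definition inst :: "nat list \<Rightarrow> nat \<Rightarrow> nat \<Rightarrow> nat \<Rightarrow> nat" where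
  "inst w t p = (env0 w)(5 := t, 6 := p)"

definition schema_holds :: "nat list \<Rightarrow> nat \<Rightarrow> schema \<Rightarrow> (nat \<Rightarrow> bool) \<Rightarrow> bool" where
  "schema_holds w b s a \<longleftrightarrow> (\<forall>t<b. \<forall>p<b. sem w (inst w t p) (fst s) \<longrightarrow>
     (\<exists>(g, k)\<in>set (snd s). a (val (inst w t p) k) = g))"

text \<open>Tautological instances are dropped, since a table cannot hold a variable with both signs.\<close>

definition guard :: "schema \<Rightarrow> fm" where
  "guard s = FConj (fst s # map (\<lambda>((g, k), (g', k')). FNot (FEq k k'))
     (filter (\<lambda>(l, l'). fst l \<noteq> fst l') (List.product (snd s) (snd s))))"

lemma sem_guard: "sem w e (guard s) \<longleftrightarrow> sem w e (fst s) \<and>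
    (\<forall>(g, k)\<in>set (snd s). \<forall>(g', k')\<in>set (snd s). g \<noteq> g' \<longrightarrow> val e k \<noteq> val e k')"
  unfolding guard_def by auto

text \<open>Variable 3 is the row and 4 the column of the table. The instance \<open>t\<close>,
  \<open>p\<close> of schema \<open>i\<close> gets its row number from \<open>i\<close>,
  \<open>t\<close>, \<open>p\<close> as digits.\<close>

definition row_fm :: "trm \<Rightarrow> nat \<Rightarrow> fm" where
  "row_fm B i = FEq (TV 3) (TAdd (TMul (TC i) (TMul B B)) (TAdd (TMul (TV 5) B) (TV 6)))"

definition lit_fm :: "bool \<Rightarrow> schema \<Rightarrow> fm" where
  "lit_fm g s = FDisj (map (\<lambda>l. FEq (TV 4) (snd l)) (filter (\<lambda>l. fst l = g) (snd s)))"

definition clause_fm :: "trm \<Rightarrow> schema list \<Rightarrow> (schema \<Rightarrow> fm) \<Rightarrow> fm" where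
  "clause_fm B sc f = FEx 5 B (FEx 6 B (FDisj (map (\<lambda>(i, s). FAnd (row_fm B i) (FAnd (guard s) (f s))) (List.enumerate 0 sc))))"

lemma sem_lit_fm: "sem w e (lit_fm g s) \<longleftrightarrow> (\<exists>k. (g, k) \<in> set (snd s) \<and> e 4 = val e k)"
  unfolding lit_fm_def by force

text \<open>
  Columns 0 and \<open>N0 + 1\<close> hold two variables that occur in every clause. The last three rows and the
  unused ones (negative, positive) force them to be false, the used rows have them positive.
\<close>

definition valid_fm :: "trm \<Rightarrow> schema list \<Rightarrow> fm" where
  "valid_fm B sc = clause_fm B sc (\<lambda>_. FLe (TC 0) (TC 0))"

definition rows_trm :: "trm \<Rightarrow> schema list \<Rightarrow> trm" where
  "rows_trm B sc = TMul (TC (length sc)) (TMul B B)"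

definition pos_fm :: "trm \<Rightarrow> trm \<Rightarrow> schema list \<Rightarrow> fm" where
  "pos_fm B N0 sc = FDisj [
     FAnd (FEq (TV 4) (TC 0)) (FOr (valid_fm B sc) (FEq (TV 3) (TAdd (rows_trm B sc) (TC 1)))),
     FAnd (FEq (TV 4) (TAdd N0 (TC 1))) (FAnd (FNot (FEq (TV 3) (rows_trm B sc))) (FNot (FEq (TV 3) (TAdd (rows_trm B sc) (TC 1))))),
     FAnd (FLt (TC 0) (TV 4)) (FAnd (FLe (TV 4) N0) (clause_fm B sc (lit_fm True)))]"

definition neg_fm :: "trm \<Rightarrow> trm \<Rightarrow> schema list \<Rightarrow> fm" where
  "neg_fm B N0 sc = FDisj [
     FAnd (FEq (TV 4) (TC 0)) (FAnd (FNot (valid_fm B sc)) (FNot (FEq (TV 3) (TAdd (rows_trm B sc) (TC 1))))),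
     FAnd (FEq (TV 4) (TAdd N0 (TC 1))) (FOr (FEq (TV 3) (rows_trm B sc)) (FEq (TV 3) (TAdd (rows_trm B sc) (TC 1)))),
     FAnd (FLt (TC 0) (TV 4)) (FAnd (FLe (TV 4) N0) (clause_fm B sc (lit_fm False)))]"

lemma divmod_pair: "m < d \<Longrightarrow> (i * d + m) div d = i \<and> (i * d + m) mod d = m" for m :: nat
  by simp

locale schema_table =
  fixes w :: "nat list" and B N0 :: trm and sc :: "schema list"
  assumes B: "tvars B \<subseteq> {0}" and N0: "tvars N0 \<subseteq> {0}"
    and fv: "\<And>s. s \<in> set sc \<Longrightarrow> fv (fst s) \<subseteq> {0, 5, 6}"
    and keys: "\<And>s g k. s \<in> set sc \<Longrightarrow> (g, k) \<in> set (snd s) \<Longrightarrow> tvars k \<subseteq> {0, 5, 6}"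
    and key_range: "\<And>s t p g k. s \<in> set sc \<Longrightarrow> t < val (env0 w) B \<Longrightarrow> p < val (env0 w) B \<Longrightarrow>
      sem w (inst w t p) (fst s) \<Longrightarrow> (g, k) \<in> set (snd s) \<Longrightarrow> 0 < val (inst w t p) k \<and> val (inst w t p) k \<le> val (env0 w) N0"
begin

definition b :: nat where "b = val (env0 w) B"
definition n0 :: nat where "n0 = val (env0 w) N0"
definition c0 :: nat where "c0 = length sc * (b * b)"

definition ok :: "nat \<Rightarrow> nat \<Rightarrow> schema \<Rightarrow> bool" where
  "ok t p s \<longleftrightarrow> sem w (inst w t p) (guard s)"

definition row :: "nat \<Rightarrow> nat \<Rightarrow> nat \<Rightarrow> nat" where
  "row i t p = i * (b * b) + (t * b + p)"

lemma row_inj: "t < b \<Longrightarrow> p < b \<Longrightarrow> t' < b \<Longrightarrow> p' < b \<Longrightarrow> row i t p = row i' t' p' \<Longrightarrow> i = i' \<and> t = t' \<and> p = p'"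
proof -
  assume *: "t < b" "p < b" "t' < b" "p' < b" "row i t p = row i' t' p'"
  have lt: "t * b + p < b * b" if "t < b" "p < b" for t p
    using mult_right_mono[of "Suc t" b b] that by simp
  have "row i t p div (b * b) = i" "row i t p mod (b * b) = t * b + p" "row i' t' p' div (b * b) = i'" "row i' t' p' mod (b * b) = t' * b + p'"
    using divmod_pair[OF lt[OF *(1,2)]] divmod_pair[OF lt[OF *(3,4)]] unfolding row_def by blast+
  then have i: "i = i'" and tp: "t * b + p = t' * b + p'" using *(5) by auto
  have "(t * b + p) div b = t" "(t * b + p) mod b = p" "(t' * b + p') div b = t'" "(t' * b + p') mod b = p'" using *(1-4) by auto
  then show ?thesis using i tp by auto
qed

lemma row_lt:
  assumes "i < length sc" "t < b" "p < b"
  shows "row i t p < c0"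
proof -
  have "t * b + p < b * b" using mult_right_mono[of "Suc t" b b] assms by simp
  moreover have "Suc i * (b * b) \<le> length sc * (b * b)" using assms(1) by (intro mult_right_mono) auto
  ultimately show ?thesis unfolding row_def c0_def by simp
qed

lemma sem_clause_fm:
  assumes "e 0 = length w" "\<And>s t p. s \<in> set sc \<Longrightarrow> sem w (e(5 := t, 6 := p)) (f s) \<longleftrightarrow> P t p s"
  shows "sem w e (clause_fm B sc f) \<longleftrightarrow>
    (\<exists>t<b. \<exists>p<b. \<exists>i<length sc. e 3 = row i t p \<and> ok t p (sc ! i) \<and> P t p (sc ! i))"
proof -
  have v: "val e B = b" "val (e(5 := t)) B = b" "val (e(5 := t, 6 := p)) B = b" for t p
    unfolding b_def using B assms(1) by (auto intro!: val_cong simp: env0_def)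
  have g: "sem w (e(5 := t, 6 := p)) (guard s) \<longleftrightarrow> ok t p s" if "s \<in> set sc" for s t p
    unfolding ok_def
  proof (rule sem_cong)
    fix v assume "v \<in> fv (guard s)"
    then have "v \<in> {0, 5, 6}" using fv[OF that] keys[OF that] unfolding guard_def by fastforce
    then show "(e(5 := t, 6 := p)) v = inst w t p v" using assms(1) by (auto simp: inst_def env0_def)
  qed
  have "sem w e (clause_fm B sc f) \<longleftrightarrow> (\<exists>t<b. \<exists>p<b. \<exists>i<length sc. e 3 = row i t p \<and>
      sem w (e(5 := t, 6 := p)) (guard (sc ! i)) \<and> sem w (e(5 := t, 6 := p)) (f (sc ! i)))"
    unfolding clause_fm_def by (simp add: v row_fm_def row_def in_set_enumerate_eq Bex_def)
  also have "\<dots> \<longleftrightarrow> (\<exists>t<b. \<exists>p<b. \<exists>i<length sc. e 3 = row i t p \<and> ok t p (sc ! i) \<and> P t p (sc ! i))"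
    by (simp add: g[OF nth_mem] assms(2)[OF nth_mem] cong: conj_cong)
  finally show ?thesis .
qed

lemma sem_lit_inst:
  assumes "e 0 = length w" "s \<in> set sc"
  shows "sem w (e(5 := t, 6 := p)) (lit_fm g s) \<longleftrightarrow> (\<exists>k. (g, k) \<in> set (snd s) \<and> e 4 = val (inst w t p) k)"
proof -
  have "val (e(5 := t, 6 := p)) k = val (inst w t p) k" if "(g, k) \<in> set (snd s)" for k
    using keys[OF assms(2) that] assms(1) by (intro val_cong) (auto simp: inst_def env0_def)
  then show ?thesis unfolding sem_lit_fm by auto
qed

definition valid :: "nat \<Rightarrow> bool" where
  "valid c \<longleftrightarrow> (\<exists>t<b. \<exists>p<b. \<exists>i<length sc. c = row i t p \<and> ok t p (sc ! i))"

definition has_lit :: "bool \<Rightarrow> nat \<Rightarrow> nat \<Rightarrow> bool" where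
  "has_lit g c j \<longleftrightarrow> (\<exists>t<b. \<exists>p<b. \<exists>i<length sc. c = row i t p \<and> ok t p (sc ! i) \<and>
     (\<exists>k. (g, k) \<in> set (snd (sc ! i)) \<and> j = val (inst w t p) k))"

definition tab :: "nat \<Rightarrow> nat \<Rightarrow> nat" where
  "tab c j = (if sem w ((env0 w)(3 := c, 4 := j)) (neg_fm B N0 sc) then 2
     else if sem w ((env0 w)(3 := c, 4 := j)) (pos_fm B N0 sc) then 1 else 0)"

lemma sem_pos_neg:
  assumes "e 0 = length w" "e 3 = c" "e 4 = j"
  shows "sem w e (pos_fm B N0 sc) \<longleftrightarrow> j = 0 \<and> (valid c \<or> c = c0 + 1) \<or>
      j = n0 + 1 \<and> c \<noteq> c0 \<and> c \<noteq> c0 + 1 \<or> 0 < j \<and> j \<le> n0 \<and> has_lit True c j"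
    "sem w e (neg_fm B N0 sc) \<longleftrightarrow> j = 0 \<and> \<not> valid c \<and> c \<noteq> c0 + 1 \<or>
      j = n0 + 1 \<and> (c = c0 \<or> c = c0 + 1) \<or> 0 < j \<and> j \<le> n0 \<and> has_lit False c j"
proof -
  have v: "val e B = b" "val e N0 = n0" unfolding b_def n0_def using B N0 assms(1) by (auto intro!: val_cong simp: env0_def)
  have l: "sem w e (clause_fm B sc (lit_fm g)) \<longleftrightarrow> has_lit g c j" for g
    using sem_clause_fm[of e "lit_fm g" "\<lambda>t p s. \<exists>k. (g, k) \<in> set (snd s) \<and> e 4 = val (inst w t p) k"]
      sem_lit_inst[where e = e and g = g, OF assms(1)] assms by (simp add: has_lit_def)
  have va: "sem w e (valid_fm B sc) \<longleftrightarrow> valid c"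
    using sem_clause_fm[of e "\<lambda>_. FLe (TC 0) (TC 0)" "\<lambda>_ _ _. True"] assms(1,2) by (simp add: valid_fm_def valid_def)
  show "sem w e (pos_fm B N0 sc) \<longleftrightarrow> j = 0 \<and> (valid c \<or> c = c0 + 1) \<or>
      j = n0 + 1 \<and> c \<noteq> c0 \<and> c \<noteq> c0 + 1 \<or> 0 < j \<and> j \<le> n0 \<and> has_lit True c j"
    "sem w e (neg_fm B N0 sc) \<longleftrightarrow> j = 0 \<and> \<not> valid c \<and> c \<noteq> c0 + 1 \<or>
      j = n0 + 1 \<and> (c = c0 \<or> c = c0 + 1) \<or> 0 < j \<and> j \<le> n0 \<and> has_lit False c j"
    by (auto simp: pos_fm_def neg_fm_def rows_trm_def c0_def v l va assms(2,3))
qed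

lemma tab_eq:
  "tab c j = (if j = 0 \<and> \<not> valid c \<and> c \<noteq> c0 + 1 \<or> j = n0 + 1 \<and> (c = c0 \<or> c = c0 + 1) \<or> 0 < j \<and> j \<le> n0 \<and> has_lit False c j then 2
     else if j = 0 \<and> (valid c \<or> c = c0 + 1) \<or> j = n0 + 1 \<and> c \<noteq> c0 \<and> c \<noteq> c0 + 1 \<or> 0 < j \<and> j \<le> n0 \<and> has_lit True c j then 1 else 0)"
proof -
  let ?e = "(env0 w)(3 := c, 4 := j)"
  have "?e 0 = length w" "?e 3 = c" "?e 4 = j" by (simp_all add: env0_def)
  note sem_pos_neg[OF this]
  then show ?thesis unfolding tab_def by (simp only:)
qed

lemma valid_lt: "valid c \<Longrightarrow> c < c0"
  unfolding valid_def using row_lt by blast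

lemma lits_exclusive: "has_lit True c j \<Longrightarrow> \<not> has_lit False c j"
proof
  assume "has_lit True c j" "has_lit False c j"
  then obtain t p i k t' p' i' k' where *: "t < b" "p < b" "c = row i t p" "ok t p (sc ! i)" "(True, k) \<in> set (snd (sc ! i))"
    "j = val (inst w t p) k" "t' < b" "p' < b" "c = row i' t' p'" "(False, k') \<in> set (snd (sc ! i'))" "j = val (inst w t' p') k'"
    unfolding has_lit_def by blast
  have "i = i'" "t = t'" "p = p'" using row_inj[of t p t' p' i i'] * by auto
  then show False using * unfolding ok_def sem_guard by fastforce
qed

lemma tab_le: "tab c j \<le> 2"
  by (simp add: tab_eq)

lemma tab_ends: "tab c 0 \<noteq> 0" "tab c (n0 + 1) \<noteq> 0"
  by (auto simp: tab_eq)

theorem table_sat_iff: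
  "(\<exists>a. table_sat (c0 + 3) (n0 + 2) tab a) \<longleftrightarrow> (\<exists>a. \<forall>s\<in>set sc. schema_holds w b s a)"
proof
  assume "\<exists>a. table_sat (c0 + 3) (n0 + 2) tab a"
  then obtain a where a: "\<And>c. c < c0 + 3 \<Longrightarrow> \<exists>j<n0 + 2. tab c j = 1 \<and> a j \<or> tab c j = 2 \<and> \<not> a j"
    unfolding table_sat_def by blast
  have last: "\<not> valid c0" "\<not> valid (c0 + 1)" "\<not> valid (c0 + 2)" using valid_lt by force+
  have nolit: "\<not> has_lit g c j" if "\<not> valid c" for g c j using that unfolding has_lit_def valid_def by blast
  \<comment> \<open>On the two constant columns the rows \<open>c0\<close>, \<open>c0 + 1\<close>,
    \<open>c0 + 2\<close> have the signs (-,-), (+,-), (-,+) and no further literals; only the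
    assignment false, false satisfies all three.\<close>
  have "a 0 = False" "a (n0 + 1) = False"
    using a[of c0] a[of "c0 + 1"] a[of "c0 + 2"] nolit[OF last(1)] nolit[OF last(2)] nolit[OF last(3)] last
    by (auto simp: tab_eq split: if_splits)
  have "schema_holds w b s a" if s: "s \<in> set sc" for s unfolding schema_holds_def
  proof (intro allI impI)
    fix t p assume tp: "t < b" "p < b" "sem w (inst w t p) (fst s)"
    show "\<exists>(g, k)\<in>set (snd s). a (val (inst w t p) k) = g"
    proof (cases "ok t p s")
      case False
      \<comment> \<open>An instance without a row has complementary literals of one variable, one of
        which is true.\<close>
      then obtain g k g' k' where l: "(g, k) \<in> set (snd s)" "(g', k') \<in> set (snd s)" "g \<noteq> g'"
          "val (inst w t p) k = val (inst w t p) k'"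
        using tp(3) unfolding ok_def sem_guard by blast
      then have "a (val (inst w t p) k) = g \<or> a (val (inst w t p) k') = g'" by auto
      then show ?thesis using l(1,2) by blast
    next
      case True
      obtain i where i: "i < length sc" "s = sc ! i" using s by (metis in_set_conv_nth)
      have v: "valid (row i t p)" using i tp True unfolding valid_def by blast
      have lt: "row i t p < c0" using valid_lt[OF v] .
      obtain j where j: "j < n0 + 2" "tab (row i t p) j = 1 \<and> a j \<or> tab (row i t p) j = 2 \<and> \<not> a j"
        using a[of "row i t p"] lt by auto
      then obtain g where "has_lit g (row i t p) j" "a j = g"
        using v lt \<open>a 0 = False\<close> \<open>a (n0 + 1) = False\<close> by (auto simp: tab_eq split: if_splits)
      then obtain t' p' i' k where *: "t' < b" "p' < b" "row i t p = row i' t' p'" "(g, k) \<in> set (snd (sc ! i'))" "j = val (inst w t' p') k"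
        unfolding has_lit_def by blast
      then have "i = i'" "t = t'" "p = p'" using row_inj[of t p t' p' i i'] tp by auto
      then show ?thesis using * \<open>a j = g\<close> i by blast
    qed
  qed
  then show "\<exists>a. \<forall>s\<in>set sc. schema_holds w b s a" by blast
next
  assume "\<exists>a. \<forall>s\<in>set sc. schema_holds w b s a"
  then obtain a where a: "\<And>s. s \<in> set sc \<Longrightarrow> schema_holds w b s a" by blast
  define a' where "a' = a(0 := False, n0 + 1 := False)"
  have "\<exists>j<n0 + 2. tab c j = 1 \<and> a' j \<or> tab c j = 2 \<and> \<not> a' j" for c
  proof (cases "valid c")
    case False
    then show ?thesis
    proof (cases "c = c0 + 1")
      case True
      then have "tab c (n0 + 1) = 2" by (simp add: tab_eq)
      then show ?thesis by (intro exI[of _ "n0 + 1"]) (simp add: a'_def)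
    next
      case 2: False
      then have "tab c 0 = 2" using False by (simp add: tab_eq)
      then show ?thesis by (intro exI[of _ 0]) (simp add: a'_def)
    qed
  next
    case True
    then obtain t p i where *: "t < b" "p < b" "i < length sc" "c = row i t p" "ok t p (sc ! i)" unfolding valid_def by blast
    have s: "sc ! i \<in> set sc" and cond: "sem w (inst w t p) (fst (sc ! i))" using * unfolding ok_def sem_guard by auto
    then obtain g k where gk: "(g, k) \<in> set (snd (sc ! i))" "a (val (inst w t p) k) = g"
      using a[OF s] *(1,2) unfolding schema_holds_def by blast
    let ?j = "val (inst w t p) k"
    have r: "0 < ?j" "?j \<le> n0" using key_range[OF s *(1,2)[unfolded b_def] cond gk(1)] by (auto simp: n0_def)
    have l: "has_lit g c ?j" unfolding has_lit_def using * gk(1) by blast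
    have "tab c ?j = (if g then 1 else 2)" using r l lits_exclusive[of c ?j] by (cases g) (auto simp: tab_eq)
    moreover have "a' ?j = g" using r gk(2) by (simp add: a'_def)
    ultimately show ?thesis using r(2) by (intro exI[of _ ?j]) auto
  qed
  then show "\<exists>a. table_sat (c0 + 3) (n0 + 2) tab a" unfolding table_sat_def by blast
qed

end

section \<open>Computations as clauses\<close>

text \<open>Halting states are turned into stationary ones, so that one kind of clause describes
  every step.\<close>

definition nxt :: "turing_machine \<Rightarrow> nat \<Rightarrow> nat list \<Rightarrow> nat \<times> (nat \<times> dir) list" where
  "nxt M q ss = (if q = accept_state M \<or> q = reject_state M then (q, map (\<lambda>s. (s, Stay)) ss) else delta M q ss)"

lemma act_stay: "map2 act_tape tps (map (\<lambda>s. (s, Stay)) (map read_tape tps)) = tps"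
  by (induction tps) auto

lemma step_nxt:
  "step M c = (fst (nxt M (fst c) (map read_tape (snd c))), map2 act_tape (snd c) (snd (nxt M (fst c) (map read_tape (snd c)))))"
  using act_stay[of "snd c"] by (auto simp: step_def nxt_def halted_def split: prod.splits)

text \<open>Cell \<open>p\<close> of a tape is addressed relative to its head, which stands at \<open>p = O\<close>.\<close>

definition rel :: "nat \<Rightarrow> config \<Rightarrow> nat \<Rightarrow> nat \<Rightarrow> nat" where
  "rel O' c i p = fst (snd c ! i) (snd (snd c ! i) + int p - int O')"

definition wf_config :: "turing_machine \<Rightarrow> config \<Rightarrow> bool" where
  "wf_config M c \<longleftrightarrow> fst c < state_count M \<and> length (snd c) = tape_count M \<and>
     (\<forall>i<tape_count M. \<forall>z. fst (snd c ! i) z < symbol_count M)"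

lemma nxt_wf:
  assumes "wf_tm M" "q < state_count M" "length ss = tape_count M" "set ss \<subseteq> {..<symbol_count M}"
  shows "fst (nxt M q ss) < state_count M" "length (snd (nxt M q ss)) = tape_count M"
    "i < tape_count M \<Longrightarrow> fst (snd (nxt M q ss) ! i) < symbol_count M"
proof -
  obtain q' as where D: "delta M q ss = (q', as)" by (cases "delta M q ss")
  have "case delta M q ss of (q', as) \<Rightarrow> q' < state_count M \<and> length as = tape_count M \<and> (\<forall>(a, d) \<in> set as. a < symbol_count M)"
    using assms(1)[unfolded wf_tm_def, THEN conjunct2, THEN conjunct2, THEN conjunct2, THEN conjunct2, THEN conjunct2,
      THEN conjunct2, rule_format, OF assms(2) conjI[OF assms(3,4)]] .
  then have d: "q' < state_count M" "length as = tape_count M" "\<And>x. x \<in> set as \<Longrightarrow> fst x < symbol_count M"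
    unfolding D by auto
  show "fst (nxt M q ss) < state_count M" "length (snd (nxt M q ss)) = tape_count M"
    unfolding nxt_def D using d(1,2) assms(2,3) by simp_all
  show "fst (snd (nxt M q ss) ! i) < symbol_count M" if "i < tape_count M"
  proof (cases "q = accept_state M \<or> q = reject_state M")
    case True
    have "ss ! i \<in> {..<symbol_count M}" by (rule subsetD[OF assms(4)]) (use that assms(3) in simp)
    then show ?thesis using True that assms(3) unfolding nxt_def by simp
  next
    case False
    have "as ! i \<in> set as" using that d(2) by simp
    then show ?thesis using False d(3) unfolding nxt_def D by simp
  qed
qed

lemma read_tape_rel: "i < length (snd c) \<Longrightarrow> map read_tape (snd c) ! i = rel O' c i O'"
  by (cases "snd c ! i") (simp add: rel_def)

lemma wf_config_symbols: "wf_config M c \<Longrightarrow> set (map read_tape (snd c)) \<subseteq> {..<symbol_count M}"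
proof
  fix s assume c: "wf_config M c" and "s \<in> set (map read_tape (snd c))"
  then obtain i where "i < length (map read_tape (snd c))" "s = map read_tape (snd c) ! i" by (metis in_set_conv_nth)
  then show "s \<in> {..<symbol_count M}" using c read_tape_rel[of i c 0] by (auto simp: wf_config_def rel_def)
qed

text \<open>The coordinates move with the head: place \<open>p2\<close> afterwards is place
  \<open>p2 + offset d\<close> before, and only the cell that was under the head has new
  contents.\<close>

lemma rel_step:
  assumes "wf_tm M" "wf_config M c" "i < tape_count M"
    and d: "snd (nxt M (fst c) (map read_tape (snd c))) ! i = (s, d)"
  shows "int p1 = int p2 + offset d \<Longrightarrow> p1 \<noteq> O' \<Longrightarrow> rel O' (step M c) i p2 = rel O' c i p1"
    "int p2 + offset d = int O' \<Longrightarrow> rel O' (step M c) i p2 = s"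
proof -
  obtain t h where th: "snd c ! i = (t, h)" by (cases "snd c ! i")
  have "length (snd (nxt M (fst c) (map read_tape (snd c)))) = tape_count M"
    using nxt_wf(2)[OF assms(1) _ _ wf_config_symbols[OF assms(2)]] assms(2) by (simp add: wf_config_def)
  then have "snd (step M c) ! i = (t(h := s), h + offset d)"
    using assms(2,3) d th by (simp add: step_nxt wf_config_def)
  then have r: "rel O' (step M c) i p2 = (t(h := s)) (h + offset d + int p2 - int O')" for p2 by (simp add: rel_def)
  show "rel O' (step M c) i p2 = rel O' c i p1" if "int p1 = int p2 + offset d" "p1 \<noteq> O'"
  proof -
    have "h + offset d + int p2 - int O' = h + int p1 - int O'" using that(1) by simp
    moreover have "h + int p1 - int O' \<noteq> h" using that(2) by simp
    ultimately show ?thesis unfolding r by (simp only:) (simp add: rel_def th)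
  qed
  show "rel O' (step M c) i p2 = s" if "int p2 + offset d = int O'"
  proof -
    have "h + offset d + int p2 - int O' = h" using that by simp
    then show ?thesis unfolding r by simp
  qed
qed

lemma wf_config_step:
  assumes "wf_tm M" "wf_config M c"
  shows "wf_config M (step M c)"
proof -
  let ?n = "nxt M (fst c) (map read_tape (snd c))"
  have n: "fst ?n < state_count M" "length (snd ?n) = tape_count M" "i < tape_count M \<Longrightarrow> fst (snd ?n ! i) < symbol_count M" for i
    using nxt_wf[OF assms(1) _ _ wf_config_symbols[OF assms(2)]] assms(2) by (auto simp: wf_config_def)
  show ?thesis unfolding wf_config_def
  proof (intro conjI allI impI)
    show "fst (step M c) < state_count M" using n by (simp add: step_nxt)
    show "length (snd (step M c)) = tape_count M" using n assms(2) by (simp add: step_nxt wf_config_def)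
    fix i z assume i: "i < tape_count M"
    obtain t h where th: "snd c ! i = (t, h)" by (cases "snd c ! i")
    obtain s d where sd: "snd ?n ! i = (s, d)" by (cases "snd ?n ! i")
    have "snd (step M c) ! i = (t(h := s), h + offset d)"
      using assms(2) n(2) sd th i by (simp add: step_nxt wf_config_def)
    then show "fst (snd (step M c) ! i) z < symbol_count M"
      using n(3)[OF i] sd th assms(2) i by (auto simp: wf_config_def)
  qed
qed

lemma wf_config_run:
  assumes "wf_tm M" "\<And>z. z \<in> set v \<Longrightarrow> z < 4"
  shows "wf_config M (run M v t)"
proof (induction t)
  case 0
  have "word_contents v z < symbol_count M" "word_contents [] z < symbol_count M" for z
    using assms nth_mem[of "nat z" v] by (fastforce simp: word_contents_def wf_tm_def)+
  then show ?case using assms(1) unfolding run_def init_config_def wf_config_def wf_tm_def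
    by (auto simp: nth_Cons split: nat.split)
next
  case (Suc t)
  then show ?case using wf_config_step[OF assms(1)] by (simp add: run_def)
qed

section \<open>The clauses of a computation\<close>

locale tableau =
  fixes M :: turing_machine and Tt Pt :: trm
  assumes wf: "wf_tm M" and vars: "tvars Tt \<subseteq> {0}" "tvars Pt \<subseteq> {0}"
begin

abbreviation K where "K \<equiv> tape_count M"
abbreviation G where "G \<equiv> symbol_count M"
abbreviation S where "S \<equiv> state_count M"

abbreviation "Len \<equiv> TV 0"
abbreviation "Time \<equiv> TV 5"
abbreviation "Place \<equiv> TV 6"

abbreviation plus :: "trm \<Rightarrow> nat \<Rightarrow> trm" where "plus t n \<equiv> TAdd t (TC n)"

text \<open>Clauses speak only of places below \<open>Bt\<close>. One place is lost at either border
  in each step, so the margins must keep the head place \<open>Tt + 2\<close> determined for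
  \<open>Tt\<close> steps and leave room for the input, the separator and the certificate.\<close>

definition Ot :: trm where "Ot = plus Tt 2"
definition Bt :: trm where "Bt = TAdd (TMul (TC 2) Tt) (TAdd Pt (plus Len 10))"
definition Nt :: trm where "Nt = TMul (TC (S + K * G)) (TMul Bt Bt)"

text \<open>The added 1 reserves column 0 for a constant column; the rest is a number with digits
  index, time and place.\<close>

definition key :: "nat \<Rightarrow> trm \<Rightarrow> trm \<Rightarrow> trm" where
  "key idx \<tau> \<pi> = TAdd (TC 1) (TAdd (TMul (TC idx) (TMul Bt Bt)) (TAdd (TMul \<tau> Bt) \<pi>))"

definition Qk :: "trm \<Rightarrow> nat \<Rightarrow> trm" where "Qk \<tau> q = key q \<tau> (TC 0)"
definition Sk :: "trm \<Rightarrow> nat \<Rightarrow> trm \<Rightarrow> nat \<Rightarrow> trm" where "Sk \<tau> i \<pi> s = key (S + i * G + s) \<tau> \<pi>"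

text \<open>A copied cell moves from \<open>p + source d\<close> to \<open>p + target d\<close>,
  which avoids subtraction. The cell just written lands at \<open>T + target0 d\<close>, which is
  the head place minus the offset.\<close>

definition source :: "dir \<Rightarrow> nat" where "source d = (if d = MoveRight then 1 else 0)"
definition target :: "dir \<Rightarrow> nat" where "target d = (if d = MoveLeft then 1 else 0)"
definition target0 :: "dir \<Rightarrow> nat" where "target0 d = (case d of MoveLeft \<Rightarrow> 3 | Stay \<Rightarrow> 2 | MoveRight \<Rightarrow> 1)"

definition reads :: "nat \<Rightarrow> nat list \<Rightarrow> (bool \<times> trm) list" where
  "reads q ss = (False, Qk Time q) # map (\<lambda>i. (False, Sk Time i Ot (ss ! i))) [0..<K]"

definition modes :: "(nat \<times> nat list) list" where
  "modes = List.product [0..<S] (List.n_lists K [0..<G])"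

definition state_schemas :: "schema list" where
  "state_schemas = map (\<lambda>(q, ss). (FLt (plus Time 1) Bt, (True, Qk (plus Time 1) (fst (nxt M q ss))) # reads q ss)) modes"

definition write_schemas :: "schema list" where
  "write_schemas = map (\<lambda>((q, ss), i). (FLt (plus Time 1) Bt,
     (True, Sk (plus Time 1) i (plus Tt (target0 (snd (snd (nxt M q ss) ! i)))) (fst (snd (nxt M q ss) ! i))) # reads q ss))
     (List.product modes [0..<K])"

definition copy_schemas :: "schema list" where
  "copy_schemas = map (\<lambda>(((q, ss), i), s). let d = snd (snd (nxt M q ss) ! i) in
     (FConj [FLt (plus Time 1) Bt, FLt (plus Place 1) Bt, FNot (FEq (plus Place (source d)) Ot)],
     [(True, Sk (plus Time 1) i (plus Place (target d)) s), (False, Sk Time i (plus Place (source d)) s)] @ reads q ss))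
     (List.product (List.product modes [0..<K]) [0..<G])"

text \<open>In the certificate region every cell may hold 0, 1 or 2, and a blank passes to the
  right. So a guessed word of bounded length follows the separator. No clause says that a cell holds
  only one symbol.\<close>

definition init_schemas :: "schema list" where
  "init_schemas = map (\<lambda>i. (FConj [], [(True, Sk (TC 0) i Place 0)])) [1..<K] @
    [(FConj [], [(True, Qk (TC 0) (start_state M))]),
     (FOr (FLt Place Ot) (FLt (TAdd Ot (TAdd Len Pt)) Place), [(True, Sk (TC 0) 0 Place 0)]),
     (FEx 7 Len (FAnd (FEq Place (TAdd Ot (TV 7))) (FSym 1 (TV 7))), [(True, Sk (TC 0) 0 Place 1)]),
     (FEx 7 Len (FAnd (FEq Place (TAdd Ot (TV 7))) (FSym 2 (TV 7))), [(True, Sk (TC 0) 0 Place 2)]),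
     (FEq Place (TAdd Ot Len), [(True, Sk (TC 0) 0 Place 3)]),
     (FAnd (FLt (TAdd Ot Len) Place) (FLe Place (TAdd Ot (TAdd Len Pt))),
       [(True, Sk (TC 0) 0 Place 0), (True, Sk (TC 0) 0 Place 1), (True, Sk (TC 0) 0 Place 2)]),
     (FAnd (FLt (TAdd Ot Len) Place) (FLt (plus Place 1) Bt),
       [(True, Sk (TC 0) 0 (plus Place 1) 0), (False, Sk (TC 0) 0 Place 0)])]"

definition final_schemas :: "schema list" where
  "final_schemas = map (\<lambda>q. (FConj [], [(False, Qk Tt q)])) (filter (\<lambda>q. q \<noteq> accept_state M) [0..<S])"

definition schemas :: "schema list" where
  "schemas = state_schemas @ write_schemas @ copy_schemas @ init_schemas @ final_schemas"

definition key_ok :: "nat list \<Rightarrow> nat \<Rightarrow> nat \<Rightarrow> trm \<Rightarrow> bool" where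
  "key_ok w t p k \<longleftrightarrow> tvars k \<subseteq> {0, 5, 6} \<and> 0 < val (inst w t p) k \<and> val (inst w t p) k \<le> val (env0 w) Nt"

lemma val_closed [simp]:
  "val (inst w t p) Tt = val (env0 w) Tt" "val (inst w t p) Pt = val (env0 w) Pt"
  "val (inst w t p) Bt = val (env0 w) Bt" "val (inst w t p) Ot = val (env0 w) Ot"
proof -
  have 0: "inst w t p 0 = env0 w 0" by (simp add: inst_def)
  show *: "val (inst w t p) Tt = val (env0 w) Tt" "val (inst w t p) Pt = val (env0 w) Pt"
    by (rule val_cong; use vars 0 in auto)+
  show "val (inst w t p) Bt = val (env0 w) Bt" "val (inst w t p) Ot = val (env0 w) Ot"
    by (simp_all add: Bt_def Ot_def * 0)
qed

lemma val_inst_vars [simp]: "inst w t p 0 = length w" "inst w t p 5 = t" "inst w t p 6 = p"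
  by (simp_all add: inst_def env0_def)

lemma tvars_closed: "tvars Tt \<subseteq> {0, 5, 6}" "tvars Pt \<subseteq> {0, 5, 6}" "tvars Bt \<subseteq> {0, 5, 6}" "tvars Ot \<subseteq> {0, 5, 6}"
  using vars by (auto simp: Bt_def Ot_def)

lemma key_ok_key:
  assumes "idx < S + K * G" "tvars \<tau> \<subseteq> {0, 5, 6}" "tvars \<pi> \<subseteq> {0, 5, 6}"
    "val (inst w t p) \<tau> < val (env0 w) Bt" "val (inst w t p) \<pi> < val (env0 w) Bt"
  shows "key_ok w t p (key idx \<tau> \<pi>)"
proof -
  let ?b = "val (env0 w) Bt"
  have "val (inst w t p) \<tau> * ?b + val (inst w t p) \<pi> < ?b * ?b"
    using mult_right_mono[of "Suc (val (inst w t p) \<tau>)" ?b ?b] assms(4,5) by simp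
  moreover have "Suc idx * (?b * ?b) \<le> (S + K * G) * (?b * ?b)" using assms(1) by (intro mult_right_mono) auto
  ultimately show ?thesis using assms(2,3) tvars_closed unfolding key_ok_def by (auto simp: key_def Nt_def)
qed

lemma key_ok_Q:
  "q < S \<Longrightarrow> tvars \<tau> \<subseteq> {0, 5, 6} \<Longrightarrow> val (inst w t p) \<tau> < val (env0 w) Bt \<Longrightarrow> key_ok w t p (Qk \<tau> q)"
  unfolding Qk_def by (rule key_ok_key) auto

lemma index_lt: "i < K \<Longrightarrow> s < G \<Longrightarrow> S + i * G + s < S + K * G"
  using mult_right_mono[of "Suc i" K G] by simp

lemma key_ok_S:
  "i < K \<Longrightarrow> s < G \<Longrightarrow> tvars \<tau> \<subseteq> {0, 5, 6} \<Longrightarrow> tvars \<pi> \<subseteq> {0, 5, 6} \<Longrightarrow>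
   val (inst w t p) \<tau> < val (env0 w) Bt \<Longrightarrow> val (inst w t p) \<pi> < val (env0 w) Bt \<Longrightarrow> key_ok w t p (Sk \<tau> i \<pi> s)"
  unfolding Sk_def by (rule key_ok_key) (use index_lt in auto)

lemma modes_iff: "(q, ss) \<in> set modes \<longleftrightarrow> q < S \<and> length ss = K \<and> set ss \<subseteq> {..<G}"
  by (auto simp: modes_def set_n_lists)

lemma mode_symbol: "(q, ss) \<in> set modes \<Longrightarrow> i < K \<Longrightarrow> ss ! i < G"
  using modes_iff[of q ss] nth_mem[of i ss] by (metis lessThan_iff subsetD)

lemma mode_nxt:
  assumes "(q, ss) \<in> set modes"
  shows "fst (nxt M q ss) < S" "i < K \<Longrightarrow> fst (snd (nxt M q ss) ! i) < G"
  using assms nxt_wf(1,3)[OF wf, of q ss] unfolding modes_iff by blast+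

lemma bounds: "val (env0 w) Bt = 2 * val (env0 w) Tt + val (env0 w) Pt + length w + 10"
    "val (env0 w) Ot = val (env0 w) Tt + 2"
  by (simp_all add: Bt_def Ot_def env0_def)

lemma reads_ok:
  assumes "(q, ss) \<in> set modes" "t < val (env0 w) Bt" "(g, k) \<in> set (reads q ss)"
  shows "key_ok w t p k"
  using assms mode_symbol[OF assms(1)] bounds[of w] tvars_closed
  by (auto simp: reads_def modes_iff intro!: key_ok_Q key_ok_S)

lemma small: "0 < K" "0 < G" "1 < G" "2 < G" "3 < G" "start_state M < S" "accept_state M < S"
  using wf by (auto simp: wf_tm_def)

lemma target0_less: "target0 d < 4"
  by (cases d) (auto simp: target0_def)

lemma source_less: "source d \<le> 1" "target d \<le> 1"
  by (auto simp: source_def target_def)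

lemma schema_vars:
  assumes "s \<in> set schemas"
  shows "fv (fst s) \<subseteq> {0, 5, 6}"
  using assms tvars_closed unfolding schemas_def
  by (auto simp: state_schemas_def write_schemas_def copy_schemas_def init_schemas_def final_schemas_def Let_def)

lemma schema_keys:
  assumes "s \<in> set schemas" "t < val (env0 w) Bt" "p < val (env0 w) Bt" "sem w (inst w t p) (fst s)" "(g, k) \<in> set (snd s)"
  shows "key_ok w t p k"
proof -
  note b = bounds[of w]
  consider "s \<in> set state_schemas" | "s \<in> set write_schemas" | "s \<in> set copy_schemas" | "s \<in> set init_schemas" | "s \<in> set final_schemas"
    using assms(1) unfolding schemas_def by auto
  then show ?thesis
  proof cases
    case 1
    then show ?thesis using assms(2-) reads_ok mode_nxt tvars_closed b
      by (auto simp: state_schemas_def intro!: key_ok_Q)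
  next
    case 2
    then obtain q ss i where *: "(q, ss) \<in> set modes" "i < K" "s = (FLt (plus Time 1) Bt,
     (True, Sk (plus Time 1) i (plus Tt (target0 (snd (snd (nxt M q ss) ! i)))) (fst (snd (nxt M q ss) ! i))) # reads q ss)"
      unfolding write_schemas_def by auto
    then show ?thesis using assms(2-) reads_ok[OF *(1)] mode_nxt[OF *(1)] tvars_closed b target0_less[of "snd (snd (nxt M q ss) ! i)"]
      by (auto intro!: key_ok_S)
  next
    case 3
    then obtain q ss i s' where *: "(q, ss) \<in> set modes" "i < K" "s' < G" "s = (let d = snd (snd (nxt M q ss) ! i) in
     (FConj [FLt (plus Time 1) Bt, FLt (plus Place 1) Bt, FNot (FEq (plus Place (source d)) Ot)],
     [(True, Sk (plus Time 1) i (plus Place (target d)) s'), (False, Sk Time i (plus Place (source d)) s')] @ reads q ss))"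
      unfolding copy_schemas_def by auto
    then show ?thesis using assms(2-) reads_ok[OF *(1)] tvars_closed b source_less[of "snd (snd (nxt M q ss) ! i)"]
      by (auto simp: Let_def intro!: key_ok_S)
  next
    case 4
    then show ?thesis using assms(2-) tvars_closed b small
      by (auto simp: init_schemas_def intro!: key_ok_S key_ok_Q)
  next
    case 5
    then show ?thesis using assms(2-) tvars_closed b
      by (auto simp: final_schemas_def intro!: key_ok_Q)
  qed
qed

end

section \<open>Satisfying assignments and accepting runs\<close>

context tableau
begin

definition col :: "nat list \<Rightarrow> nat \<Rightarrow> nat \<Rightarrow> nat \<Rightarrow> nat" where
  "col w idx t p = (let b = val (env0 w) Bt in 1 + (idx * (b * b) + (t * b + p)))"

lemma val_keys:
  "val (inst w t p) (Qk \<tau> q) = col w q (val (inst w t p) \<tau>) 0"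
  "val (inst w t p) (Sk \<tau> i \<pi> s) = col w (S + i * G + s) (val (inst w t p) \<tau>) (val (inst w t p) \<pi>)"
  by (simp_all add: Qk_def Sk_def key_def col_def Let_def)

definition Q :: "nat list \<Rightarrow> (nat \<Rightarrow> bool) \<Rightarrow> nat \<Rightarrow> nat \<Rightarrow> bool" where
  "Q w a t q \<longleftrightarrow> a (col w q t 0)"

definition C :: "nat list \<Rightarrow> (nat \<Rightarrow> bool) \<Rightarrow> nat \<Rightarrow> nat \<Rightarrow> nat \<Rightarrow> nat \<Rightarrow> bool" where
  "C w a t i p s \<longleftrightarrow> a (col w (S + i * G + s) t p)"

lemma a_keys:
  "a (val (inst w t p) (Qk \<tau> q)) \<longleftrightarrow> Q w a (val (inst w t p) \<tau>) q"
  "a (val (inst w t p) (Sk \<tau> i \<pi> s)) \<longleftrightarrow> C w a (val (inst w t p) \<tau>) i (val (inst w t p) \<pi>) s"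
  by (simp_all add: val_keys Q_def C_def)

definition reading :: "nat list \<Rightarrow> (nat \<Rightarrow> bool) \<Rightarrow> nat \<Rightarrow> nat \<Rightarrow> nat list \<Rightarrow> bool" where
  "reading w a t q ss \<longleftrightarrow> Q w a t q \<and> (\<forall>i<K. C w a t i (val (env0 w) Ot) (ss ! i))"

lemma reads_iff: "(\<exists>(g, k)\<in>set (reads q ss). a (val (inst w t p) k) = g) \<longleftrightarrow> \<not> reading w a t q ss"
  by (auto simp: reads_def reading_def a_keys)

lemma nth_word: "z < length x \<Longrightarrow> encode_pair x y ! z = encode_word x ! z"
  "encode_pair x y ! length x = 3"
  "z < length y \<Longrightarrow> encode_pair x y ! Suc (length x + z) = encode_word y ! z"
  "length (encode_pair x y) = Suc (length x + length y)"
  by (auto simp: encode_pair_def encode_word_def nth_append)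

lemma length_word [simp]: "length (encode_word x) = length x"
  by (simp add: encode_word_def)

lemma sym_at_word: "z < length x \<Longrightarrow> sym_at (encode_word x) z = (if x ! z then 2 else 1)"
  by (simp add: sym_at_def encode_word_def)

lemma nth_encode_word: "z < length x \<Longrightarrow> encode_word x ! z = (if x ! z then 2 else 1)"
  by (simp add: encode_word_def)

lemma val_Ot: "val ((inst w t p)(7 := z)) Ot = val (env0 w) Ot"
  using vars by (auto intro!: val_cong simp: inst_def Ot_def)

lemma rel_init:
  assumes "i < K"
  shows "rel O' (run M v 0) i p = (if i = 0 \<and> O' \<le> p \<and> p < O' + length v then v ! (p - O') else 0)"
proof (cases i)
  case 0
  have "nat (int p - int O') = p - O'" by linarith
  then show ?thesis using 0 by (auto simp: run_def init_config_def rel_def word_contents_def)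
next
  case (Suc j)
  then show ?thesis using assms by (auto simp: run_def init_config_def rel_def word_contents_def)
qed

lemma sound:
  assumes "\<And>s. s \<in> set schemas \<Longrightarrow> schema_holds (encode_word x) (val (env0 (encode_word x)) Bt) s a"
  shows "\<exists>y. length y \<le> val (env0 (encode_word x)) Pt \<and>
    fst (run M (encode_pair x y) (val (env0 (encode_word x)) Tt)) = accept_state M"
proof -
  define w where "w = encode_word x"
  define b where "b = val (env0 w) Bt"
  define T where "T = val (env0 w) Tt"
  define P where "P = val (env0 w) Pt"
  define n where "n = length x"
  define O' where "O' = T + 2"
  have bnd: "b = 2 * T + P + n + 10" "val (env0 w) Ot = O'"
    using bounds[of w] by (simp_all add: b_def T_def P_def n_def O'_def w_def)
  have H: "\<exists>(g, k)\<in>set (snd s). a (val (inst w t p) k) = g"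
    if "s \<in> set schemas" "t < b" "p < b" "sem w (inst w t p) (fst s)" for s t p
    using assms[OF that(1)] that(2-) unfolding schema_holds_def b_def w_def by blast
  note vals = val_closed[of w] b_def[symmetric] T_def[symmetric] P_def[symmetric] bnd(2)
  have len: "length w = n" by (simp add: w_def n_def)
  have state: "Q w a (Suc t) (fst (nxt M q ss))" if "(q, ss) \<in> set modes" "Suc t < b" "reading w a t q ss" for q ss t
  proof -
    let ?s = "(FLt (plus Time 1) Bt, (True, Qk (plus Time 1) (fst (nxt M q ss))) # reads q ss)"
    have "?s \<in> set schemas" using that(1) unfolding schemas_def state_schemas_def by force
    from H[OF this, of t 0] that(2) reads_iff[of q ss a w t 0] that(3) show ?thesis
      by (auto simp: vals a_keys)
  qed
  have writing: "C w a (Suc t) i (T + target0 (snd (snd (nxt M q ss) ! i))) (fst (snd (nxt M q ss) ! i))"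
    if "(q, ss) \<in> set modes" "Suc t < b" "reading w a t q ss" "i < K" for q ss t i
  proof -
    let ?s = "(FLt (plus Time 1) Bt,
     (True, Sk (plus Time 1) i (plus Tt (target0 (snd (snd (nxt M q ss) ! i)))) (fst (snd (nxt M q ss) ! i))) # reads q ss)"
    have "?s \<in> set schemas" using that(1,4) unfolding schemas_def write_schemas_def by force
    from H[OF this, of t 0] that(2) reads_iff[of q ss a w t 0] that(3) show ?thesis
      by (auto simp: vals a_keys)
  qed
  have copying: "C w a (Suc t) i (p + target d) s"
    if "(q, ss) \<in> set modes" "Suc t < b" "reading w a t q ss" "i < K" "s < G" "Suc p < b" "d = snd (snd (nxt M q ss) ! i)"
      "p + source d \<noteq> O'" "C w a t i (p + source d) s" for q ss t i s p d
  proof -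
    let ?s = "let d = snd (snd (nxt M q ss) ! i) in
     (FConj [FLt (plus Time 1) Bt, FLt (plus Place 1) Bt, FNot (FEq (plus Place (source d)) Ot)],
     [(True, Sk (plus Time 1) i (plus Place (target d)) s), (False, Sk Time i (plus Place (source d)) s)] @ reads q ss)"
    have "(((q, ss), i), s) \<in> set (List.product (List.product modes [0..<K]) [0..<G])" using that(1,4,5) by simp
    then have "?s \<in> set schemas" unfolding schemas_def copy_schemas_def by (auto simp: image_iff simp del: set_product)
    from H[OF this, of t p] that(2,6,8,9) that(7)[symmetric] reads_iff[of q ss a w t p] that(3) show ?thesis
      by (auto simp: vals a_keys Let_def)
  qed
  have init: "s \<in> set init_schemas \<Longrightarrow> s \<in> set schemas" for s by (simp add: schemas_def)
  have start: "Q w a 0 (start_state M)"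
    using H[OF init, of "(FConj [], [(True, Qk (TC 0) (start_state M))])" 0 0] bnd by (simp add: init_schemas_def a_keys)
  have other: "C w a 0 i p 0" if "0 < i" "i < K" "p < b" for i p
    using H[OF init, of "(FConj [], [(True, Sk (TC 0) i Place 0)])" 0 p] bnd that by (simp add: init_schemas_def a_keys)
  have outside: "C w a 0 0 p 0" if "p < O' \<or> O' + n + P < p" "p < b" for p
    using H[OF init, of "(FOr (FLt Place Ot) (FLt (TAdd Ot (TAdd Len Pt)) Place), [(True, Sk (TC 0) 0 Place 0)])" 0 p] bnd that
    by (simp add: init_schemas_def a_keys vals len add.assoc)
  have word: "C w a 0 0 (O' + z) (if x ! z then 2 else 1)" if "z < n" for z
  proof -
    have "sem w (inst w 0 (O' + z)) (FEx 7 Len (FAnd (FEq Place (TAdd Ot (TV 7))) (FSym (if x ! z then 2 else 1) (TV 7))))"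
      using that sym_at_word[of z x, folded w_def] by (auto simp: val_Ot bnd(2) len n_def)
    then show ?thesis
      using H[OF init, of "(FEx 7 Len (FAnd (FEq Place (TAdd Ot (TV 7))) (FSym 1 (TV 7))), [(True, Sk (TC 0) 0 Place 1)])" 0 "O' + z"]
        H[OF init, of "(FEx 7 Len (FAnd (FEq Place (TAdd Ot (TV 7))) (FSym 2 (TV 7))), [(True, Sk (TC 0) 0 Place 2)])" 0 "O' + z"]
        bnd that by (cases "x ! z") (simp_all add: init_schemas_def a_keys O'_def del: sem.simps)
  qed
  have sep: "C w a 0 0 (O' + n) 3"
    using H[OF init, of "(FEq Place (TAdd Ot Len), [(True, Sk (TC 0) 0 Place 3)])" 0 "O' + n"] bnd
    by (simp add: init_schemas_def a_keys vals len O'_def)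
  have cert: "C w a 0 0 p 0 \<or> C w a 0 0 p 1 \<or> C w a 0 0 p 2" if "O' + n < p" "p \<le> O' + n + P" for p
    using H[OF init, of "(FAnd (FLt (TAdd Ot Len) Place) (FLe Place (TAdd Ot (TAdd Len Pt))),
       [(True, Sk (TC 0) 0 Place 0), (True, Sk (TC 0) 0 Place 1), (True, Sk (TC 0) 0 Place 2)])" 0 p] bnd that
    by (simp add: init_schemas_def a_keys vals len O'_def)
  have blank: "C w a 0 0 (Suc p) 0" if "O' + n < p" "Suc p < b" "C w a 0 0 p 0" for p
    using H[OF init, of "(FAnd (FLt (TAdd Ot Len) Place) (FLt (plus Place 1) Bt),
       [(True, Sk (TC 0) 0 (plus Place 1) 0), (False, Sk (TC 0) 0 Place 0)])" 0 p] bnd that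
    by (simp add: init_schemas_def a_keys vals len O'_def)
  \<comment> \<open>The certificate ends at its first blank, or after \<open>P\<close> cells if
    there is none.\<close>
  define m where "m = (LEAST m. m = P \<or> C w a 0 0 (Suc (O' + n + m)) 0)"
  have m: "m = P \<or> C w a 0 0 (Suc (O' + n + m)) 0" unfolding m_def by (rule LeastI[of _ P]) simp
  have mP: "m \<le> P" unfolding m_def by (rule Least_le) simp
  have before: "\<not> C w a 0 0 (Suc (O' + n + z)) 0" if "z < m" for z
    using not_less_Least[of z] that unfolding m_def by blast
  have after: "C w a 0 0 (Suc (O' + n + m + d)) 0" if "m < P" "Suc (O' + n + m + d) < b" for d
    using that(2)
  proof (induction d)
    case 0
    then show ?case using m that(1) by simp
  next
    case (Suc d)
    then show ?case using blank[of "Suc (O' + n + m + d)"] by simp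
  qed
  \<comment> \<open>Before the first blank each cell has 1 or 2 true. If both are, 2 is taken, which
    agrees with \<open>a\<close> as well.\<close>
  define y where "y = map (\<lambda>z. C w a 0 0 (Suc (O' + n + z)) 2) [0..<m]"
  define v where "v = encode_pair x y"
  have ylen: "length y = m" by (simp add: y_def)
  have vlen: "length v = Suc (n + m)" using nth_word(4)[of x y] by (simp add: v_def ylen n_def)
  have tape0: "C w a 0 0 p (rel O' (run M v 0) 0 p)" if p: "p < b" for p
  proof -
    have r: "rel O' (run M v 0) 0 p = (if O' \<le> p \<and> p < O' + length v then v ! (p - O') else 0)"
      using rel_init[of 0 O' v p] small(1) by simp
    consider "p < O'" | z where "p = O' + z" "z < n" | "p = O' + n" | z where "p = Suc (O' + n + z)" "z < m"
      | "Suc (O' + n + m) \<le> p"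
    proof -
      have "p < O' \<or> p = O' + (p - O') \<and> p - O' < n \<or> p = O' + n \<or>
          p = Suc (O' + n + (p - Suc (O' + n))) \<and> p - Suc (O' + n) < m \<or> Suc (O' + n + m) \<le> p" by linarith
      then show thesis using that by blast
    qed
    then show ?thesis
    proof cases
      case 1
      then show ?thesis unfolding r using outside p by simp
    next
      case (2 z)
      then show ?thesis unfolding r using word[of z] nth_word(1)[of z x y, folded v_def] nth_encode_word[of z x] by (simp add: vlen n_def)
    next
      case 3
      then show ?thesis unfolding r using sep nth_word(2)[of x y, folded v_def] by (simp add: vlen n_def)
    next
      case (4 z)
      have "C w a 0 0 p 0 \<or> C w a 0 0 p 1 \<or> C w a 0 0 p 2" using cert[of p] 4 mP by simp
      moreover have "v ! (p - O') = (if y ! z then 2 else 1)"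
        using 4 nth_word(3)[of z y x] nth_encode_word[of z y] by (simp add: v_def n_def ylen)
      moreover have "y ! z = C w a 0 0 p 2" using 4 by (simp add: y_def)
      ultimately show ?thesis unfolding r using before[of z] 4 by (auto simp: vlen)
    next
      case 5
      define d where "d = p - Suc (O' + n + m)"
      have d: "p = Suc (O' + n + m + d)" using 5 by (simp add: d_def)
      have "C w a 0 0 p 0"
      proof (cases "m < P")
        case True
        then show ?thesis using after[of d] d p by simp
      next
        case False
        then show ?thesis using outside[of p] d p mP by simp
      qed
      then show ?thesis unfolding r using d by (simp add: vlen)
    qed
  qed
  have v4: "z < 4" if "z \<in> set v" for z
    using that by (auto simp: v_def encode_pair_def encode_word_def split: if_splits)
  have wfc: "wf_config M (run M v t)" for t using wf_config_run[OF wf v4] .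
  \<comment> \<open>The region in which \<open>a\<close> is known to contain the run shrinks by one
    place per step on either side.\<close>
  have inv: "Q w a t (fst (run M v t)) \<and> (\<forall>i<K. \<forall>p. t \<le> p \<and> p + t < b \<longrightarrow> C w a t i p (rel O' (run M v t) i p))"
    if "t \<le> T" for t
    using that
  proof (induction t)
    case 0
    have "C w a 0 i p (rel O' (run M v 0) i p)" if "i < K" "p < b" for i p
    proof (cases "i = 0")
      case True
      then show ?thesis using tape0 that by simp
    next
      case False
      then show ?thesis using other[of i p] rel_init[of i O' v p] that by simp
    qed
    then show ?case using start by (simp add: run_def init_config_def)
  next
    case (Suc t)
    let ?c = "run M v t"
    let ?q = "fst ?c" and ?ss = "map read_tape (snd ?c)"
    have IH: "Q w a t ?q" "\<And>i p. i < K \<Longrightarrow> t \<le> p \<Longrightarrow> p + t < b \<Longrightarrow> C w a t i p (rel O' ?c i p)" using Suc by auto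
    have step: "run M v (Suc t) = step M ?c" by (simp add: run_def)
    have tb: "Suc t < b" using Suc.prems bnd by simp
    have lenc: "length (snd ?c) = K" using wfc[of t] by (simp add: wf_config_def)
    have mode: "(?q, ?ss) \<in> set modes"
      using wfc[of t] wf_config_symbols[OF wfc[of t]] unfolding modes_iff by (simp add: wf_config_def)
    have reading: "reading w a t ?q ?ss" unfolding reading_def bnd(2)
    proof (intro conjI allI impI)
      fix i assume i: "i < K"
      then have "?ss ! i = rel O' ?c i O'" using read_tape_rel[of i ?c O'] lenc by simp
      then show "C w a t i O' (?ss ! i)" using IH(2)[of i O'] i Suc.prems bnd by (simp add: O'_def)
    qed (rule IH(1))
    have "Q w a (Suc t) (fst (run M v (Suc t)))" using state[OF mode tb reading] unfolding step step_nxt by simp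
    moreover have "C w a (Suc t) i p (rel O' (run M v (Suc t)) i p)" if i: "i < K" and p: "Suc t \<le> p" "p + Suc t < b" for i p
    proof -
      obtain s d where sd: "snd (nxt M ?q ?ss) ! i = (s, d)" by (cases "snd (nxt M ?q ?ss) ! i")
      note rs = rel_step[where O' = O', OF wf wfc[of t] i sd]
      show ?thesis
      proof (cases "int p + offset d = int O'")
        case True
        then have "p = T + target0 d" by (cases d) (auto simp: target0_def O'_def)
        then show ?thesis using rs(2)[of p] True writing[OF mode tb reading i] unfolding step sd by simp
      next
        case False
        define p0 where "p0 = p - target d"
        have e: "p = p0 + target d" "int (p0 + source d) = int p + offset d" "Suc p0 < b" "t \<le> p0 + source d" "p0 + source d + t < b"
          using p by (cases d; simp add: p0_def target_def source_def)+
        have ne: "p0 + source d \<noteq> O'" using False e(2) by simp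
        have r: "rel O' (run M v (Suc t)) i p = rel O' ?c i (p0 + source d)" unfolding step using rs(1)[OF e(2) ne] .
        have "rel O' ?c i (p0 + source d) < G" using wfc[of t] i by (simp add: wf_config_def rel_def)
        then have "C w a (Suc t) i (p0 + target d) (rel O' ?c i (p0 + source d))"
          using copying[OF mode tb reading i _ e(3) _ ne] IH(2)[OF i e(4,5)] sd by simp
        then show ?thesis unfolding r e(1)[symmetric] .
      qed
    qed
    ultimately show ?case by blast
  qed
  have "fst (run M v T) = accept_state M"
  proof (rule ccontr)
    assume na: "fst (run M v T) \<noteq> accept_state M"
    have "fst (run M v T) < S" using wfc[of T] by (simp add: wf_config_def)
    then have "(FConj [], [(False, Qk Tt (fst (run M v T)))]) \<in> set schemas" using na by (auto simp: schemas_def final_schemas_def)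
    from H[OF this, of 0 0] bnd have "\<not> Q w a T (fst (run M v T))" by (simp add: a_keys vals)
    then show False using inv[of T] by simp
  qed
  then show ?thesis using ylen mP unfolding v_def T_def P_def w_def by blast
qed

text \<open>The assignment records the actual run: a variable is true if the state or symbol it
  names occurs at the named time and place.\<close>

lemma complete:
  assumes y: "length y \<le> val (env0 (encode_word x)) Pt"
    and acc: "fst (run M (encode_pair x y) (val (env0 (encode_word x)) Tt)) = accept_state M"
  shows "\<exists>a. \<forall>s\<in>set schemas. schema_holds (encode_word x) (val (env0 (encode_word x)) Bt) s a"
proof -
  define w where "w = encode_word x"
  define b where "b = val (env0 w) Bt"
  define T where "T = val (env0 w) Tt"
  define P where "P = val (env0 w) Pt"
  define n where "n = length x"
  define O' where "O' = T + 2"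
  have bnd: "b = 2 * T + P + n + 10" "val (env0 w) Ot = O'"
    using bounds[of w] by (simp_all add: b_def T_def P_def n_def O'_def w_def)
  note vals = val_closed[of w] b_def[symmetric] T_def[symmetric] P_def[symmetric] bnd(2)
  have len: "length w = n" by (simp add: w_def n_def)
  define v where "v = encode_pair x y"
  define r where "r t = run M v t" for t
  have v4: "z < 4" if "z \<in> set v" for z
    using that by (auto simp: v_def encode_pair_def encode_word_def split: if_splits)
  have wfc: "wf_config M (r t)" for t unfolding r_def using wf_config_run[OF wf v4] .
  have yP: "length y \<le> P" using y by (simp add: P_def w_def)
  have vlen: "length v = Suc (n + length y)" using nth_word(4)[of x y] by (simp add: v_def n_def)
  define truth where "truth idx t p \<longleftrightarrow> (if idx < S then fst (r t) = idx else rel O' (r t) ((idx - S) div G) p = (idx - S) mod G)"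
    for idx t p
  \<comment> \<open>This undoes the numbering \<open>col\<close>.\<close>
  define a where "a m = truth ((m - 1) div (b * b)) ((m - 1) mod (b * b) div b) ((m - 1) mod (b * b) mod b)" for m
  have a: "a (col w idx t p) = truth idx t p" if "t < b" "p < b" for idx t p
  proof -
    have "t * b + p < b * b" using mult_right_mono[of "Suc t" b b] that by simp
    from divmod_pair[OF this, of idx] divmod_pair[OF that(2), of t] show ?thesis
      unfolding a_def by (simp add: col_def Let_def b_def[symmetric])
  qed
  have Q: "Q w a t q \<longleftrightarrow> fst (r t) = q" if "t < b" "q < S" for t q
    unfolding Q_def using a[OF that(1), of 0] that bnd by (simp add: truth_def)
  have C: "C w a t i p s \<longleftrightarrow> rel O' (r t) i p = s" if "t < b" "p < b" "s < G" for t i p s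
    unfolding C_def using a[OF that(1,2)] divmod_pair[OF that(3), of i] by (simp add: truth_def add.assoc)
  have holds: "schema_holds w b s a"
    if "\<And>t p. t < b \<Longrightarrow> p < b \<Longrightarrow> sem w (inst w t p) (fst s) \<Longrightarrow> \<exists>(g, k)\<in>set (snd s). a (val (inst w t p) k) = g" for s
    unfolding schema_holds_def using that by blast
  have reading: "ss = map read_tape (snd (r t)) \<and> q = fst (r t)" if "reading w a t q ss" "(q, ss) \<in> set modes" "t < b" for q ss t
  proof -
    have lenc: "length (snd (r t)) = K" using wfc[of t] by (simp add: wf_config_def)
    have "ss ! i = map read_tape (snd (r t)) ! i" if "i < K" for i
    proof -
      have "C w a t i O' (ss ! i)" using \<open>reading w a t q ss\<close> that bnd(2) by (simp add: reading_def)
      then show ?thesis using C[OF \<open>t < b\<close>, of O'] mode_symbol[OF \<open>(q, ss) \<in> set modes\<close> that] bnd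
        read_tape_rel[of i "r t" O'] lenc that by (simp add: O'_def)
    qed
    then have "ss = map read_tape (snd (r t))" using that(2) lenc by (intro nth_equalityI) (auto simp: modes_iff)
    moreover have "q = fst (r t)" using Q[OF that(3), of q] that(1,2) by (auto simp: modes_iff reading_def)
    ultimately show ?thesis ..
  qed
  have rstep: "r (Suc t) = step M (r t)" for t by (simp add: r_def run_def)
  have state: "schema_holds w b s a" if s: "s \<in> set state_schemas" for s
  proof -
    obtain q ss where *: "(q, ss) \<in> set modes" "s = (FLt (plus Time 1) Bt, (True, Qk (plus Time 1) (fst (nxt M q ss))) # reads q ss)"
      using s unfolding state_schemas_def by auto
    show ?thesis
    proof (rule holds)
      fix t p assume t: "t < b" "sem w (inst w t p) (fst s)"
      then have t': "Suc t < b" using * by (simp add: vals)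
      have "Q w a (Suc t) (fst (nxt M q ss))" if "reading w a t q ss"
        using reading[OF that *(1) t(1)] Q[OF t' mode_nxt(1)[OF *(1)]] by (simp add: rstep step_nxt)
      then show "\<exists>(g, k)\<in>set (snd s). a (val (inst w t p) k) = g"
        using reads_iff[of q ss a w t p] *(2) by (auto simp: a_keys)
    qed
  qed
  have writing: "schema_holds w b s a" if s: "s \<in> set write_schemas" for s
  proof -
    obtain q ss i where *: "(q, ss) \<in> set modes" "i < K" "s = (FLt (plus Time 1) Bt,
     (True, Sk (plus Time 1) i (plus Tt (target0 (snd (snd (nxt M q ss) ! i)))) (fst (snd (nxt M q ss) ! i))) # reads q ss)"
      using s unfolding write_schemas_def by auto
    obtain s' d where sd: "snd (nxt M q ss) ! i = (s', d)" by (cases "snd (nxt M q ss) ! i")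
    show ?thesis
    proof (rule holds)
      fix t p assume t: "t < b" "sem w (inst w t p) (fst s)"
      then have t': "Suc t < b" using * by (simp add: vals)
      have "C w a (Suc t) i (T + target0 d) s'" if "reading w a t q ss"
      proof -
        have e: "ss = map read_tape (snd (r t))" "q = fst (r t)" using reading[OF that *(1) t(1)] by auto
        have "int (T + target0 d) + offset d = int O'" by (cases d) (auto simp: target0_def O'_def)
        then have "rel O' (r (Suc t)) i (T + target0 d) = s'"
          using rel_step(2)[OF wf wfc[of t] *(2) sd[unfolded e]] rstep by simp
        moreover have "s' < G" using mode_nxt(2)[OF *(1,2)] sd by simp
        ultimately show ?thesis using C[OF t', of "T + target0 d" s' i] bnd target0_less[of d] by simp
      qed
      then show "\<exists>(g, k)\<in>set (snd s). a (val (inst w t p) k) = g"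
        using reads_iff[of q ss a w t p] *(3) sd by (auto simp: a_keys vals)
    qed
  qed
  have copying: "schema_holds w b s a" if s: "s \<in> set copy_schemas" for s
  proof -
    obtain q ss i s' where *: "(q, ss) \<in> set modes" "i < K" "s' < G" "s = (let d = snd (snd (nxt M q ss) ! i) in
     (FConj [FLt (plus Time 1) Bt, FLt (plus Place 1) Bt, FNot (FEq (plus Place (source d)) Ot)],
     [(True, Sk (plus Time 1) i (plus Place (target d)) s'), (False, Sk Time i (plus Place (source d)) s')] @ reads q ss))"
      using s unfolding copy_schemas_def by auto
    obtain s'' d where sd: "snd (nxt M q ss) ! i = (s'', d)" by (cases "snd (nxt M q ss) ! i")
    show ?thesis
    proof (rule holds)
      fix t p assume t: "t < b" "p < b" "sem w (inst w t p) (fst s)"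
      then have t': "Suc t < b" "Suc p < b" "p + source d \<noteq> O'" using * sd by (simp_all add: vals Let_def)
      have "C w a (Suc t) i (p + target d) s'" if "reading w a t q ss" "C w a t i (p + source d) s'"
      proof -
        have e: "ss = map read_tape (snd (r t))" "q = fst (r t)" using reading[OF that(1) *(1) t(1)] by auto
        have "int (p + source d) = int (p + target d) + offset d" by (cases d) (auto simp: target_def source_def)
        then have "rel O' (r (Suc t)) i (p + target d) = rel O' (r t) i (p + source d)"
          using rel_step(1)[OF wf wfc[of t] *(2) sd[unfolded e]] rstep t'(3) by simp
        moreover have "p + source d < b" "p + target d < b" using source_less[of d] t'(2) by auto
        ultimately show ?thesis using C[OF t'(1), of "p + target d" s' i] C[OF t(1), of "p + source d" s' i] that(2) *(3) by simp
      qed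
      then show "\<exists>(g, k)\<in>set (snd s). a (val (inst w t p) k) = g"
        using reads_iff[of q ss a w t p] *(4) sd by (auto simp: a_keys vals Let_def)
    qed
  qed
  have b0: "0 < b" using bnd by simp
  have rel0: "rel O' (r 0) i p = (if i = 0 \<and> O' \<le> p \<and> p < O' + length v then v ! (p - O') else 0)" if "i < K" for i p
    unfolding r_def using rel_init[OF that] .
  have word: "C w a 0 0 p (if x ! z then 2 else 1)" if "p = O' + z" "z < n" "p < b" for p z
    using C[OF b0 that(3), of "if x ! z then 2 else 1" 0] rel0[of 0 p] small that nth_word(1)[of z x y] nth_encode_word[of z x]
    by (simp add: nth_word(4) v_def n_def)
  have init: "schema_holds w b s a" if "s \<in> set init_schemas" for s
  proof (rule holds)
    fix t p assume t: "t < b" "p < b" "sem w (inst w t p) (fst s)"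
    have sy: "sym_at w z = (if x ! z then 2 else 1)" if "z < n" for z using sym_at_word[of z x] that by (simp add: w_def n_def)
    have "s \<in> (\<lambda>i. (FConj [], [(True, Sk (TC 0) i Place 0)])) ` set [1..<K] \<union>
      {(FConj [], [(True, Qk (TC 0) (start_state M))]),
       (FOr (FLt Place Ot) (FLt (TAdd Ot (TAdd Len Pt)) Place), [(True, Sk (TC 0) 0 Place 0)]),
       (FEx 7 Len (FAnd (FEq Place (TAdd Ot (TV 7))) (FSym 1 (TV 7))), [(True, Sk (TC 0) 0 Place 1)]),
       (FEx 7 Len (FAnd (FEq Place (TAdd Ot (TV 7))) (FSym 2 (TV 7))), [(True, Sk (TC 0) 0 Place 2)]),
       (FEq Place (TAdd Ot Len), [(True, Sk (TC 0) 0 Place 3)]),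
       (FAnd (FLt (TAdd Ot Len) Place) (FLe Place (TAdd Ot (TAdd Len Pt))),
         [(True, Sk (TC 0) 0 Place 0), (True, Sk (TC 0) 0 Place 1), (True, Sk (TC 0) 0 Place 2)]),
       (FAnd (FLt (TAdd Ot Len) Place) (FLt (plus Place 1) Bt),
         [(True, Sk (TC 0) 0 (plus Place 1) 0), (False, Sk (TC 0) 0 Place 0)])}"
      using that unfolding init_schemas_def set_append set_map list.set .
    then show "\<exists>(g, k)\<in>set (snd s). a (val (inst w t p) k) = g"
    proof (elim UnE imageE insertE emptyE, goal_cases)
      case (1 i)
      then show ?thesis using C[OF b0 t(2), of 0 i] rel0[of i p] small by (simp add: a_keys)
    next
      case 2
      then show ?thesis using Q[OF b0 small(6)] by (simp add: a_keys r_def run_def init_config_def)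
    next
      case 3
      then show ?thesis using C[OF b0 t(2), of 0 0] rel0[of 0 p] small t(3) yP by (auto simp: a_keys vals len vlen)
    next
      case 4
      obtain z where "p = O' + z" "z < n" "sym_at w z = 1" using 4 t(3) by (auto simp: val_Ot bnd(2) len)
      then show ?thesis using word[of p z] sy[of z] 4 t(2) by (simp add: a_keys split: if_splits)
    next
      case 5
      obtain z where "p = O' + z" "z < n" "sym_at w z = 2" using 5 t(3) by (auto simp: val_Ot bnd(2) len)
      then show ?thesis using word[of p z] sy[of z] 5 t(2) by (simp add: a_keys split: if_splits)
    next
      case 6
      then show ?thesis using C[OF b0 t(2), of 3 0] rel0[of 0 p] small t(3) nth_word(2)[of x y, folded v_def n_def]
        by (auto simp: a_keys vals len vlen)
    next
      case 7
      have "rel O' (r 0) 0 p \<in> {0, 1, 2}"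
      proof (cases "p < O' + length v")
        case True
        define z where "z = p - Suc (O' + n)"
        have z: "p = Suc (O' + n + z)" using 7 t(3) by (simp add: vals len z_def)
        have "z < length y" using z True vlen by simp
        then have "v ! (p - O') = (if y ! z then 2 else 1)"
          using z nth_word(3)[of z y x] nth_encode_word[of z y] by (simp add: v_def n_def)
        then show ?thesis using rel0[of 0 p] small(1) by simp
      next
        case False
        then show ?thesis using rel0[of 0 p] small(1) by simp
      qed
      then show ?thesis using C[OF b0 t(2), of 0 0] C[OF b0 t(2), of 1 0] C[OF b0 t(2), of 2 0] small 7 by (auto simp: a_keys)
    next
      case 8
      have p: "O' + n < p" "Suc p < b" using 8 t(3) by (simp_all add: vals len)
      have "rel O' (r 0) 0 (Suc p) = 0" if "rel O' (r 0) 0 p = 0"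
      proof (cases "p < O' + length v")
        case True
        define z where "z = p - Suc (O' + n)"
        have z: "p = Suc (O' + n + z)" using p by (simp add: z_def)
        have "z < length y" using z True vlen by simp
        then have "v ! (p - O') = (if y ! z then 2 else 1)"
          using z nth_word(3)[of z y x] nth_encode_word[of z y] by (simp add: v_def n_def)
        then show ?thesis using rel0[of 0 p] small(1) that True z by (simp split: if_splits)
      next
        case False
        then show ?thesis using rel0[of 0 "Suc p"] small(1) by simp
      qed
      then show ?thesis using C[OF b0 t(2), of 0 0] C[OF b0 p(2), of 0 0] small 8 by (auto simp: a_keys)
    qed
  qed
  have final: "schema_holds w b s a" if s: "s \<in> set final_schemas" for s
  proof (rule holds)
    fix t p
    obtain q where q: "s = (FConj [], [(False, Qk Tt q)])" "q < S" "q \<noteq> accept_state M"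
      using s unfolding final_schemas_def by auto
    have "\<not> Q w a T q" using Q[of T q] acc q bnd by (auto simp: r_def v_def T_def w_def)
    then show "\<exists>(g, k)\<in>set (snd s). a (val (inst w t p) k) = g" using q by (simp add: a_keys vals)
  qed
  show ?thesis using state writing copying init final unfolding schemas_def w_def[symmetric] b_def[symmetric]
    by (intro exI[of _ a] ballI) (simp only: set_append Un_iff, blast)
qed

theorem schemas_iff:
  "(\<exists>a. \<forall>s\<in>set schemas. schema_holds (encode_word x) (val (env0 (encode_word x)) Bt) s a) \<longleftrightarrow>
   (\<exists>y. length y \<le> val (env0 (encode_word x)) Pt \<and>
      fst (run M (encode_pair x y) (val (env0 (encode_word x)) Tt)) = accept_state M)"
  using sound[of x] complete[of _ x] by blast

lemma tvars_keys: "tvars (Qk \<tau> q) = tvars Bt \<union> tvars \<tau>" "tvars (Sk \<tau> i \<pi> s) = tvars Bt \<union> tvars \<tau> \<union> tvars \<pi>"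
  by (auto simp: Qk_def Sk_def key_def)

lemma schema_literal_vars: "s \<in> set schemas \<Longrightarrow> \<forall>l\<in>set (snd s). tvars (snd l) \<subseteq> {0, 5, 6}"
proof -
  have r: "\<forall>l\<in>set (reads q ss). tvars (snd l) \<subseteq> {0, 5, 6}" for q ss
    using tvars_closed by (simp add: reads_def tvars_keys)
  have "\<forall>s\<in>set schemas. \<forall>l\<in>set (snd s). tvars (snd l) \<subseteq> {0, 5, 6}"
    unfolding schemas_def set_append ball_Un
    using r tvars_closed
    by (simp add: tvars_keys state_schemas_def write_schemas_def copy_schemas_def init_schemas_def final_schemas_def
      Let_def split_beta ball_Un del: set_product)
  then show "s \<in> set schemas \<Longrightarrow> \<forall>l\<in>set (snd s). tvars (snd l) \<subseteq> {0, 5, 6}" by (rule bspec)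
qed

lemma schema_table_schemas: "schema_table w Bt Nt schemas"
proof
  show "tvars Bt \<subseteq> {0}" "tvars Nt \<subseteq> {0}" using vars by (auto simp: Nt_def Bt_def)
  show "fv (fst s) \<subseteq> {0, 5, 6}" if "s \<in> set schemas" for s using schema_vars[OF that] .
  show "tvars k \<subseteq> {0, 5, 6}" if "s \<in> set schemas" "(g, k) \<in> set (snd s)" for s g k
    using schema_literal_vars[OF that(1)] that(2) by force
  show "0 < val (inst w t p) k \<and> val (inst w t p) k \<le> val (env0 w) Nt"
    if "s \<in> set schemas" "t < val (env0 w) Bt" "p < val (env0 w) Bt" "sem w (inst w t p) (fst s)" "(g, k) \<in> set (snd s)"
    for s t p g k
    using schema_keys[OF that] unfolding key_ok_def by blast
qed

end

section \<open>Hardness\<close>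

lemma length_encode_graph: "length (encode_graph n E) = n * n"
  unfolding encode_graph_def by (simp add: length_concat o_def sum_list_triv)

lemma nth_concat_rows: "i < n \<Longrightarrow> j < m \<Longrightarrow> concat (map (\<lambda>i. map (E i) [0..<m]) [0..<n]) ! (i * m + j) = E i j"
proof (induction n)
  case (Suc n)
  let ?c = "concat (map (\<lambda>i. map (E i) [0..<m]) [0..<n])"
  have len: "length ?c = n * m" by (simp add: length_concat o_def sum_list_triv)
  show ?case
  proof (cases "i < n")
    case True
    have "i * m + j < n * m" using mult_right_mono[of "Suc i" n m] True Suc.prems(2) by simp
    then show ?thesis using Suc.IH[OF True Suc.prems(2)] len by (simp add: nth_append)
  next
    case False
    then have "i = n" using Suc.prems(1) by simp
    then show ?thesis using len Suc.prems(2) by (simp add: nth_append)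
  qed
qed simp

lemma nth_encode_graph: "i < n \<Longrightarrow> j < n \<Longrightarrow> encode_graph n E ! (i * n + j) = E i j"
  unfolding encode_graph_def by (rule nth_concat_rows)

lemma encode_graph_eq:
  assumes "encode_graph n E = encode_graph n' E'"
  shows "n = n'" "i < n \<Longrightarrow> j < n \<Longrightarrow> E i j = E' i j"
proof -
  have "n * n = n' * n'" using arg_cong[OF assms, of length] by (simp add: length_encode_graph)
  then show n: "n = n'" by (metis power2_eq_square power2_eq_imp_eq zero_le)
  show "E i j = E' i j" if "i < n" "j < n" using nth_encode_graph[OF that, of E] nth_encode_graph[OF that, of E'] assms n by simp
qed

lemma graph_cong:
  assumes "\<And>i j. i \<in> V \<Longrightarrow> j \<in> V \<Longrightarrow> E i j = E' i j"
  shows "unit_d_interval_graph d V E = unit_d_interval_graph d V E'" "simple_graph V E = simple_graph V E'"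
    "max_degree_le k V E = max_degree_le k V E'"
proof -
  show "unit_d_interval_graph d V E = unit_d_interval_graph d V E'" "simple_graph V E = simple_graph V E'"
    unfolding unit_d_interval_graph_def simple_graph_def using assms by (auto cong: ball_cong)
  have "{u \<in> V. E v u} = {u \<in> V. E' v u}" if "v \<in> V" for v using assms that by blast
  then show "max_degree_le k V E = max_degree_le k V E'" unfolding max_degree_le_def degree_in_def by simp
qed

lemma encode_graph_recognition:
  "encode_graph n E \<in> unit_2_interval_recognition \<longleftrightarrow> simple_graph {..<n} E \<and> unit_d_interval_graph 2 {..<n} E"
  "encode_graph n E \<in> unit_2_interval_recognition_max_degree k \<longleftrightarrow>
     simple_graph {..<n} E \<and> max_degree_le k {..<n} E \<and> unit_d_interval_graph 2 {..<n} E"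
proof -
  have c: "(simple_graph {..<n} E \<longleftrightarrow> simple_graph {..<n'} E') \<and> (max_degree_le k {..<n} E \<longleftrightarrow> max_degree_le k {..<n'} E') \<and>
      (unit_d_interval_graph 2 {..<n} E \<longleftrightarrow> unit_d_interval_graph 2 {..<n'} E')"
    if "encode_graph n E = encode_graph n' E'" for n' E'
    using encode_graph_eq(1)[OF that] graph_cong[of "{..<n}" E E'] encode_graph_eq(2)[OF that] by auto
  show "encode_graph n E \<in> unit_2_interval_recognition \<longleftrightarrow> simple_graph {..<n} E \<and> unit_d_interval_graph 2 {..<n} E"
    unfolding unit_2_interval_recognition_def using c by blast
  show "encode_graph n E \<in> unit_2_interval_recognition_max_degree k \<longleftrightarrow>
     simple_graph {..<n} E \<and> max_degree_le k {..<n} E \<and> unit_d_interval_graph 2 {..<n} E"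
    unfolding unit_2_interval_recognition_max_degree_def using c by blast
qed

lemma graph_transfer:
  assumes h: "bij_betw h V V'" and E: "\<And>u v. u \<in> V \<Longrightarrow> v \<in> V \<Longrightarrow> E' (h u) (h v) \<longleftrightarrow> E u v"
  shows "unit_d_interval_graph d V E \<longleftrightarrow> unit_d_interval_graph d V' E'"
    "simple_graph V E \<Longrightarrow> simple_graph V' E'" "max_degree_le k V E \<Longrightarrow> max_degree_le k V' E'"
proof -
  have img: "V' = h ` V" and inj: "inj_on h V" using h by (auto simp: bij_betw_def)
  show "unit_d_interval_graph d V E \<longleftrightarrow> unit_d_interval_graph d V' E'"
  proof
    assume "unit_d_interval_graph d V E"
    then obtain \<phi> where \<phi>: "\<forall>v\<in>V. unit_d_interval d (\<phi> v)" "\<forall>u\<in>V. \<forall>v\<in>V. u \<noteq> v \<longrightarrow> (E u v \<longleftrightarrow> \<phi> u \<inter> \<phi> v \<noteq> {})"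
      unfolding unit_d_interval_graph_def by blast
    have g: "the_inv_into V h (h v) = v" if "v \<in> V" for v using the_inv_into_f_f[OF inj that] .
    have "E' (h u) (h v) \<longleftrightarrow> \<phi> u \<inter> \<phi> v \<noteq> {}" if "u \<in> V" "v \<in> V" "h u \<noteq> h v" for u v
      using \<phi>(2)[rule_format, OF that(1,2)] that(3) E[OF that(1,2)] by blast
    then show "unit_d_interval_graph d V' E'" unfolding unit_d_interval_graph_def img
      by (intro exI[of _ "\<lambda>v. \<phi> (the_inv_into V h v)"]) (simp add: g \<phi>(1))
  next
    assume "unit_d_interval_graph d V' E'"
    then obtain \<phi> where \<phi>: "\<forall>v\<in>V'. unit_d_interval d (\<phi> v)" "\<forall>u\<in>V'. \<forall>v\<in>V'. u \<noteq> v \<longrightarrow> (E' u v \<longleftrightarrow> \<phi> u \<inter> \<phi> v \<noteq> {})"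
      unfolding unit_d_interval_graph_def by blast
    have "E u v \<longleftrightarrow> \<phi> (h u) \<inter> \<phi> (h v) \<noteq> {}" if "u \<in> V" "v \<in> V" "u \<noteq> v" for u v
    proof -
      have "h u \<noteq> h v" using inj_onD[OF inj] that by blast
      then show ?thesis using \<phi>(2)[rule_format, of "h u" "h v"] E[OF that(1,2)] that img by blast
    qed
    then show "unit_d_interval_graph d V E" unfolding unit_d_interval_graph_def
      by (intro exI[of _ "\<lambda>v. \<phi> (h v)"]) (simp add: \<phi>(1) img[symmetric] imageI[of _ V h, folded img])
  qed
  show "simple_graph V' E'" if "simple_graph V E" using that E unfolding simple_graph_def img by auto
  show "max_degree_le k V' E'" if "max_degree_le k V E"
    unfolding max_degree_le_def degree_in_def img
  proof
    fix v' assume "v' \<in> h ` V"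
    then obtain v where v: "v \<in> V" "v' = h v" by blast
    have "{u \<in> h ` V. E' v' u} = h ` {u \<in> V. E v u}" using v E by auto
    then have "card {u \<in> h ` V. E' v' u} = card {u \<in> V. E v u}"
      using inj by (simp add: card_image inj_on_def)
    then show "card {u \<in> h ` V. E' v' u} \<le> k" using that v(1) unfolding max_degree_le_def degree_in_def by simp
  qed
qed

definition num :: "nat \<Rightarrow> vertex \<Rightarrow> nat" where
  "num N v = (case v of (c, j, t) \<Rightarrow> 24 * (c * N + j) + t)"

lemma num_bij: "bij_betw (num N) (verts C N) {..<24 * (C * N)}"
proof (rule bij_betwI[where g = "\<lambda>m. (m div 24 div N, m div 24 mod N, m mod 24)"])
  have lt: "24 * (c * N + j) + t < 24 * (C * N)" if "c < C" "j < N" "t < 24" for c j t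
  proof -
    have "c * N + j < C * N" using mult_right_mono[of "Suc c" C N] that by simp
    moreover have "24 * x + t < 24 * y" if "x < y" for x y :: nat using that \<open>t < 24\<close> by presburger
    ultimately show ?thesis by blast
  qed
  show "num N \<in> verts C N \<rightarrow> {..<24 * (C * N)}" using lt by (auto simp: num_def verts_def)
  show "(\<lambda>m. (m div 24 div N, m div 24 mod N, m mod 24)) \<in> {..<24 * (C * N)} \<rightarrow> verts C N"
  proof
    fix m assume m: "m \<in> {..<24 * (C * N)}"
    then have "m div 24 < C * N" by (simp add: less_mult_imp_div_less mult.commute)
    moreover have "0 < N" using m by (cases N) auto
    ultimately show "(m div 24 div N, m div 24 mod N, m mod 24) \<in> verts C N"
      by (simp add: verts_def less_mult_imp_div_less)
  qed
  show "(num N v div 24 div N, num N v div 24 mod N, num N v mod 24) = v" if v_in: "v \<in> verts C N" for v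
  proof -
    obtain c j t where v: "v = (c, j, t)" "j < N" "t < 24" using v_in by (auto simp: verts_def)
    have "(24 * (c * N + j) + t) div 24 = c * N + j" "(24 * (c * N + j) + t) mod 24 = t"
      using divmod_pair[OF v(3), of "c * N + j"] by (simp_all only: mult.commute[of 24])
    then show ?thesis using divmod_pair[OF v(2), of c] v by (simp add: num_def)
  qed
  show "num N (m div 24 div N, m div 24 mod N, m mod 24) = m" if "m \<in> {..<24 * (C * N)}" for m
    unfolding num_def prod.case div_mult_mod_eq by (rule mult_div_mod_eq)
qed

section \<open>The adjacency relation as a formula\<close>

definition fixed_edge :: "nat \<Rightarrow> nat \<Rightarrow> bool" where
  "fixed_edge t t' \<longleftrightarrow>
     (t, t') \<in> {(0, 2), (0, 4), (0, 3), (1, 5), (1, 3), (3, 4), (4, 6), (5, 7), (0, 9), (0, 13), (1, 17), (1, 21)} \<or>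
     8 \<le> t \<and> 8 \<le> t' \<and> k44 (t - 8) (t' - 8) \<or> 16 \<le> t \<and> 16 \<le> t' \<and> k44 (t - 16) (t' - 16)"

lemma cell_edge_fixed: "cell_edge tab c j t t' \<longleftrightarrow> fixed_edge t t' \<or>
    t = 3 \<and> t' = 5 \<and> tab c j \<noteq> 0 \<and> j \<noteq> 0 \<or> t = 3 \<and> t' = 6 \<and> tab c j = 2"
  unfolding cell_edge_def fixed_edge_def by (simp only: disj_assoc)

definition vertex_trm :: "trm \<Rightarrow> trm \<Rightarrow> trm \<Rightarrow> nat \<Rightarrow> trm" where
  "vertex_trm N c j t = TAdd (TMul (TC 24) (TAdd (TMul c N) j)) (TC t)"

text \<open>The two cases of \<open>nx n v\<close>: its value with the condition under which it applies.\<close>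

definition nx_cases :: "trm \<Rightarrow> nat \<Rightarrow> (trm \<times> fm) list" where
  "nx_cases n v = [(TAdd (TV v) (TC 1), FLt (TAdd (TV v) (TC 1)) n), (TC 0, FEq (TAdd (TV v) (TC 1)) n)]"

abbreviation (input) "FTrue \<equiv> FLe (TC 0) (TC 0)"

definition type_pairs :: "(nat \<times> nat) list" where "type_pairs = List.product [0..<24] [0..<24]"

lemma set_type_pairs: "set type_pairs = {..<24} \<times> {..<24}"
  unfolding type_pairs_def by (simp only: set_product set_upt atLeast0LessThan)

text \<open>Each entry stands for a class of directed edges: the types of the endpoints, terms for
  the cell of the second one, and a condition. \<open>p\<close> and \<open>n\<close> express the
  table entry at variables 3 and 4; as in \<open>tab\<close>, \<open>n\<close> has priority, so
  entry 1 is \<open>p\<close> without \<open>n\<close>.\<close>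

definition edge_kinds :: "trm \<Rightarrow> trm \<Rightarrow> fm \<Rightarrow> fm \<Rightarrow> (nat \<times> nat \<times> trm \<times> trm \<times> fm) list" where
  "edge_kinds C N p n =
     map (\<lambda>(t, t'). (t, t', TV 3, TV 4, FTrue)) (filter (\<lambda>(t, t'). fixed_edge t t') type_pairs) @
     [(3, 5, TV 3, TV 4, FAnd (FOr p n) (FLt (TC 0) (TV 4))), (3, 6, TV 3, TV 4, n)] @
     concat (map (\<lambda>(c', g). [(0, 4, c', TV 4, g), (3, 4, c', TV 4, g), (4, 4, c', TV 4, g),
       (3, 6, c', TV 4, FAnd g (FAnd p (FNot n)))]) (nx_cases C 3)) @
     concat (map (\<lambda>(j', g). [(1, 5, TV 3, j', g), (3, 5, TV 3, j', FAnd g (FAnd (FOr p n) (FLt (TC 0) j'))),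
       (5, 5, TV 3, j', FAnd g (FAnd (FLt (TC 0) (TV 4)) (FLt (TC 0) j')))]) (nx_cases N 4))"

definition dedge_fm :: "trm \<Rightarrow> trm \<Rightarrow> fm \<Rightarrow> fm \<Rightarrow> nat \<Rightarrow> nat \<Rightarrow> fm" where
  "dedge_fm C N p n u v = FEx 3 C (FEx 4 N (FDisj (map (\<lambda>(t, t', c', j', f).
     FConj [FEq (TV u) (vertex_trm N (TV 3) (TV 4) t), FEq (TV v) (vertex_trm N c' j' t'), f]) (edge_kinds C N p n))))"

lemma sem_dedge_fm: "sem w e (dedge_fm C N p n u v) \<longleftrightarrow> (\<exists>c<val e C. \<exists>j<val (e(3 := c)) N.
    \<exists>x\<in>set (edge_kinds C N p n). case x of (t, t', c', j', f) \<Rightarrow>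
      (e(3 := c, 4 := j)) u = val (e(3 := c, 4 := j)) (vertex_trm N (TV 3) (TV 4) t) \<and>
      (e(3 := c, 4 := j)) v = val (e(3 := c, 4 := j)) (vertex_trm N c' j' t') \<and> sem w (e(3 := c, 4 := j)) f)"
  unfolding dedge_fm_def sem.simps sem_connectives(5) set_map bex_simps(7)
  by (intro ex_cong1 conj_cong bex_cong refl) (simp add: split_beta)

lemma nx_cases_iff: "(\<exists>(k, g)\<in>set (nx_cases n v). sem w e g \<and> P (val e k)) \<longleftrightarrow> e v < val e n \<and> P (nx (val e n) (e v))"
  if "e v < val e n"
  using that by (auto simp: nx_cases_def nx_def)

text \<open>The predicate \<open>P\<close> stays arbitrary, so both sides reduce to the same finite
  disjunction of its instances, one for each kind of edge.\<close>

lemma edge_kinds_iff: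
  assumes c: "e 3 < val e C" "e 4 < val e N"
    and tab: "sem w e n \<longleftrightarrow> tab (e 3) (e 4) = 2" "sem w e p \<and> \<not> sem w e n \<longleftrightarrow> tab (e 3) (e 4) = 1"
      "sem w e p \<or> sem w e n \<longleftrightarrow> tab (e 3) (e 4) \<noteq> 0"
  shows "(\<exists>(t, t', c', j', f)\<in>set (edge_kinds C N p n). sem w e f \<and> P t t' (val e c') (val e j')) \<longleftrightarrow>
    (\<exists>t t' c' j'. t < 24 \<and> t' < 24 \<and> dedge (val e C) (val e N) tab (e 3, e 4, t) (c', j', t') \<and> P t t' c' j')"
    (is "?L \<longleftrightarrow> ?R")
proof -
  let ?c = "e 3" and ?j = "e 4" and ?c' = "nx (val e C) (e 3)" and ?j' = "nx (val e N) (e 4)"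
  have t0: "tab ?c ?j \<noteq> 0 \<longleftrightarrow> sem w e p \<or> sem w e n" using tab(3) by blast
  have L: "?L \<longleftrightarrow> (\<exists>t<24. \<exists>t'<24. fixed_edge t t' \<and> P t t' ?c ?j) \<or>
      tab ?c ?j \<noteq> 0 \<and> 0 < ?j \<and> P 3 5 ?c ?j \<or> tab ?c ?j = 2 \<and> P 3 6 ?c ?j \<or>
      (\<exists>(c', g)\<in>set (nx_cases C 3). sem w e g \<and> (P 0 4 (val e c') ?j \<or> P 3 4 (val e c') ?j \<or> P 4 4 (val e c') ?j \<or>
        tab ?c ?j = 1 \<and> P 3 6 (val e c') ?j)) \<or>
      (\<exists>(j', g)\<in>set (nx_cases N 4). sem w e g \<and> (P 1 5 ?c (val e j') \<or>
        tab ?c ?j \<noteq> 0 \<and> 0 < val e j' \<and> P 3 5 ?c (val e j') \<or> 0 < ?j \<and> 0 < val e j' \<and> P 5 5 ?c (val e j')))"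
  proof -
    let ?X = "\<lambda>(t, t', c', j', f). sem w e f \<and> P t t' (val e c') (val e j')"
    have 1: "(\<exists>x\<in>set (map (\<lambda>(t, t'). (t, t', TV 3, TV 4, FTrue)) (filter (\<lambda>(t, t'). fixed_edge t t') type_pairs)). ?X x)
        \<longleftrightarrow> (\<exists>t<24. \<exists>t'<24. fixed_edge t t' \<and> P t t' ?c ?j)" by (auto simp: set_type_pairs)
    have 2: "(\<exists>x\<in>set [(3, 5, TV 3, TV 4, FAnd (FOr p n) (FLt (TC 0) (TV 4))), (3, 6, TV 3, TV 4, n)]. ?X x) \<longleftrightarrow>
        tab ?c ?j \<noteq> 0 \<and> 0 < ?j \<and> P 3 5 ?c ?j \<or> tab ?c ?j = 2 \<and> P 3 6 ?c ?j"
      unfolding t0 tab(1)[symmetric] by simp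
    have 3: "(\<exists>x\<in>set (concat (map (\<lambda>(c', g). [(0, 4, c', TV 4, g), (3, 4, c', TV 4, g), (4, 4, c', TV 4, g),
         (3, 6, c', TV 4, FAnd g (FAnd p (FNot n)))]) xs)). ?X x) \<longleftrightarrow>
       (\<exists>(c', g)\<in>set xs. sem w e g \<and> (P 0 4 (val e c') ?j \<or> P 3 4 (val e c') ?j \<or> P 4 4 (val e c') ?j \<or>
        tab ?c ?j = 1 \<and> P 3 6 (val e c') ?j))" for xs
    proof (induction xs)
      case (Cons x xs)
      then show ?case using tab(2) by (cases x) (simp add: bex_Un, blast)
    qed simp
    have 4: "(\<exists>x\<in>set (concat (map (\<lambda>(j', g). [(1, 5, TV 3, j', g), (3, 5, TV 3, j', FAnd g (FAnd (FOr p n) (FLt (TC 0) j'))),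
         (5, 5, TV 3, j', FAnd g (FAnd (FLt (TC 0) (TV 4)) (FLt (TC 0) j')))]) xs)). ?X x) \<longleftrightarrow>
       (\<exists>(j', g)\<in>set xs. sem w e g \<and> (P 1 5 ?c (val e j') \<or>
        tab ?c ?j \<noteq> 0 \<and> 0 < val e j' \<and> P 3 5 ?c (val e j') \<or> 0 < ?j \<and> 0 < val e j' \<and> P 5 5 ?c (val e j')))" for xs
    proof (induction xs)
      case (Cons x xs)
      then show ?case using t0 by (cases x) (simp add: bex_Un, blast)
    qed simp
    show ?thesis unfolding edge_kinds_def set_append bex_Un 1 2 3 4 by (simp only: disj_assoc)
  qed
  have R: "?R \<longleftrightarrow> (\<exists>t<24. \<exists>t'<24. fixed_edge t t' \<and> P t t' ?c ?j) \<or>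
      tab ?c ?j \<noteq> 0 \<and> 0 < ?j \<and> P 3 5 ?c ?j \<or> tab ?c ?j = 2 \<and> P 3 6 ?c ?j \<or>
      (P 0 4 ?c' ?j \<or> P 3 4 ?c' ?j \<or> P 4 4 ?c' ?j \<or> tab ?c ?j = 1 \<and> P 3 6 ?c' ?j) \<or>
      (P 1 5 ?c ?j' \<or> tab ?c ?j \<noteq> 0 \<and> 0 < ?j' \<and> P 3 5 ?c ?j' \<or> 0 < ?j \<and> 0 < ?j' \<and> P 5 5 ?c ?j')"
  proof
    assume ?R
    then obtain t t' c' j' where *: "t < 24" "t' < 24" "dedge (val e C) (val e N) tab (?c, ?j, t) (c', j', t')" "P t t' c' j'" by blast
    have fixed: "fixed_edge t t' \<Longrightarrow> P t t' ?c ?j \<Longrightarrow> t < 24 \<Longrightarrow> t' < 24 \<Longrightarrow>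
        (\<exists>t<24. \<exists>t'<24. fixed_edge t t' \<and> P t t' ?c ?j)" by blast
    show "(\<exists>t<24. \<exists>t'<24. fixed_edge t t' \<and> P t t' ?c ?j) \<or>
      tab ?c ?j \<noteq> 0 \<and> 0 < ?j \<and> P 3 5 ?c ?j \<or> tab ?c ?j = 2 \<and> P 3 6 ?c ?j \<or>
      (P 0 4 ?c' ?j \<or> P 3 4 ?c' ?j \<or> P 4 4 ?c' ?j \<or> tab ?c ?j = 1 \<and> P 3 6 ?c' ?j) \<or>
      (P 1 5 ?c ?j' \<or> tab ?c ?j \<noteq> 0 \<and> 0 < ?j' \<and> P 3 5 ?c ?j' \<or> 0 < ?j \<and> 0 < ?j' \<and> P 5 5 ?c ?j')"
      using *(3) unfolding dedge.simps cell_edge_fixed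
      apply (elim disjE conjE insertE emptyE)
      using *(1,2,4) fixed by simp_all
  next
    have i: "?R" if "t < 24" "t' < 24" "dedge (val e C) (val e N) tab (?c, ?j, t) (c', j', t')" "P t t' c' j'" for t t' c' j'
      using that by blast
    assume "(\<exists>t<24. \<exists>t'<24. fixed_edge t t' \<and> P t t' ?c ?j) \<or>
      tab ?c ?j \<noteq> 0 \<and> 0 < ?j \<and> P 3 5 ?c ?j \<or> tab ?c ?j = 2 \<and> P 3 6 ?c ?j \<or>
      (P 0 4 ?c' ?j \<or> P 3 4 ?c' ?j \<or> P 4 4 ?c' ?j \<or> tab ?c ?j = 1 \<and> P 3 6 ?c' ?j) \<or>
      (P 1 5 ?c ?j' \<or> tab ?c ?j \<noteq> 0 \<and> 0 < ?j' \<and> P 3 5 ?c ?j' \<or> 0 < ?j \<and> 0 < ?j' \<and> P 5 5 ?c ?j')"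
    then show ?R
    proof (elim disjE exE conjE)
      fix t t' assume "t < 24" "t' < 24" "fixed_edge t t'" "P t t' ?c ?j"
      then show ?R by (intro i[of t t']) (simp_all add: cell_edge_fixed)
    qed (rule i; simp add: cell_edge_fixed; fail)+
  qed
  show ?thesis unfolding L R using nx_cases_iff[where e = e and n = C and v = 3 and w = w and
        P = "\<lambda>k. P 0 4 k ?j \<or> P 3 4 k ?j \<or> P 4 4 k ?j \<or> tab ?c ?j = 1 \<and> P 3 6 k ?j", OF c(1)]
      nx_cases_iff[where e = e and n = N and v = 4 and w = w and
        P = "\<lambda>k. P 1 5 ?c k \<or> tab ?c ?j \<noteq> 0 \<and> 0 < k \<and> P 3 5 ?c k \<or> 0 < ?j \<and> 0 < k \<and> P 5 5 ?c k", OF c(2)] c by simp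
qed


lemma num_inj: "u \<in> verts C N \<Longrightarrow> v \<in> verts C N \<Longrightarrow> num N u = num N v \<Longrightarrow> u = v"
  using num_bij[of N C] unfolding bij_betw_def inj_on_def by blast

lemma (in schema_table) sem_tab:
  assumes "e 0 = length w" "e 3 = c" "e 4 = j"
  shows "sem w e (neg_fm B N0 sc) \<longleftrightarrow> tab c j = 2"
    "sem w e (pos_fm B N0 sc) \<and> \<not> sem w e (neg_fm B N0 sc) \<longleftrightarrow> tab c j = 1"
    "sem w e (pos_fm B N0 sc) \<or> sem w e (neg_fm B N0 sc) \<longleftrightarrow> tab c j \<noteq> 0"
proof -
  let ?e = "(env0 w)(3 := c, 4 := j)"
  have "?e 0 = length w" "?e 3 = c" "?e 4 = j" by (simp_all add: env0_def)
  note * = sem_pos_neg[OF this]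
  have "sem w e (neg_fm B N0 sc) = sem w ?e (neg_fm B N0 sc)" "sem w e (pos_fm B N0 sc) = sem w ?e (pos_fm B N0 sc)"
    unfolding * sem_pos_neg[OF assms] by (rule refl)+
  then show "sem w e (neg_fm B N0 sc) \<longleftrightarrow> tab c j = 2"
    "sem w e (pos_fm B N0 sc) \<and> \<not> sem w e (neg_fm B N0 sc) \<longleftrightarrow> tab c j = 1"
    "sem w e (pos_fm B N0 sc) \<or> sem w e (neg_fm B N0 sc) \<longleftrightarrow> tab c j \<noteq> 0"
    unfolding tab_def by auto
qed

context tableau
begin

definition Ct :: trm where "Ct = TAdd (rows_trm Bt schemas) (TC 3)"
definition Mt :: trm where "Mt = TAdd Nt (TC 2)"

abbreviation "pf \<equiv> pos_fm Bt Nt schemas"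
abbreviation "nf \<equiv> neg_fm Bt Nt schemas"

definition edge_fm :: fm where
  "edge_fm = FOr (dedge_fm Ct Mt pf nf 1 2) (dedge_fm Ct Mt pf nf 2 1)"

definition size_trm :: trm where "size_trm = TMul (TC 24) (TMul Ct Mt)"

lemma tvars_table: "tvars Bt = {0}" "tvars Nt = {0}" "tvars Ct = {0}" "tvars Mt = {0}" "tvars size_trm = {0}" "tvars Ot \<subseteq> {0}"
  using vars by (auto simp: size_trm_def Ct_def Mt_def rows_trm_def Nt_def Bt_def Ot_def)

lemma edge_fm_adj:
  fixes x
  defines "w \<equiv> encode_word x"
  defines "nC \<equiv> val (env0 w) Ct" and "nN \<equiv> val (env0 w) Mt"
  assumes u: "u \<in> verts nC nN" and v: "v \<in> verts nC nN"
  shows "sem w (matrix_env w (num nN u) (num nN v)) edge_fm \<longleftrightarrow> adj nC nN (schema_table.tab w Bt Nt schemas) u v"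
proof -
  interpret T: schema_table w Bt Nt schemas by (rule schema_table_schemas)
  let ?tab = T.tab and ?e = "matrix_env w (num nN u) (num nN v)"
  have e0: "?e 0 = length w" by (simp add: matrix_env_def env0_def)
  have val_eq: "val e Ct = nC" "val e Mt = nN" if "e 0 = length w" for e
    unfolding nC_def nN_def using that by (auto intro!: val_cong simp: tvars_table env0_def)
  have d: "sem w ?e (dedge_fm Ct Mt pf nf a b) \<longleftrightarrow> dedge nC nN ?tab u' v'"
    if ab: "?e a = num nN u'" "?e b = num nN v'" "u' \<in> verts nC nN" "v' \<in> verts nC nN" "a = 1 \<or> a = 2" "b = 1 \<or> b = 2" for a b u' v'
  proof -
    have val3: "val (?e(3 := c)) Mt = nN" for c using e0 by (intro val_eq) simp
    have "sem w ?e (dedge_fm Ct Mt pf nf a b) \<longleftrightarrow> (\<exists>c<nC. \<exists>j<nN. \<exists>(t, t', c', j', f)\<in>set (edge_kinds Ct Mt pf nf).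
        sem w (?e(3 := c, 4 := j)) f \<and> (num nN u' = num nN (c, j, t) \<and>
          num nN v' = num nN (val (?e(3 := c, 4 := j)) c', val (?e(3 := c, 4 := j)) j', t')))"
      unfolding sem_dedge_fm val_eq(1)[of ?e, OF e0] val3
    proof (intro ex_cong1 conj_cong bex_cong refl)
      fix c j and k :: "nat \<times> nat \<times> trm \<times> trm \<times> fm"
      obtain t t' c' j' f where k: "k = (t, t', c', j', f)" by (cases k)
      have "val (?e(3 := c, 4 := j)) Mt = nN" using e0 by (intro val_eq) simp
      then show "(case k of (t, t', c', j', f) \<Rightarrow>
          (?e(3 := c, 4 := j)) a = val (?e(3 := c, 4 := j)) (vertex_trm Mt (TV 3) (TV 4) t) \<and>
          (?e(3 := c, 4 := j)) b = val (?e(3 := c, 4 := j)) (vertex_trm Mt c' j' t') \<and> sem w (?e(3 := c, 4 := j)) f) \<longleftrightarrow>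
        (case k of (t, t', c', j', f) \<Rightarrow> sem w (?e(3 := c, 4 := j)) f \<and> (num nN u' = num nN (c, j, t) \<and>
          num nN v' = num nN (val (?e(3 := c, 4 := j)) c', val (?e(3 := c, 4 := j)) j', t')))"
        using ab(1,2,5,6) unfolding k prod.case vertex_trm_def num_def val.simps by auto
    qed
    also have "\<dots> \<longleftrightarrow> (\<exists>c<nC. \<exists>j<nN. \<exists>t t' c' j'. t < 24 \<and> t' < 24 \<and> dedge nC nN ?tab (c, j, t) (c', j', t') \<and>
        num nN u' = num nN (c, j, t) \<and> num nN v' = num nN (c', j', t'))"
    proof (intro ex_cong1 conj_cong refl)
      fix c j assume c: "c < nC" "j < nN"
      let ?f = "?e(3 := c, 4 := j)"
      have f: "?f 0 = length w" "?f 3 = c" "?f 4 = j" using e0 by simp_all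
      show "(\<exists>(t, t', c', j', f)\<in>set (edge_kinds Ct Mt pf nf). sem w ?f f \<and> (num nN u' = num nN (c, j, t) \<and>
          num nN v' = num nN (val ?f c', val ?f j', t'))) \<longleftrightarrow>
        (\<exists>t t' c' j'. t < 24 \<and> t' < 24 \<and> dedge nC nN ?tab (c, j, t) (c', j', t') \<and>
        num nN u' = num nN (c, j, t) \<and> num nN v' = num nN (c', j', t'))"
        using edge_kinds_iff[where e = ?f and w = w and C = Ct and N = Mt and p = pf and n = nf and tab = ?tab and
          P = "\<lambda>t t' c' j'. num nN u' = num nN (c, j, t) \<and> num nN v' = num nN (c', j', t')"]
          c T.sem_tab[OF f] unfolding val_eq(1)[of ?f, OF f(1)] val_eq(2)[of ?f, OF f(1)] f(2,3) by blast
    qed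
    also have "\<dots> \<longleftrightarrow> dedge nC nN ?tab u' v'"
    proof
      assume "\<exists>c<nC. \<exists>j<nN. \<exists>t t' c' j'. t < 24 \<and> t' < 24 \<and> dedge nC nN ?tab (c, j, t) (c', j', t') \<and>
        num nN u' = num nN (c, j, t) \<and> num nN v' = num nN (c', j', t')"
      then obtain c j t t' c' j' where *: "c < nC" "j < nN" "t < 24" "t' < 24" "dedge nC nN ?tab (c, j, t) (c', j', t')"
        "num nN u' = num nN (c, j, t)" "num nN v' = num nN (c', j', t')" by blast
      \<comment> \<open>Vertex numbers are injective only on the grid, so the second endpoint must
        be known to lie in it.\<close>
      have "c' < nC" "j' < nN" using *(5) *(1,2) nx_lt[of c nC] nx_lt[of j nN] by auto
      then have "u' = (c, j, t)" "v' = (c', j', t')" using num_inj[OF ab(3) _ *(6)] num_inj[OF ab(4) _ *(7)] * by (auto simp: verts_def)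
      then show "dedge nC nN ?tab u' v'" using *(5) by simp
    next
      assume *: "dedge nC nN ?tab u' v'"
      obtain c j t c' j' t' where uv: "u' = (c, j, t)" "v' = (c', j', t')" by (cases u', cases v')
      show "\<exists>c<nC. \<exists>j<nN. \<exists>t t' c' j'. t < 24 \<and> t' < 24 \<and> dedge nC nN ?tab (c, j, t) (c', j', t') \<and>
        num nN u' = num nN (c, j, t) \<and> num nN v' = num nN (c', j', t')"
        using * ab(3,4) unfolding uv verts_def by blast
    qed
    finally show ?thesis .
  qed
  have "?e 1 = num nN u" "?e 2 = num nN v" by (simp_all add: matrix_env_def)
  then show ?thesis unfolding edge_fm_def sem_connectives adj_def using d[of 1 u 2 v] d[of 2 v 1 u] u v by simp
qed

lemma guard_wff: "s \<in> set schemas \<Longrightarrow> wff 8 {0, 1, 2, 3, 4, 5, 6} (guard s)"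
proof -
  have "wff 8 {0, 1, 2, 3, 4, 5, 6} (fst s)" if "s \<in> set schemas"
  proof -
    have "tvars Tt \<subseteq> {..<8}" "tvars Pt \<subseteq> {..<8}" "tvars Ot \<subseteq> {..<8}" using vars tvars_table(6) by (force dest: subsetD)+
    then have "\<forall>s\<in>set schemas. wff 8 {0, 1, 2, 3, 4, 5, 6} (fst s)" unfolding schemas_def set_append ball_Un
      by (simp add: state_schemas_def write_schemas_def copy_schemas_def init_schemas_def final_schemas_def
        Let_def split_beta ball_Un tvars_table del: set_product)
    then show ?thesis using that by (rule bspec)
  qed
  moreover have "tvars k \<subseteq> {..<8}" if "s \<in> set schemas" "(g, k) \<in> set (snd s)" for g k
    using schema_literal_vars[OF that(1)] that(2) by force
  ultimately show "s \<in> set schemas \<Longrightarrow> wff 8 {0, 1, 2, 3, 4, 5, 6} (guard s)" unfolding guard_def by auto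
qed

lemma lit_wff: "s \<in> set schemas \<Longrightarrow> wff 8 S' (lit_fm g s)"
proof -
  assume s: "s \<in> set schemas"
  have "tvars (snd l) \<subseteq> {..<8}" if "l \<in> set (snd s)" for l
    using schema_literal_vars[OF s] that by force
  then show ?thesis unfolding lit_fm_def by auto
qed

lemma clause_wff:
  assumes "\<And>s. s \<in> set schemas \<Longrightarrow> wff 8 {0, 1, 2, 3, 4, 5, 6} (f s)"
  shows "wff 8 {0, 1, 2, 3, 4} (clause_fm Bt schemas f)"
proof -
  have i: "insert 6 (insert 5 {0, 1, 2, 3, 4}) = {0, 1, 2, 3, 4, 5, 6 :: nat}" by auto
  have "wff 8 {0, 1, 2, 3, 4, 5, 6} (FDisj (map (\<lambda>(i, s). FAnd (row_fm Bt i) (FAnd (guard s) (f s))) (List.enumerate 0 schemas)))"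
    unfolding wff_connectives(5)
  proof
    fix h assume "h \<in> set (map (\<lambda>(i, s). FAnd (row_fm Bt i) (FAnd (guard s) (f s))) (List.enumerate 0 schemas))"
    then obtain i s where m: "(i, s) \<in> set (List.enumerate 0 schemas)" "h = FAnd (row_fm Bt i) (FAnd (guard s) (f s))" by auto
    have "s \<in> set schemas" using m(1) nth_mem[of i schemas] by (auto simp: in_set_enumerate_eq)
    then show "wff 8 {0, 1, 2, 3, 4, 5, 6} h" unfolding m(2) using assms guard_wff
      by (auto simp: row_fm_def tvars_table)
  qed
  then show ?thesis unfolding clause_fm_def wff.simps i by (simp add: tvars_table del: wff_connectives)
qed

lemma pf_nf_wff: "wff 8 {0, 1, 2, 3, 4} pf" "wff 8 {0, 1, 2, 3, 4} nf"
  using clause_wff[of "lit_fm True", OF lit_wff] clause_wff[of "lit_fm False", OF lit_wff] clause_wff[of "\<lambda>_. FTrue"]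
  by (simp_all add: pos_fm_def neg_fm_def valid_fm_def tvars_table rows_trm_def)

lemma edge_fm_wff: "wff 8 {0, 1, 2} edge_fm"
proof -
  have i: "insert 4 (insert 3 {0, 1, 2}) = {0, 1, 2, 3, 4 :: nat}" by auto
  have k: "tvars c' \<subseteq> {..<8} \<and> tvars j' \<subseteq> {..<8} \<and> wff 8 {0, 1, 2, 3, 4} f"
    if "(t, t', c', j', f) \<in> set (edge_kinds Ct Mt pf nf)" for t t' c' j' f
    using that pf_nf_wff unfolding edge_kinds_def nx_cases_def by (auto simp: tvars_table set_type_pairs)
  have "wff 8 {0, 1, 2, 3, 4} (FDisj (map (\<lambda>(t, t', c', j', f).
     FConj [FEq (TV u) (vertex_trm Mt (TV 3) (TV 4) t), FEq (TV v) (vertex_trm Mt c' j' t'), f]) (edge_kinds Ct Mt pf nf)))"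
    if "u < 8" "v < 8" for u v
    using that k by (auto simp: vertex_trm_def tvars_table)
  from this[of 1 2] this[of 2 1] show ?thesis unfolding edge_fm_def dedge_fm_def wff_connectives(2) wff.simps i
    by (simp add: tvars_table del: wff_connectives FConj.simps)
qed

text \<open>The graph is always simple and of degree at most 7, so one map reduces to both
  languages.\<close>

theorem reduction:
  fixes x
  defines "w \<equiv> encode_word x"
  defines "g \<equiv> encode_graph (val (env0 w) size_trm) (\<lambda>i j. sem w (matrix_env w i j) edge_fm)"
  shows "g \<in> unit_2_interval_recognition \<longleftrightarrow> (\<exists>y. length y \<le> val (env0 w) Pt \<and> fst (run M (encode_pair x y) (val (env0 w) Tt)) = accept_state M)"
    "g \<in> unit_2_interval_recognition_max_degree 7 \<longleftrightarrow> (\<exists>y. length y \<le> val (env0 w) Pt \<and> fst (run M (encode_pair x y) (val (env0 w) Tt)) = accept_state M)"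
proof -
  interpret T: schema_table w Bt Nt schemas by (rule schema_table_schemas)
  define nC where "nC = val (env0 w) Ct"
  define nN where "nN = val (env0 w) Mt"
  define E where "E u v = sem w (matrix_env w u v) edge_fm" for u v
  have nC: "nC = T.c0 + 3" by (simp add: nC_def Ct_def rows_trm_def T.c0_def T.b_def)
  have nN: "nN = T.n0 + 2" by (simp add: nN_def Mt_def T.n0_def)
  have n0: "1 \<le> T.n0" unfolding T.n0_def unfolding Nt_def using small(6) bounds(1)[of w] by simp
  have size: "val (env0 w) size_trm = 24 * (nC * nN)" by (simp add: size_trm_def nC_def nN_def)
  have E: "E (num nN u) (num nN v) \<longleftrightarrow> adj nC nN T.tab u v" if "u \<in> verts nC nN" "v \<in> verts nC nN" for u v
    using edge_fm_adj[of u x v] that unfolding E_def nC_def nN_def w_def by blast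
  note tr = graph_transfer[where h = "num nN" and E' = E and E = "adj nC nN T.tab", OF num_bij[of nN nC] E]
  have C2: "2 < nC" "2 < nN" using nC nN n0 by auto
  have s: "simple_graph {..<24 * (nC * nN)} E" "max_degree_le 7 {..<24 * (nC * nN)} E"
    using tr(2)[OF _ _ adj_simple[OF C2]] tr(3)[OF _ _ adj_degree] by blast+
  have tn: "tab c 0 \<noteq> 0 \<and> tab c (nN - 1) \<noteq> 0" if "tab = T.tab" for tab c
    using T.tab_ends[of c] that nN by simp
  have "unit_d_interval_graph 2 {..<24 * (nC * nN)} E \<longleftrightarrow> unit_d_interval_graph 2 (verts nC nN) (adj nC nN T.tab)"
    using tr(1)[of 2] by blast
  also have "\<dots> \<longleftrightarrow> (\<exists>a. table_sat nC nN T.tab a)"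
    using graph_sound[where tab = T.tab, OF C2 tn[OF refl] T.tab_le] graph_complete[where tab = T.tab, OF C2 tn[OF refl] T.tab_le] by blast
  also have "\<dots> \<longleftrightarrow> (\<exists>a. \<forall>s\<in>set schemas. schema_holds w (val (env0 w) Bt) s a)"
    unfolding nC nN using T.table_sat_iff unfolding T.b_def .
  also have "\<dots> \<longleftrightarrow> (\<exists>y. length y \<le> val (env0 w) Pt \<and> fst (run M (encode_pair x y) (val (env0 w) Tt)) = accept_state M)"
    unfolding w_def by (rule schemas_iff)
  finally have u: "unit_d_interval_graph 2 {..<24 * (nC * nN)} E \<longleftrightarrow>
    (\<exists>y. length y \<le> val (env0 w) Pt \<and> fst (run M (encode_pair x y) (val (env0 w) Tt)) = accept_state M)" .
  have g: "g = encode_graph (24 * (nC * nN)) E" unfolding g_def size E_def ..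
  show "g \<in> unit_2_interval_recognition \<longleftrightarrow> (\<exists>y. length y \<le> val (env0 w) Pt \<and> fst (run M (encode_pair x y) (val (env0 w) Tt)) = accept_state M)"
    "g \<in> unit_2_interval_recognition_max_degree 7 \<longleftrightarrow> (\<exists>y. length y \<le> val (env0 w) Pt \<and> fst (run M (encode_pair x y) (val (env0 w) Tt)) = accept_state M)"
    unfolding g encode_graph_recognition using u s by blast+
qed

end

lemma poly_trm: "tvars X \<subseteq> {0} \<Longrightarrow> \<exists>T. tvars T \<subseteq> {0} \<and> (\<forall>e. val e T = poly p (val e X))" for p :: "nat poly"
proof (induction p)
  case 0
  show ?case by (rule exI[of _ "TC 0"]) simp
next
  case (pCons a p)
  then obtain T where "tvars T \<subseteq> {0}" "\<forall>e. val e T = poly p (val e X)" by blast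
  then show ?case using pCons.prems by (intro exI[of _ "TAdd (TC a) (TMul X T)"]) auto
qed

lemma run_halted: "halted M (run M v t) \<Longrightarrow> run M v (t + d) = run M v t"
proof (induction d)
  case (Suc d)
  then show ?case by (simp add: run_def step_def)
qed simp

theorem recognition_NP_hard: "NP_hard unit_2_interval_recognition \<and> NP_hard (unit_2_interval_recognition_max_degree 7)"
proof -
  have "\<exists>f. polytime_computable f \<and> (\<forall>x. (x \<in> L \<longleftrightarrow> f x \<in> unit_2_interval_recognition) \<and>
      (x \<in> L \<longleftrightarrow> f x \<in> unit_2_interval_recognition_max_degree 7))" if L: "in_NP L" for L
  proof -
    obtain R p where R: "polytime_decidable_rel R" "\<And>x. x \<in> L \<longleftrightarrow> (\<exists>y. length y \<le> poly p (length x) \<and> R x y)"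
      using L unfolding in_NP_def by blast
    obtain M q where M: "wf_tm M" "\<And>x y. halted M (run M (encode_pair x y) (poly q (length (encode_pair x y))))"
        "\<And>x y. fst (run M (encode_pair x y) (poly q (length (encode_pair x y)))) = accept_state M \<longleftrightarrow> R x y"
      using R(1) unfolding polytime_decidable_rel_def Let_def by blast
    obtain Pt where Pt: "tvars Pt \<subseteq> {0}" "\<And>e. val e Pt = poly p (e 0)" using poly_trm[of "TV 0" p] by auto
    \<comment> \<open>This bounds the time for the longest admissible certificate, the 1 counting
      the separator. Runs on shorter certificates have halted by then, and halted configurations
      persist.\<close>
    obtain Tt where Tt: "tvars Tt \<subseteq> {0}" "\<And>e. val e Tt = poly q (e 0 + val e Pt + 1)"
      using poly_trm[of "TAdd (TV 0) (TAdd Pt (TC 1))" q] Pt(1) by (auto simp: add.assoc)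
    interpret tableau M Tt Pt by unfold_locales (use M(1) Pt(1) Tt(1) in auto)
    define f where "f x = encode_graph (val (env0 (encode_word x)) size_trm)
      (\<lambda>i j. sem (encode_word x) (matrix_env (encode_word x) i j) edge_fm)" for x
    have "polytime_computable f" unfolding f_def
      by (rule compute_matrix[OF edge_fm_wff]) (simp_all add: tvars_table)
    moreover have "(\<exists>y. length y \<le> val (env0 (encode_word x)) Pt \<and>
        fst (run M (encode_pair x y) (val (env0 (encode_word x)) Tt)) = accept_state M) \<longleftrightarrow> x \<in> L" for x
    proof -
      have P: "val (env0 (encode_word x)) Pt = poly p (length x)" by (simp add: Pt(2) env0_def)
      have "fst (run M (encode_pair x y) (val (env0 (encode_word x)) Tt)) = accept_state M \<longleftrightarrow> R x y"
        if "length y \<le> poly p (length x)" for y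
      proof -
        let ?l = "poly q (length (encode_pair x y))"
        have "?l \<le> val (env0 (encode_word x)) Tt" unfolding Tt(2) P
          using that by (intro poly_nat_mono) (simp add: encode_pair_def encode_word_def env0_def)
        then obtain d where "val (env0 (encode_word x)) Tt = ?l + d" using le_Suc_ex by blast
        then show ?thesis using run_halted[OF M(2), of x y d] M(3)[of x y] by simp
      qed
      then show ?thesis unfolding R(2) P by blast
    qed
    ultimately show ?thesis using reduction unfolding f_def by blast
  qed
  then show ?thesis unfolding NP_hard_def polytime_reducible_def by blast
qed


section \<open>Membership\<close>

lemma finite_between:
  fixes A B :: "real set"
  assumes "finite A" "finite B" "\<And>x y. x \<in> A \<Longrightarrow> y \<in> B \<Longrightarrow> x < y"
  shows "\<exists>z. (\<forall>x\<in>A. x < z) \<and> (\<forall>y\<in>B. z < y)"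
proof (cases "A = {} \<or> B = {}")
  case True
  then show ?thesis
  proof
    assume A: "A = {}"
    have "Min (insert 0 B) \<le> y" if "y \<in> B" for y by (rule Min_le) (use assms(2) that in auto)
    then have "Min (insert 0 B) - 1 < y" if "y \<in> B" for y using that by fastforce
    then show ?thesis using A by blast
  next
    assume B: "B = {}"
    have "x \<le> Max (insert 0 A)" if "x \<in> A" for x by (rule Max_ge) (use assms(1) that in auto)
    then have "x < Max (insert 0 A) + 1" if "x \<in> A" for x using that by fastforce
    then show ?thesis using B by blast
  qed
next
  case False
  then have "Max A < Min B" using assms by simp
  then obtain z where "Max A < z" "z < Min B" using dense by blast
  then show ?thesis using assms(1,2) False by auto
qed

text \<open>The closeness relation of a sequence in which no two members have distance exactly 1.\<close>

lemma semiorder_representation: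
  fixes Q :: "nat \<Rightarrow> nat \<Rightarrow> bool"
  assumes refl: "\<And>p. p < m \<Longrightarrow> Q p p"
    and mono: "\<And>p p' q' q. p \<le> p' \<Longrightarrow> p' \<le> q' \<Longrightarrow> q' \<le> q \<Longrightarrow> q < m \<Longrightarrow> Q p q \<Longrightarrow> Q p' q'"
  shows "\<exists>a :: nat \<Rightarrow> real. \<forall>p q. p \<le> q \<longrightarrow> q < m \<longrightarrow> a p \<le> a q \<and> (p < q \<longrightarrow> a p < a q) \<and> (Q p q \<longleftrightarrow> a q - a p < 1) \<and> a q - a p \<noteq> 1"
  using assms
proof (induction m)
  case (Suc m)
  have "\<exists>a :: nat \<Rightarrow> real. \<forall>p q. p \<le> q \<longrightarrow> q < m \<longrightarrow> a p \<le> a q \<and> (p < q \<longrightarrow> a p < a q) \<and> (Q p q \<longleftrightarrow> a q - a p < 1) \<and> a q - a p \<noteq> 1"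
  proof (rule Suc.IH)
    show "Q p p" if "p < m" for p using Suc.prems(1) that by simp
    show "Q p' q'" if "p \<le> p'" "p' \<le> q'" "q' \<le> q" "q < m" "Q p q" for p p' q' q
      using Suc.prems(2)[OF that(1-3) _ that(5)] that(4) by simp
  qed
  then obtain a :: "nat \<Rightarrow> real" where a: "\<And>p q. p \<le> q \<Longrightarrow> q < m \<Longrightarrow>
      a p \<le> a q \<and> (p < q \<longrightarrow> a p < a q) \<and> (Q p q \<longleftrightarrow> a q - a p < 1) \<and> a q - a p \<noteq> 1" by blast
  \<comment> \<open>The new point must lie above all members of \<open>A\<close> and below all
    members of \<open>B\<close>. Excluding distance exactly 1 makes all these conditions strict, so
    any point of the open gap will do.\<close>
  define A where "A = a ` {..<m} \<union> (\<lambda>p. a p + 1) ` {p. p < m \<and> \<not> Q p m}"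
  define B where "B = (\<lambda>p. a p + 1) ` {p. p < m \<and> Q p m}"
  have "x < y" if xy: "x \<in> A" "y \<in> B" for x y
  proof -
    obtain q where q: "q < m" "Q q m" "y = a q + 1" using xy(2) unfolding B_def by blast
    consider p where "p < m" "x = a p" | p where "p < m" "\<not> Q p m" "x = a p + 1" using xy(1) unfolding A_def by blast
    then show ?thesis
    proof cases
      case (1 p)
      show ?thesis
      proof (cases "p \<le> q")
        case True
        then show ?thesis using a[of p q] q 1 by auto
      next
        case False
        then have "Q q p" using Suc.prems(2)[of q q p m] q 1 by simp
        then show ?thesis using a[of q p] q 1 False by auto
      qed
    next
      case (2 p)
      have "p < q"
      proof (rule ccontr)
        assume "\<not> p < q"
        then have "Q p m" using Suc.prems(2)[of q p m m] q 2 by simp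
        then show False using 2 by simp
      qed
      then show ?thesis using a[of p q] q 2 by auto
    qed
  qed
  then obtain z where z: "\<And>x. x \<in> A \<Longrightarrow> x < z" "\<And>y. y \<in> B \<Longrightarrow> z < y"
  proof -
    have "finite A" "finite B" unfolding A_def B_def by auto
    then show thesis using finite_between[of A B] \<open>\<And>x y. x \<in> A \<Longrightarrow> y \<in> B \<Longrightarrow> x < y\<close> that by blast
  qed
  have z1: "a p < z" "\<not> Q p m \<Longrightarrow> a p + 1 < z" "Q p m \<Longrightarrow> z < a p + 1" if "p < m" for p
    using z(1)[of "a p"] z(1)[of "a p + 1"] z(2)[of "a p + 1"] that unfolding A_def B_def by auto
  show ?case
  proof (intro exI[of _ "a(m := z)"] allI impI)
    fix p q assume pq: "p \<le> q" "q < Suc m"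
    consider "q < m" | "q = m" "p = m" | "q = m" "p < m" using pq by linarith
    then show "(a(m := z)) p \<le> (a(m := z)) q \<and> (p < q \<longrightarrow> (a(m := z)) p < (a(m := z)) q) \<and>
        (Q p q \<longleftrightarrow> (a(m := z)) q - (a(m := z)) p < 1) \<and> (a(m := z)) q - (a(m := z)) p \<noteq> 1"
    proof cases
      case 1
      then show ?thesis using a[OF pq(1) 1] pq by simp
    next
      case 2
      then show ?thesis using Suc.prems(1)[of m] by simp
    next
      case 3
      then show ?thesis using z1[of p] by (cases "Q p m") auto
    qed
  qed
qed simp

text \<open>The positions below \<open>2 * n\<close> stand for ranks of left endpoints. Vertices may
  share a position, which accounts for equal endpoints, and positions may be unowned.
  \<open>Q\<close> is closeness of an ordered pair; the last condition is all that a semiorder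
  requires.\<close>

definition layout_code :: "nat \<Rightarrow> (nat \<Rightarrow> nat \<Rightarrow> bool) \<Rightarrow> (nat \<Rightarrow> nat \<Rightarrow> bool) \<Rightarrow> (nat \<Rightarrow> nat \<Rightarrow> bool) \<Rightarrow> bool" where
  "layout_code n E O' Q \<longleftrightarrow>
     (\<forall>v<n. \<exists>p<2 * n. \<exists>q<2 * n. p < q \<and> O' p v \<and> O' q v \<and> \<not> Q p q \<and> (\<forall>r<2 * n. O' r v \<longrightarrow> r = p \<or> r = q)) \<and>
     (\<forall>u<n. \<forall>v<n. u \<noteq> v \<longrightarrow> (E u v \<longleftrightarrow> (\<exists>p<2 * n. \<exists>q<2 * n. O' p u \<and> O' q v \<and> (p \<le> q \<and> Q p q \<or> q \<le> p \<and> Q q p)))) \<and>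
     (\<forall>p<2 * n. Q p p) \<and>
     (\<forall>p<2 * n. \<forall>p'<2 * n. \<forall>q'<2 * n. \<forall>q<2 * n. p \<le> p' \<and> p' \<le> q' \<and> q' \<le> q \<and> Q p q \<longrightarrow> Q p' q')"

lemma layout_code_sound:
  assumes "layout_code n E O' Q"
  shows "\<exists>L. represents L {..<n} E"
proof -
  note code = assms[unfolded layout_code_def]
  have 1: "\<forall>v<n. \<exists>p<2 * n. \<exists>q<2 * n. p < q \<and> O' p v \<and> O' q v \<and> \<not> Q p q \<and> (\<forall>r<2 * n. O' r v \<longrightarrow> r = p \<or> r = q)"
    by (rule code[THEN conjunct1])
  have 2: "E u v \<longleftrightarrow> (\<exists>p<2 * n. \<exists>q<2 * n. O' p u \<and> O' q v \<and> (p \<le> q \<and> Q p q \<or> q \<le> p \<and> Q q p))"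
    if "u < n" "v < n" "u \<noteq> v" for u v
    by (rule code[THEN conjunct2, THEN conjunct1, rule_format, OF that])
  have 3: "Q p p" if "p < 2 * n" for p
    by (rule code[THEN conjunct2, THEN conjunct2, THEN conjunct1, rule_format, OF that])
  have 4: "Q p' q'" if "p < 2 * n" "p' < 2 * n" "q' < 2 * n" "q < 2 * n" "p \<le> p'" "p' \<le> q'" "q' \<le> q" "Q p q" for p p' q' q
    by (rule code[THEN conjunct2, THEN conjunct2, THEN conjunct2, rule_format, OF that(1-4)]) (use that in simp)
  have "\<exists>a :: nat \<Rightarrow> real. \<forall>p q. p \<le> q \<longrightarrow> q < 2 * n \<longrightarrow> a p \<le> a q \<and> (p < q \<longrightarrow> a p < a q) \<and> (Q p q \<longleftrightarrow> a q - a p < 1) \<and> a q - a p \<noteq> 1"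
  proof (rule semiorder_representation)
    show "Q p' q'" if "p \<le> p'" "p' \<le> q'" "q' \<le> q" "q < 2 * n" "Q p q" for p p' q' q
      using 4[of p p' q' q] that by simp
  qed (rule 3)
  then obtain a :: "nat \<Rightarrow> real" where a: "\<And>p q. p \<le> q \<Longrightarrow> q < 2 * n \<Longrightarrow>
      a p \<le> a q \<and> (p < q \<longrightarrow> a p < a q) \<and> (Q p q \<longleftrightarrow> a q - a p < 1) \<and> a q - a p \<noteq> 1" by blast
  obtain f g where fg: "\<And>v. v < n \<Longrightarrow> f v < 2 * n \<and> g v < 2 * n \<and> f v < g v \<and> O' (f v) v \<and> O' (g v) v \<and> \<not> Q (f v) (g v) \<and>
      (\<forall>r<2 * n. O' r v \<longrightarrow> r = f v \<or> r = g v)"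
    using 1 by metis
  define h where "h v i = (if i then g v else f v)" for v and i :: bool
  have h: "O' p v \<and> p < 2 * n \<longleftrightarrow> (\<exists>i. p = h v i)" if "v < n" for p v
    using fg[OF that] unfolding ex_bool h_def by auto
  have close: "p \<le> q \<and> Q p q \<or> q \<le> p \<and> Q q p \<longleftrightarrow> \<bar>a p - a q\<bar> \<le> 1" if "p < 2 * n" "q < 2 * n" for p q
    using a[of p q] a[of q p] that by (cases "p \<le> q") (auto simp: abs_if)
  have "represents (\<lambda>v i. a (h v i)) {..<n} E" unfolding represents_def
  proof (intro conjI ballI impI)
    fix v assume v: "v \<in> {..<n}"
    then show "\<bar>a (h v False) - a (h v True)\<bar> > 1"
      using fg[of v] close[of "f v" "g v"] by (auto simp: h_def)
  next
    fix u v assume uv: "u \<in> {..<n}" "v \<in> {..<n}" "u \<noteq> v"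
    have hn: "h u i < 2 * n" "h v i < 2 * n" for i using h[of u "h u i"] h[of v "h v i"] uv by auto
    have "E u v \<longleftrightarrow> (\<exists>p q. (O' p u \<and> p < 2 * n) \<and> (O' q v \<and> q < 2 * n) \<and> (p \<le> q \<and> Q p q \<or> q \<le> p \<and> Q q p))"
      using 2[of u v] uv by auto
    also have "\<dots> \<longleftrightarrow> (\<exists>i k. h u i \<le> h v k \<and> Q (h u i) (h v k) \<or> h v k \<le> h u i \<and> Q (h v k) (h u i))"
      using h[of u] h[of v] uv by auto
    also have "\<dots> \<longleftrightarrow> touch (\<lambda>v i. a (h v i)) u v"
      unfolding touch_def using close[OF hn(1) hn(2)] by simp
    finally show "E u v \<longleftrightarrow> touch (\<lambda>v i. a (h v i)) u v" .
  qed
  then show ?thesis by blast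
qed

lemma layout_code_complete:
  assumes "represents L {..<n} E"
  shows "\<exists>O' Q. layout_code n E O' Q"
proof -
  define X where "X = (\<lambda>(v, i). L v i) ` ({..<n} \<times> (UNIV :: bool set))"
  define rank where "rank x = card {y \<in> X. y < x}" for x
  define O' where "O' p v \<longleftrightarrow> (\<exists>i. p = rank (L v i))" for p v
  \<comment> \<open>Closeness is extended downwards to all pairs nested in a close pair of actual
    endpoints, which makes it monotone at unowned positions too.\<close>
  define Q where "Q p q \<longleftrightarrow> p = q \<or> (\<exists>x\<in>X. \<exists>y\<in>X. rank x \<le> p \<and> q \<le> rank y \<and> y \<le> x + 1)" for p q
  have fin: "finite X" unfolding X_def by simp
  have cX: "card X \<le> 2 * n"
    using card_image_le[of "{..<n} \<times> (UNIV :: bool set)" "\<lambda>(v, i). L v i"] by (simp add: X_def card_cartesian_product mult.commute)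
  have LX: "L v i \<in> X" if "v < n" for v i using that unfolding X_def by force
  have rank_less: "rank x < rank y" if "x < y" "x \<in> X" for x y
    unfolding rank_def using that fin by (intro psubset_card_mono) auto
  have rank_le: "rank x \<le> rank y \<longleftrightarrow> x \<le> y" if "x \<in> X" "y \<in> X" for x y
    using rank_less[of x y] rank_less[of y x] that by (cases x y rule: linorder_cases) auto
  have rank_n: "rank x < 2 * n" if "x \<in> X" for x
  proof -
    have "rank x < card X" unfolding rank_def using that fin by (intro psubset_card_mono) auto
    then show ?thesis using cX by simp
  qed
  have Q: "Q (rank x) (rank y) \<longleftrightarrow> y \<le> x + 1" if xy: "x \<in> X" "y \<in> X" "x \<le> y" for x y
  proof
    assume "Q (rank x) (rank y)"
    then consider "rank x = rank y" | x' y' where "x' \<in> X" "y' \<in> X" "rank x' \<le> rank x" "rank y \<le> rank y'" "y' \<le> x' + 1"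
      unfolding Q_def by blast
    then show "y \<le> x + 1"
    proof cases
      case 1
      then have "y \<le> x" using rank_le[OF xy(2,1)] by simp
      then show ?thesis by simp
    next
      case 2
      then have "x' \<le> x" "y \<le> y'" using rank_le xy by auto
      then show ?thesis using 2 by simp
    qed
  next
    assume "y \<le> x + 1"
    then show "Q (rank x) (rank y)" unfolding Q_def using xy(1,2) by blast
  qed
  have close: "rank x \<le> rank y \<and> Q (rank x) (rank y) \<or> rank y \<le> rank x \<and> Q (rank y) (rank x) \<longleftrightarrow> \<bar>x - y\<bar> \<le> 1"
    if "x \<in> X" "y \<in> X" for x y
    using rank_le[OF that] rank_le[OF that(2,1)] Q[OF that] Q[OF that(2,1)] by (cases "x \<le> y") (auto simp: abs_if)
  have "layout_code n E O' Q" unfolding layout_code_def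
  proof (intro conjI allI impI)
    fix v assume v: "v < n"
    have far: "\<bar>L v False - L v True\<bar> > 1" using assms v by (simp add: represents_def)
    obtain i where i: "L v i < L v (\<not> i)" using far by (cases "L v False < L v True") (force intro: that[of False], force intro: that[of True])
    have "\<not> Q (rank (L v i)) (rank (L v (\<not> i)))" using Q[OF LX[OF v] LX[OF v], of i "\<not> i"] i far by (cases i) auto
    moreover have "r = rank (L v i) \<or> r = rank (L v (\<not> i))" if own: "O' r v" for r
    proof -
      obtain k where k: "r = rank (L v k)" using own unfolding O'_def by blast
      have "k = i \<or> k = (\<not> i)" by blast
      then show ?thesis using k by blast
    qed
    moreover have "O' (rank (L v i)) v" "O' (rank (L v (\<not> i))) v" unfolding O'_def by blast+
    ultimately show "\<exists>p<2 * n. \<exists>q<2 * n. p < q \<and> O' p v \<and> O' q v \<and> \<not> Q p q \<and> (\<forall>r<2 * n. O' r v \<longrightarrow> r = p \<or> r = q)"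
      using rank_n[OF LX[OF v]] rank_less[OF i LX[OF v]] by blast
  next
    fix u v assume uv: "u < n" "v < n" "u \<noteq> v"
    have "E u v \<longleftrightarrow> (\<exists>i k. \<bar>L u i - L v k\<bar> \<le> 1)" using assms uv by (simp add: represents_def touch_def)
    also have "\<dots> \<longleftrightarrow> (\<exists>i k. rank (L u i) \<le> rank (L v k) \<and> Q (rank (L u i)) (rank (L v k)) \<or>
        rank (L v k) \<le> rank (L u i) \<and> Q (rank (L v k)) (rank (L u i)))"
      using close[OF LX[OF uv(1)] LX[OF uv(2)]] by simp
    also have "\<dots> \<longleftrightarrow> (\<exists>p<2 * n. \<exists>q<2 * n. O' p u \<and> O' q v \<and> (p \<le> q \<and> Q p q \<or> q \<le> p \<and> Q q p))"
      using rank_n[OF LX[OF uv(1)]] rank_n[OF LX[OF uv(2)]] unfolding O'_def by blast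
    finally show "E u v \<longleftrightarrow> (\<exists>p<2 * n. \<exists>q<2 * n. O' p u \<and> O' q v \<and> (p \<le> q \<and> Q p q \<or> q \<le> p \<and> Q q p))" .
  next
    fix p p' q' q assume "p \<le> p' \<and> p' \<le> q' \<and> q' \<le> q \<and> Q p q"
    then show "Q p' q'" unfolding Q_def by (auto intro: le_trans)
  qed (simp add: Q_def)
  then show ?thesis by blast
qed

section \<open>The verifier formula\<close>

definition FAll :: "nat \<Rightarrow> trm \<Rightarrow> fm \<Rightarrow> fm" where "FAll v t f = FNot (FEx v t (FNot f))"
definition FImp :: "fm \<Rightarrow> fm \<Rightarrow> fm" where "FImp f g = FOr (FNot f) g"

lemma sem_all_imp [simp]: "sem w e (FAll v t f) \<longleftrightarrow> (\<forall>z<val e t. sem w (e(v := z)) f)"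
    "sem w e (FImp f g) \<longleftrightarrow> (sem w e f \<longrightarrow> sem w e g)"
  by (auto simp: FAll_def FImp_def)

lemma wff_all_imp [simp]: "wff K S (FAll v t f) \<longleftrightarrow> wff K S (FEx v t f)" "wff K S (FImp f g) \<longleftrightarrow> wff K S f \<and> wff K S g"
  by (auto simp: FAll_def FImp_def)

text \<open>
  Variable 1 is the position of the separator, variable 2 the number of vertices. The certificate
  lists the truth values of \<open>O'\<close> and then those of \<open>Q\<close>.
\<close>

definition edge_at :: "trm \<Rightarrow> trm \<Rightarrow> fm" where "edge_at u v = FSym 2 (TAdd (TMul u (TV 2)) v)"
definition own_at :: "trm \<Rightarrow> trm \<Rightarrow> fm" where
  "own_at p v = FSym 2 (TAdd (TAdd (TV 1) (TC 1)) (TAdd (TMul p (TV 2)) v))"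
definition close_at :: "trm \<Rightarrow> trm \<Rightarrow> fm" where
  "close_at p q = FSym 2 (TAdd (TAdd (TV 1) (TC 1)) (TAdd (TMul (TC 2) (TMul (TV 2) (TV 2)))
     (TAdd (TMul p (TMul (TC 2) (TV 2))) q)))"

definition simple_fm :: fm where
  "simple_fm = FAnd (FAll 3 (TV 2) (FNot (edge_at (TV 3) (TV 3))))
     (FAll 3 (TV 2) (FAll 4 (TV 2) (FImp (edge_at (TV 3) (TV 4)) (edge_at (TV 4) (TV 3)))))"

text \<open>The \<open>k\<close> neighbours of the vertex in variable 3 are chosen in increasing
  order, starting from \<open>l\<close>, which makes them distinct without pairwise
  comparisons.\<close>

primrec degree_fm :: "nat \<Rightarrow> trm \<Rightarrow> fm" where
  "degree_fm 0 l = FLe (TC 0) (TC 0)"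
| "degree_fm (Suc k) l = FEx (4 + k) (TV 2)
     (FAnd (FLe l (TV (4 + k))) (FAnd (edge_at (TV 3) (TV (4 + k))) (degree_fm k (TAdd (TV (4 + k)) (TC 1)))))"

definition code_fm :: fm where
  "code_fm = (let n2 = TMul (TC 2) (TV 2) in FConj [
     FAll 3 (TV 2) (FEx 4 n2 (FEx 5 n2 (FConj [FLt (TV 4) (TV 5), own_at (TV 4) (TV 3), own_at (TV 5) (TV 3),
       FNot (close_at (TV 4) (TV 5)), FAll 6 n2 (FImp (own_at (TV 6) (TV 3)) (FOr (FEq (TV 6) (TV 4)) (FEq (TV 6) (TV 5))))]))),
     FAll 3 (TV 2) (FAll 4 (TV 2) (FImp (FNot (FEq (TV 3) (TV 4))) (let X = FEx 5 n2 (FEx 6 n2 (FConj [own_at (TV 5) (TV 3), own_at (TV 6) (TV 4),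
       FOr (FAnd (FLe (TV 5) (TV 6)) (close_at (TV 5) (TV 6))) (FAnd (FLe (TV 6) (TV 5)) (close_at (TV 6) (TV 5)))])) in
       FAnd (FImp (edge_at (TV 3) (TV 4)) X) (FImp X (edge_at (TV 3) (TV 4)))))),
     FAll 3 n2 (close_at (TV 3) (TV 3)),
     FAll 3 n2 (FAll 4 n2 (FAll 5 n2 (FAll 6 n2 (FImp (FConj [FLe (TV 3) (TV 4), FLe (TV 4) (TV 5), FLe (TV 5) (TV 6), close_at (TV 3) (TV 6)])
       (close_at (TV 4) (TV 5))))))])"

definition verifier_fm :: "bool \<Rightarrow> fm" where
  "verifier_fm d = FEx 1 (TV 0) (FEx 2 (TV 0) (FConj [FSym 3 (TV 1), FEq (TMul (TV 2) (TV 2)) (TV 1), simple_fm,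
     if d then FAll 3 (TV 2) (FNot (degree_fm 8 (TC 0))) else FLe (TC 0) (TC 0), code_fm]))"

lemma degree_fm_wff: "k \<le> 8 \<Longrightarrow> tvars l \<subseteq> {..<12} \<Longrightarrow> S \<inter> {4..<4 + k} = {} \<Longrightarrow> wff 12 S (degree_fm k l)"
proof (induction k arbitrary: l S)
  case (Suc k)
  have "wff 12 (insert (4 + k) S) (degree_fm k (TAdd (TV (4 + k)) (TC 1)))"
    by (rule Suc.IH) (use Suc.prems in auto)
  then show ?case using Suc.prems by (auto simp: edge_at_def)
qed simp

lemma verifier_wff: "wff 12 {0} (verifier_fm d)"
  unfolding verifier_fm_def using degree_fm_wff[of 8 "TC 0" "{3, 2, 1, 0}"]
  by (simp add: simple_fm_def code_fm_def edge_at_def own_at_def close_at_def Let_def insert_commute)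

text \<open>Splitting off the least element gives the recursion behind
  \<open>degree_fm\<close>.\<close>

lemma card_first:
  fixes n :: nat
  shows "Suc k \<le> card {z. l \<le> z \<and> z < n \<and> P z} \<longleftrightarrow> (\<exists>z<n. l \<le> z \<and> P z \<and> k \<le> card {y. Suc z \<le> y \<and> y < n \<and> P y})"
proof
  let ?A = "{z. l \<le> z \<and> z < n \<and> P z}"
  assume k: "Suc k \<le> card ?A"
  then have "0 < card ?A" by linarith
  then have ne: "?A \<noteq> {}" "finite ?A" unfolding card_gt_0_iff by blast+
  define z where "z = Min ?A"
  have z: "z \<in> ?A" unfolding z_def using ne by (intro Min_in) auto
  have "?A - {z} \<subseteq> {y. Suc z \<le> y \<and> y < n \<and> P y}"
  proof
    fix y assume y: "y \<in> ?A - {z}"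
    then have "z \<le> y" unfolding z_def using ne by (intro Min_le) auto
    then show "y \<in> {y. Suc z \<le> y \<and> y < n \<and> P y}" using y by auto
  qed
  then have "card (?A - {z}) \<le> card {y. Suc z \<le> y \<and> y < n \<and> P y}" by (intro card_mono) auto
  moreover have "card (?A - {z}) = card ?A - 1" using z by (simp add: card_Diff_singleton)
  ultimately show "\<exists>z<n. l \<le> z \<and> P z \<and> k \<le> card {y. Suc z \<le> y \<and> y < n \<and> P y}" using k z by (intro exI[of _ z]) auto
next
  assume "\<exists>z<n. l \<le> z \<and> P z \<and> k \<le> card {y. Suc z \<le> y \<and> y < n \<and> P y}"
  then obtain z where z: "z < n" "l \<le> z" "P z" "k \<le> card {y. Suc z \<le> y \<and> y < n \<and> P y}" by blast
  have "card (insert z {y. Suc z \<le> y \<and> y < n \<and> P y}) \<le> card {z. l \<le> z \<and> z < n \<and> P z}"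
    using z by (intro card_mono) auto
  then show "Suc k \<le> card {z. l \<le> z \<and> z < n \<and> P z}" using z(4) by simp
qed

lemma sem_degree_fm:
  assumes "e 2 = n" "e 3 = v" "tvars l \<inter> {4..<4 + k} = {}"
  shows "sem w e (degree_fm k l) \<longleftrightarrow> k \<le> card {z. val e l \<le> z \<and> z < n \<and> sym_at w (v * n + z) = 2}"
  using assms
proof (induction k arbitrary: e l)
  case (Suc k)
  have l: "val (e(4 + k := z)) l = val e l" for z using Suc.prems(3) by (intro val_cong) auto
  have "sem w (e(4 + k := z)) (degree_fm k (TAdd (TV (4 + k)) (TC 1))) \<longleftrightarrow>
      k \<le> card {y. Suc z \<le> y \<and> y < n \<and> sym_at w (v * n + y) = 2}" for z
  proof -
    have *: "(e(4 + k := z)) 2 = n" "(e(4 + k := z)) 3 = v" "tvars (TAdd (TV (4 + k)) (TC 1)) \<inter> {4..<4 + k} = {}"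
      using Suc.prems(1,2) by auto
    show ?thesis unfolding Suc.IH[OF *] by simp
  qed
  then show ?case unfolding card_first using l Suc.prems(1,2) by (simp add: edge_at_def)
qed simp

lemma sem_simple_fm:
  assumes "e 2 = n"
  shows "sem w e simple_fm \<longleftrightarrow> simple_graph {..<n} (\<lambda>u v. sym_at w (u * n + v) = 2)"
  using assms by (simp add: simple_fm_def edge_at_def simple_graph_def Ball_def)

lemma sem_code_fm:
  assumes "e 1 = m" "e 2 = n"
  shows "sem w e code_fm \<longleftrightarrow> layout_code n (\<lambda>u v. sym_at w (u * n + v) = 2)
    (\<lambda>p v. sym_at w (Suc (m + (p * n + v))) = 2) (\<lambda>p q. sym_at w (Suc (m + (2 * (n * n) + (p * (2 * n) + q)))) = 2)"
  using assms by (simp add: code_fm_def layout_code_def Let_def edge_at_def own_at_def close_at_def iff_conv_conj_imp[symmetric] conj_assoc)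

lemma sym_pair:
  "i < length x \<Longrightarrow> sym_at (encode_pair x y) i = 2 \<longleftrightarrow> x ! i"
  "sym_at (encode_pair x y) i = 3 \<longleftrightarrow> i = length x"
  "sym_at (encode_pair x y) (Suc (length x + i)) = 2 \<longleftrightarrow> i < length y \<and> y ! i"
proof -
  have "sym_at (encode_pair x y) i = (if i < length x then if x ! i then 2 else 1 else if i = length x then 3
      else if i < Suc (length x + length y) then if y ! (i - Suc (length x)) then 2 else 1 else 0)" for i
    by (auto simp: sym_at_def encode_pair_def encode_word_def nth_append nth_Cons' )
  note * = this
  show "i < length x \<Longrightarrow> sym_at (encode_pair x y) i = 2 \<longleftrightarrow> x ! i" "sym_at (encode_pair x y) i = 3 \<longleftrightarrow> i = length x"
    "sym_at (encode_pair x y) (Suc (length x + i)) = 2 \<longleftrightarrow> i < length y \<and> y ! i" unfolding * by auto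
qed

lemma layout_code_cong:
  assumes "\<And>u v. u < n \<Longrightarrow> v < n \<Longrightarrow> E u v \<longleftrightarrow> E' u v" "\<And>p v. p < 2 * n \<Longrightarrow> v < n \<Longrightarrow> O' p v \<longleftrightarrow> O'' p v"
    "\<And>p q. p < 2 * n \<Longrightarrow> q < 2 * n \<Longrightarrow> Q p q \<longleftrightarrow> Q' p q"
  shows "layout_code n E O' Q \<longleftrightarrow> layout_code n E' O'' Q'"
  unfolding layout_code_def using assms by (simp cong: conj_cong imp_cong)

text \<open>A code has \<open>2 * n * n\<close> bits for \<open>O'\<close> and
  \<open>4 * n * n\<close> for \<open>Q\<close>, together six times the length of the input. Beyond
  the end of a shorter certificate all bits read as false, so every bounded word describes some
  candidate code.\<close>

lemma verifier_iff:
  "(\<exists>y. length y \<le> 6 * length x \<and> sem (encode_pair x y) (env0 (encode_pair x y)) (verifier_fm d)) \<longleftrightarrow>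
   (\<exists>n E. x = encode_graph n E \<and> simple_graph {..<n} E \<and> (d \<longrightarrow> max_degree_le 7 {..<n} E) \<and> unit_d_interval_graph 2 {..<n} E)"
  (is "?l \<longleftrightarrow> ?r")
proof -
  define E where "E y n u v \<longleftrightarrow> sym_at (encode_pair x y) (u * n + v) = 2" for y :: "bool list" and n u v
  define O' where "O' y n p v \<longleftrightarrow> sym_at (encode_pair x y) (Suc (n * n + (p * n + v))) = 2" for y :: "bool list" and n p v
  define Q where "Q y n p q \<longleftrightarrow> sym_at (encode_pair x y) (Suc (n * n + (2 * (n * n) + (p * (2 * n) + q)))) = 2" for y :: "bool list" and n p q
  have deg: "(\<forall>v<n. \<not> 8 \<le> card {z. z < n \<and> E y n v z}) \<longleftrightarrow> max_degree_le 7 {..<n} (E y n)" for n y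
    unfolding max_degree_le_def degree_in_def by (auto simp: not_le less_Suc_eq_le eval_nat_numeral)
  have sem: "sem (encode_pair x y) (env0 (encode_pair x y)) (verifier_fm d) \<longleftrightarrow>
      (\<exists>n. n * n = length x \<and> simple_graph {..<n} (E y n) \<and> (d \<longrightarrow> max_degree_le 7 {..<n} (E y n)) \<and> layout_code n (E y n) (O' y n) (Q y n))"
    for y
  proof -
    let ?w = "encode_pair x y"
    have len: "length ?w = Suc (length x + length y)" by (simp add: encode_pair_def encode_word_def)
    have inner: "sem ?w ((env0 ?w)(1 := m, 2 := n)) (FConj [FSym 3 (TV 1), FEq (TMul (TV 2) (TV 2)) (TV 1), simple_fm,
       if d then FAll 3 (TV 2) (FNot (degree_fm 8 (TC 0))) else FLe (TC 0) (TC 0), code_fm]) \<longleftrightarrow>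
      m = length x \<and> n * n = length x \<and> simple_graph {..<n} (E y n) \<and> (d \<longrightarrow> max_degree_le 7 {..<n} (E y n)) \<and> layout_code n (E y n) (O' y n) (Q y n)" for m n
    proof -
      let ?e = "(env0 ?w)(1 := m, 2 := n)"
      have e: "?e 1 = m" "?e 2 = n" by simp_all
      have dg: "sem ?w (?e(3 := v)) (degree_fm 8 (TC 0)) \<longleftrightarrow> 8 \<le> card {z. z < n \<and> E y n v z}" for v
        using sem_degree_fm[of "?e(3 := v)" n v "TC 0" 8 ?w] by (simp add: E_def)
      have "sem ?w ?e (if d then FAll 3 (TV 2) (FNot (degree_fm 8 (TC 0))) else FLe (TC 0) (TC 0)) \<longleftrightarrow> (d \<longrightarrow> max_degree_le 7 {..<n} (E y n))"
        unfolding deg[symmetric] using dg by simp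
      then show ?thesis using sem_simple_fm[of ?e n ?w, OF e(2)] sem_code_fm[of ?e m n ?w, OF e] sym_pair(2)[of x y m]
        unfolding E_def[abs_def] O'_def[abs_def] Q_def[abs_def] by auto
    qed
    have small: "n < length ?w" if "n * n = length x" for n
      using that len le_square[of n] by simp
    have v: "val (env0 ?w) (TV 0) = length ?w" "val ((env0 ?w)(1 := m)) (TV 0) = length ?w" for m
      by (simp_all add: env0_def)
    have lx: "length x < length ?w" using len by simp
    show ?thesis unfolding verifier_fm_def sem.simps(5) inner v using small lx by blast
  qed
  have graph: "x = encode_graph n (E y n)" if "n * n = length x" for n y
  proof (rule nth_equalityI)
    fix i assume i: "i < length x"
    then have n: "0 < n" using that by (cases n) auto
    have "i div n < n" using i that[symmetric] by (simp add: less_mult_imp_div_less)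
    then have "encode_graph n (E y n) ! (i div n * n + i mod n) = E y n (i div n) (i mod n)" using n by (intro nth_encode_graph) auto
    then show "x ! i = encode_graph n (E y n) ! i" using sym_pair(1)[OF i, of y] by (simp add: E_def)
  qed (use that in \<open>simp add: length_encode_graph\<close>)
  show ?thesis
  proof
    assume ?l
    then obtain y n where *: "n * n = length x" "simple_graph {..<n} (E y n)" "d \<longrightarrow> max_degree_le 7 {..<n} (E y n)" "layout_code n (E y n) (O' y n) (Q y n)"
      unfolding sem by blast
    have "unit_d_interval_graph 2 {..<n} (E y n)" using layout_code_sound[OF *(4)] unfolding unit_2_interval_graph_iff .
    then show ?r using graph[OF *(1), of y] * by blast
  next
    assume ?r
    then obtain n E0 where *: "x = encode_graph n E0" "simple_graph {..<n} E0" "d \<longrightarrow> max_degree_le 7 {..<n} E0"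
      "unit_d_interval_graph 2 {..<n} E0" by blast
    have len: "length x = n * n" using *(1) by (simp add: length_encode_graph)
    have EE: "E y n u v \<longleftrightarrow> E0 u v" if "u < n" "v < n" for y u v
    proof -
      have "u * n + v < length x" unfolding len using mult_right_mono[of "Suc u" n n] that by simp
      from sym_pair(1)[OF this, of y] show ?thesis using nth_encode_graph[OF that, of E0] *(1) by (simp add: E_def)
    qed
    obtain O0 Q0 where c: "layout_code n E0 O0 Q0"
      using *(4) layout_code_complete unfolding unit_2_interval_graph_iff by blast
    define y where "y = map (\<lambda>k. if k < 2 * (n * n) then O0 (k div n) (k mod n)
      else Q0 ((k - 2 * (n * n)) div (2 * n)) ((k - 2 * (n * n)) mod (2 * n))) [0..<6 * (n * n)]"
    have ly: "length y = 6 * (n * n)" by (simp add: y_def)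
    have OO: "O' y n p v \<longleftrightarrow> O0 p v" if "p < 2 * n" "v < n" for p v
    proof -
      have lt: "p * n + v < 2 * (n * n)" using mult_right_mono[of "Suc p" "2 * n" n] that by simp
      then have "y ! (p * n + v) = O0 p v" unfolding y_def using divmod_pair[OF that(2), of p] by simp
      then show ?thesis unfolding O'_def len[symmetric] sym_pair(3) using lt ly by simp
    qed
    have QQ: "Q y n p q \<longleftrightarrow> Q0 p q" if "p < 2 * n" "q < 2 * n" for p q
    proof -
      have lt: "p * (2 * n) + q < 4 * (n * n)" using mult_right_mono[of "Suc p" "2 * n" "2 * n"] that by simp
      then have "y ! (2 * (n * n) + (p * (2 * n) + q)) = Q0 p q" unfolding y_def using divmod_pair[OF that(2), of p] by simp
      then show ?thesis using sym_pair(3)[of x y "2 * (n * n) + (p * (2 * n) + q)"] lt ly unfolding Q_def len by simp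
    qed
    have "layout_code n (E y n) (O' y n) (Q y n)" using layout_code_cong[of n "E y n" E0 "O' y n" O0 "Q y n" Q0, OF EE OO QQ] c by blast
    moreover have "simple_graph {..<n} (E y n)" "d \<longrightarrow> max_degree_le 7 {..<n} (E y n)"
    proof -
      show "simple_graph {..<n} (E y n)" using *(2) EE unfolding simple_graph_def by auto
      have "{u \<in> {..<n}. E y n v u} = {u \<in> {..<n}. E0 v u}" if "v < n" for v using EE[OF that] by blast
      then show "d \<longrightarrow> max_degree_le 7 {..<n} (E y n)" using *(3) unfolding max_degree_le_def degree_in_def by simp
    qed
    ultimately show ?l unfolding sem using len ly by (intro exI[of _ y]) auto
  qed
qed

theorem recognition_in_NP: "in_NP unit_2_interval_recognition" "in_NP (unit_2_interval_recognition_max_degree 7)"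
proof -
  have "in_NP L" if "\<And>x. x \<in> L \<longleftrightarrow> (\<exists>y. length y \<le> 6 * length x \<and> sem (encode_pair x y) (env0 (encode_pair x y)) (verifier_fm d))" for L d
    unfolding in_NP_def
  proof (intro exI[of _ "\<lambda>x y. sem (encode_pair x y) (env0 (encode_pair x y)) (verifier_fm d)"] exI[of _ "[:0, 6:]"] conjI allI)
    show "polytime_decidable_rel (\<lambda>x y. sem (encode_pair x y) (env0 (encode_pair x y)) (verifier_fm d))"
      by (rule decide_formula[OF verifier_wff]) simp
  qed (simp add: that mult.commute)
  from this[of _ False] this[of _ True]
  show "in_NP unit_2_interval_recognition" "in_NP (unit_2_interval_recognition_max_degree 7)"
    unfolding verifier_iff by (auto simp: unit_2_interval_recognition_def unit_2_interval_recognition_max_degree_def)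
qed

theorem theorem9:
  "NP_complete unit_2_interval_recognition \<and>
   NP_complete (unit_2_interval_recognition_max_degree 7)"
  using recognition_in_NP recognition_NP_hard unfolding NP_complete_def by blast

end
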